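(* Let $d\ge1$, $\beta>2$, $1\le p,q\le\infty$, $s\in\mathbb{R}$. If $$\|S_\beta(t)u\|_{L^p(I\times\mathbb{R}^d)}\le C\|u\|_{M^{s}_{p,q}}\quad\text{for all }u\in M^{s}_{p,q},$$ then $$s\ge\max\Big\{d\Big(1-\frac1p-\frac1q\Big)-\frac\beta p,\ d(\beta-2)\Big(\frac1p-\frac12\Big)+d\Big(\frac1p-\frac1q\Big)\Big\}.$$ Moreover, if in addition $p\le2$ and $p\ge q$, then $s\ge d(\beta-2)\left(\frac1p-\frac12\right)$.
   Context: $I=[0,1]$. For $\beta>0$, $S_\beta(t)=\mathcal{F}^{-1}e^{it|\xi|^\beta}\mathcal{F}$ on $\mathbb{R}^d$. $\langle x\rangle=(1+|x|^2)^{1/2}$. Modulation spaces: let $\{\eta_k\}_{k\in\mathbb{Z}^d}$ be Schwartz functions with $|\eta_k(\xi)|\gtrsim1$ if $|\xi-k|<c$, $\operatorname{supp}\eta_k\subseteq\{|\xi-k|<C\}$, $\sum_k\eta_k\equiv1$, uniformly bounded derivatives; $\Box_k=\mathcal{F}^{-1}\eta_k\mathcal{F}$. $\|f\|_{M^s_{p,q}}=\big(\sum_{k\in\mathbb{Z}^d}\langle k\rangle^{sq}\|\Box_k f\|_{L^p}^q\big)^{1/q}$ (usual modification for $q=\infty$). *)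

theory Defs
  imports "HOL-Analysis.Analysis"
begin

definition pder :: "'n::finite \<Rightarrow> (real^'n \<Rightarrow> complex) \<Rightarrow> real^'n \<Rightarrow> complex" where
  "pder i f x = vector_derivative (\<lambda>h. f (x + h *\<^sub>R axis i 1)) (at 0)"

fun pders :: "'n::finite list \<Rightarrow> (real^'n \<Rightarrow> complex) \<Rightarrow> real^'n \<Rightarrow> complex" where
  "pders [] f = f"
| "pders (i # is) f = pder i (pders is f)"

definition smooth_fn :: "(real^'n::finite \<Rightarrow> complex) \<Rightarrow> bool" where
  "smooth_fn f \<longleftrightarrow> (\<forall>is. continuous_on UNIV (pders is f) \<and>
      (\<forall>i x. (\<lambda>h. pders is f (x + h *\<^sub>R axis i 1)) differentiable (at 0)))"

definition schwartz :: "(real^'n::finite \<Rightarrow> complex) \<Rightarrow> bool" where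
  "schwartz f \<longleftrightarrow> smooth_fn f \<and>
     (\<forall>is (m::nat). bounded (range (\<lambda>x. ((1 + norm x) ^ m) *\<^sub>R pders is f x)))"

definition fourier :: "(real^'n::finite \<Rightarrow> complex) \<Rightarrow> real^'n \<Rightarrow> complex" where
  "fourier f \<xi> = integral\<^sup>L lborel (\<lambda>x. exp (- \<i> * complex_of_real (x \<bullet> \<xi>)) * f x)"

definition ifourier :: "(real^'n::finite \<Rightarrow> complex) \<Rightarrow> real^'n \<Rightarrow> complex" where
  "ifourier g x = complex_of_real (1 / (2 * pi) ^ CARD('n)) *
      integral\<^sup>L lborel (\<lambda>\<xi>. exp (\<i> * complex_of_real (x \<bullet> \<xi>)) * g \<xi>)"

definition schro :: "real \<Rightarrow> real \<Rightarrow> (real^'n::finite \<Rightarrow> complex) \<Rightarrow> real^'n \<Rightarrow> complex" where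
  "schro \<beta> t u = ifourier (\<lambda>\<xi>. exp (\<i> * complex_of_real (t * norm \<xi> powr \<beta>)) * fourier u \<xi>)"

definition lattice :: "(real^'n::finite) set" where
  "lattice = {k. \<forall>i. k $ i \<in> \<int>}"

definition jb :: "real^'n::finite \<Rightarrow> real" where
  "jb x = sqrt (1 + norm x ^ 2)"

definition admissible :: "(real^'n::finite \<Rightarrow> real^'n \<Rightarrow> complex) \<Rightarrow> bool" where
  "admissible \<eta> \<longleftrightarrow>
     (\<forall>k\<in>lattice. schwartz (\<eta> k)) \<and>
     (\<exists>c a. c > 0 \<and> a > 0 \<and> (\<forall>k\<in>lattice. \<forall>\<xi>. norm (\<xi> - k) < c \<longrightarrow> norm (\<eta> k \<xi>) \<ge> a)) \<and>
     (\<exists>C. C > 0 \<and> (\<forall>k\<in>lattice. \<forall>\<xi>. norm (\<xi> - k) \<ge> C \<longrightarrow> \<eta> k \<xi> = 0)) \<and>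
     (\<forall>\<xi>. ((\<lambda>k. \<eta> k \<xi>) has_sum 1) lattice) \<and>
     (\<forall>is. \<exists>B. \<forall>k\<in>lattice. \<forall>\<xi>. norm (pders is (\<eta> k) \<xi>) \<le> B)"

definition box :: "(real^'n::finite \<Rightarrow> real^'n \<Rightarrow> complex) \<Rightarrow> real^'n \<Rightarrow> (real^'n \<Rightarrow> complex) \<Rightarrow> real^'n \<Rightarrow> complex" where
  "box \<eta> k u = ifourier (\<lambda>\<xi>. \<eta> k \<xi> * fourier u \<xi>)"

text \<open>x^r for extended nonnegative reals, r > 0 (infinity stays infinity).\<close>
definition epow :: "ennreal \<Rightarrow> real \<Rightarrow> ennreal" where
  "epow x r = (if x = \<infinity> then \<infinity> else ennreal (enn2real x powr r))"

definition lpn :: "'a measure \<Rightarrow> ennreal \<Rightarrow> ('a \<Rightarrow> complex) \<Rightarrow> ennreal" where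
  "lpn M p f = (if p = \<infinity> then Inf {c. AE x in M. ennreal (norm (f x)) \<le> c}
     else epow (\<integral>\<^sup>+ x. ennreal (norm (f x) powr enn2real p) \<partial>M) (1 / enn2real p))"

definition modn :: "(real^'n::finite \<Rightarrow> real^'n \<Rightarrow> complex) \<Rightarrow> ennreal \<Rightarrow> ennreal \<Rightarrow> real
     \<Rightarrow> (real^'n \<Rightarrow> complex) \<Rightarrow> ennreal" where
  "modn \<eta> p q s u = (if q = \<infinity> then (SUP k\<in>lattice. ennreal (jb k powr s) * lpn lborel p (box \<eta> k u))
     else epow (\<integral>\<^sup>+ k. ennreal (jb k powr (s * enn2real q)) * epow (lpn lborel p (box \<eta> k u)) (enn2real q)
                  \<partial>count_space lattice) (1 / enn2real q))"

definition stn :: "ennreal \<Rightarrow> (real \<times> (real^'n::finite) \<Rightarrow> complex) \<Rightarrow> ennreal" where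
  "stn p F = lpn (restrict_space lborel ({0..1} \<times> UNIV)) p F"

end

(* A frequency bump of width rho, centred at a point z of size N, is tested in the estimate. All
   its frequency pieces are concentrated at the origin at time 0, which bounds the modulation
   norm by a multiple of N^s (1 + rho)^(d/q). For the lower bound, convolve the solution at time t
   with a modulated Gaussian of spatial width 1/mu. Near the classical position
   x = - t grad(|xi|^beta)(kappa) this isolates the frequencies within mu of kappa, on which the
   phase deviates from its linearisation by O(t N^(beta-2) mu^2). If that is small there is no
   cancellation, and the average has modulus at least a constant times mu^d. Jensen's inequality
   turns this into a lower bound for a local L^p average, and averaging over kappa in the support
   of the bump gives the L^p norm, because the map from kappa to x expands distances by
   t N^(beta-2). The first condition comes from t ~ N^(-beta), mu ~ rho ~ N, the second from t ~ 1,
   mu ~ N^(-(beta-2)/2), rho ~ N, and the last one from the same t and mu with rho ~ 1. *)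
theory Submission
  imports Defs "HOL-Probability.Characteristic_Functions" "HOL-Probability.Sinc_Integral"
begin

section \<open>Integration on Euclidean spaces and Gaussians\<close>

text \<open>The bump must have an exactly known transform, so it is a rescaled copy of
  \<open>\<eta> 0\<close>: admissibility supplies its continuity, its support and its lower bound
  near 0, while the uniform decay of the kernels makes its inverse transform integrable, with an L^1
  norm that dilation and modulation leave unchanged. The lower bound concerns weighted averages of
  the solution instead of pointwise values, so a tangent-plane estimate of |xi|^\<beta> with
  quadratic remainder takes the place of an asymptotic expansion. The window is Gaussian because its
  transform is again Gaussian, its mass is explicit, and its second moment absorbs the quadratic
  errors of phase and amplitude alike. The same packet identity, with a window that shrinks in
  frequency, proves Fourier inversion. The expansion property of the map from \<kappa> to x enters
  through a single number Z, a bound for the total overlap of packets at any one point. All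
  constants are fixed before N, so that letting N tend to infinity turns an inequality between
  powers into one between exponents. The exponent 1/p is read as 0 at p = \<infinity>.\<close>

lemma nn_integral_lborel_affine:
  fixes f :: "'a::euclidean_space \<Rightarrow> ennreal"
  assumes [measurable]: "f \<in> borel_measurable borel" and c: "c \<noteq> 0"
  shows "(\<integral>\<^sup>+x. f x \<partial>lborel) = ennreal (\<bar>c\<bar> ^ DIM('a)) * (\<integral>\<^sup>+x. f (t + c *\<^sub>R x) \<partial>lborel)"
  by (subst lborel_affine[OF c, of t])
     (simp add: nn_integral_density nn_integral_distr nn_integral_cmult)

lemma integrable_lborel_affine:
  fixes f :: "'a::euclidean_space \<Rightarrow> 'b::{banach, second_countable_topology}"
  assumes f: "integrable lborel f" and c: "c \<noteq> 0"
  shows "integrable lborel (\<lambda>x. f (t + c *\<^sub>R x))"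
proof -
  have [measurable]: "f \<in> borel_measurable borel"
    using f by (simp add: borel_measurable_integrable)
  have "(\<integral>\<^sup>+x. ennreal (norm (f x)) \<partial>lborel) < \<infinity>"
    using f by (simp add: integrable_iff_bounded)
  then have "(\<integral>\<^sup>+x. ennreal (norm (f (t + c *\<^sub>R x))) \<partial>lborel) < \<infinity>"
    by (subst (asm) nn_integral_lborel_affine[OF _ c, of _ t])
       (auto simp: ennreal_mult_less_top c)
  then show ?thesis by (simp add: integrable_iff_bounded)
qed

lemma integral_lborel_affine:
  fixes f :: "'a::euclidean_space \<Rightarrow> complex"
  assumes [measurable]: "f \<in> borel_measurable borel" and c: "c \<noteq> 0"
  shows "(\<integral>x. f x \<partial>lborel) = of_real (\<bar>c\<bar> ^ DIM('a)) * (\<integral>x. f (t + c *\<^sub>R x) \<partial>lborel)"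
  by (subst lborel_affine[OF c, of t])
     (simp add: integral_density integral_distr scaleR_conv_of_real)

text \<open>\<open>lborel_eq\<close> presents Lebesgue measure as the image of a product measure
  under \<open>g \<mapsto> \<Sum>b\<in>Basis. g b *\<^sub>R b\<close>, so a function that separates
  in coordinates becomes a product integrand. This serves both the Gaussian and the weight
  \<open>decay\<close>.\<close>

lemma lborel_prod_Basis:
  fixes f :: "'a::euclidean_space \<Rightarrow> real \<Rightarrow> complex"
  assumes f: "\<And>b. b \<in> Basis \<Longrightarrow> integrable lborel (f b)"
  shows integrable_lborel_prod: "integrable lborel (\<lambda>x. \<Prod>b\<in>Basis. f b (x \<bullet> b))"
    and integral_lborel_prod:
      "(\<integral>x. (\<Prod>b\<in>Basis. f b (x \<bullet> b)) \<partial>lborel) = (\<Prod>b\<in>Basis. \<integral>x. f b x \<partial>lborel)"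
proof -
  interpret product_sigma_finite "\<lambda>_::'a. lborel :: real measure" ..
  have [measurable]: "\<And>b. b \<in> Basis \<Longrightarrow> f b \<in> borel_measurable borel"
    using f by (metis borel_measurable_integrable measurable_lborel2)
  have *: "(\<Prod>b\<in>Basis. f b ((\<Sum>b\<in>Basis. g b *\<^sub>R b) \<bullet> b)) = (\<Prod>b\<in>Basis. f b (g b))" for g :: "'a \<Rightarrow> real"
    by (intro prod.cong) (auto simp: inner_sum_left inner_Basis if_distrib cong: if_cong)
  show "integrable lborel (\<lambda>x. \<Prod>b\<in>Basis. f b (x \<bullet> b))"
    apply (subst lborel_eq)
    apply (subst integrable_distr_eq)
      apply measurable
    unfolding *
    by (rule product_integrable_prod[OF finite_Basis f])
  show "(\<integral>x. (\<Prod>b\<in>Basis. f b (x \<bullet> b)) \<partial>lborel) = (\<Prod>b\<in>Basis. \<integral>x. f b x \<partial>lborel)"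
    apply (subst lborel_eq)
    apply (subst integral_distr)
      apply measurable
    unfolding *
    by (rule product_integral_prod[OF finite_Basis f])
qed

text \<open>Unnormalised: value 1 at the origin and mass \<open>sqrt (2 * pi) ^ DIM('a)\<close>. The
  general type lets one symbol denote both the Gaussian on the space and its one-dimensional
  factors.\<close>

definition gauss :: "'a::real_normed_vector \<Rightarrow> real" where
  "gauss x = exp (- (norm x)\<^sup>2 / 2)"

lemma gauss_nonneg: "gauss x \<ge> 0" and gauss_le_1: "gauss x \<le> 1"
  and gauss_0: "gauss 0 = 1"
  by (auto simp: gauss_def)

lemma continuous_on_gauss [continuous_intros]:
  "continuous_on S f \<Longrightarrow> continuous_on S (\<lambda>x. gauss (f x))"
  unfolding gauss_def by (intro continuous_intros) auto

lemma measurable_gauss [measurable]: "gauss \<in> borel_measurable borel"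
  by (rule borel_measurable_continuous_onI) (intro continuous_intros)

text \<open>Up to the factor \<open>sqrt (2 * pi)\<close> this is the characteristic function of the
  standard normal distribution.\<close>

lemma gauss_real_fourier:
  fixes s :: real
  shows "integrable lborel (\<lambda>x. of_real (gauss x) * exp (\<i> * of_real (x * s)) :: complex)"
    and "(\<integral>x. of_real (gauss x) * exp (\<i> * of_real (x * s)) \<partial>lborel) = of_real (sqrt (2 * pi) * gauss s)"
proof -
  have eq: "of_real (gauss x) * exp (\<i> * of_real (x * s)) =
     of_real (sqrt (2 * pi)) * (std_normal_density x *\<^sub>R iexp (s * x))" for x :: real
    by (simp add: gauss_def std_normal_density_def scaleR_conv_of_real mult_ac)
  have i: "integrable lborel (\<lambda>x. std_normal_density x *\<^sub>R iexp (s * x))"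
  proof (rule Bochner_Integration.integrable_bound)
    show "integrable lborel std_normal_density" by simp
    show "AE x in lborel. norm (std_normal_density x *\<^sub>R iexp (s * x)) \<le> norm (std_normal_density x)"
      by (simp del: of_real_mult)
  qed simp
  show "integrable lborel (\<lambda>x. of_real (gauss x) * exp (\<i> * of_real (x * s)) :: complex)"
    unfolding eq using i by (rule integrable_mult_right)
  have "(\<integral>x. std_normal_density x *\<^sub>R iexp (s * x) \<partial>lborel) = char std_normal_distribution s"
    unfolding char_def by (subst integral_density) auto
  also have "\<dots> = of_real (exp (- s\<^sup>2 / 2))"
    by (simp add: char_std_normal_distribution)
  finally show "(\<integral>x. of_real (gauss x) * exp (\<i> * of_real (x * s)) \<partial>lborel) = of_real (sqrt (2 * pi) * gauss s)"
    unfolding eq by (subst integral_mult_right_zero) (simp add: gauss_def)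
qed

lemma gauss_prod: "gauss (x::'a::euclidean_space) = (\<Prod>b\<in>Basis. gauss (x \<bullet> b))"
proof -
  have "(norm x)\<^sup>2 = (\<Sum>b\<in>Basis. (x \<bullet> b)\<^sup>2)"
    unfolding power2_norm_eq_inner euclidean_inner[of x x] by (simp add: power2_eq_square)
  then show ?thesis
    by (simp add: gauss_def exp_sum[symmetric] sum_negf sum_divide_distrib)
qed

lemma gauss_fourier_prod:
  fixes \<xi> :: "'a::euclidean_space"
  shows "of_real (gauss x) * exp (\<i> * of_real (x \<bullet> \<xi>)) =
      (\<Prod>b\<in>Basis. of_real (gauss (x \<bullet> b)) * exp (\<i> * of_real ((x \<bullet> b) * (\<xi> \<bullet> b))) :: complex)"
  unfolding prod.distrib gauss_prod[of x] of_real_prod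
  by (simp add: exp_sum[symmetric] sum_distrib_left[symmetric] euclidean_inner[of x \<xi>])

lemma
  fixes \<xi> :: "'a::euclidean_space"
  shows integrable_gauss_fourier:
      "integrable lborel (\<lambda>x. of_real (gauss x) * exp (\<i> * of_real (x \<bullet> \<xi>)) :: complex)"
    and integral_gauss_fourier:
      "(\<integral>x. of_real (gauss x) * exp (\<i> * of_real (x \<bullet> \<xi>)) \<partial>lborel)
         = of_real (sqrt (2 * pi) ^ DIM('a) * gauss \<xi>)"
  unfolding gauss_fourier_prod
   apply (rule integrable_lborel_prod, rule gauss_real_fourier)
  apply (subst integral_lborel_prod, rule gauss_real_fourier)
  by (simp add: gauss_real_fourier[simplified] gauss_prod[of \<xi>] prod.distrib)

lemma integrable_gauss: "integrable lborel (gauss :: 'a::euclidean_space \<Rightarrow> real)"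
  using integrable_gauss_fourier[of 0] by (simp add: complex_of_real_integrable_eq)

lemma integral_gauss: "integral\<^sup>L lborel (gauss :: 'a::euclidean_space \<Rightarrow> real) = sqrt (2 * pi) ^ DIM('a)"
proof -
  have "complex_of_real (integral\<^sup>L lborel (gauss :: 'a \<Rightarrow> real)) = of_real (sqrt (2 * pi) ^ DIM('a))"
    using integral_gauss_fourier[of 0] by (simp add: gauss_0 del: of_real_power)
  then show ?thesis using of_real_eq_iff by blast
qed

lemma nn_integral_gauss_affine:
  fixes y :: "'a::euclidean_space"
  assumes "c > 0"
  shows "(\<integral>\<^sup>+x. ennreal (gauss (c *\<^sub>R (y - x))) \<partial>lborel) = ennreal (sqrt (2 * pi) ^ DIM('a) / c ^ DIM('a))"
proof -
  have "ennreal (sqrt (2 * pi) ^ DIM('a)) = (\<integral>\<^sup>+x. ennreal (gauss (x::'a)) \<partial>lborel)"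
    by (simp add: integral_gauss nn_integral_eq_integral integrable_gauss gauss_nonneg)
  \<comment> \<open>The negative factor \<open>- c\<close> performs the reflection in
    \<open>y - x\<close> together with the dilation.\<close>
  also have "\<dots> = ennreal (\<bar>- c\<bar> ^ DIM('a)) * (\<integral>\<^sup>+x. ennreal (gauss (c *\<^sub>R y + (- c) *\<^sub>R x)) \<partial>lborel)"
    by (rule nn_integral_lborel_affine) (use assms in auto)
  finally have *: "ennreal (sqrt (2 * pi) ^ DIM('a)) = ennreal (c ^ DIM('a)) * (\<integral>\<^sup>+x. ennreal (gauss (c *\<^sub>R (y - x))) \<partial>lborel)"
    using assms by (simp add: scaleR_diff_right)
  have "ennreal (sqrt (2 * pi) ^ DIM('a) / c ^ DIM('a)) = ennreal (1 / c ^ DIM('a)) * ennreal (sqrt (2 * pi) ^ DIM('a))"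
    using assms by (simp add: ennreal_mult'[symmetric])
  also have "\<dots> = (ennreal (1 / c ^ DIM('a)) * ennreal (c ^ DIM('a))) * (\<integral>\<^sup>+x. ennreal (gauss (c *\<^sub>R (y - x))) \<partial>lborel)"
    unfolding * by (simp add: mult.assoc)
  also have "ennreal (1 / c ^ DIM('a)) * ennreal (c ^ DIM('a)) = 1"
    using assms by (simp add: ennreal_mult'[symmetric])
  finally show ?thesis by simp
qed

section \<open>Decay of the kernels of the frequency projections\<close>

lemma integrable_bounded_support:
  fixes f :: "'a::euclidean_space \<Rightarrow> complex"
  assumes [measurable]: "f \<in> borel_measurable borel"
    and b: "\<And>x. norm (f x) \<le> B" and z: "\<And>x. norm (x - k) > R \<Longrightarrow> f x = 0" and R: "R \<ge> 0"
  shows "integrable lborel f"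
    and "norm (\<integral>x. f x \<partial>lborel) \<le> B * (unit_ball_vol (DIM('a)) * R ^ DIM('a))"
proof -
  have fin: "emeasure lborel (cball k R) < \<infinity>"
    using R by (simp add: emeasure_cball)
  have i: "integrable lborel (\<lambda>x. B * indicator (cball k R) x)"
    using fin by (intro integrable_mult_right integrable_real_indicator) auto
  have le: "norm (f x) \<le> B * indicator (cball k R) x" for x
    using b[of x] z[of x] by (cases "x \<in> cball k R") (auto simp: dist_norm norm_minus_commute)
  show f: "integrable lborel f"
    by (rule Bochner_Integration.integrable_bound[OF i]) (auto intro!: order.trans[OF le])
  have "norm (\<integral>x. f x \<partial>lborel) \<le> (\<integral>x. norm (f x) \<partial>lborel)"
    by (rule integral_norm_bound)
  also have "\<dots> \<le> (\<integral>x. B * indicator (cball k R) x \<partial>lborel)"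
    by (rule integral_mono) (use f i le in auto)
  also have "\<dots> = B * (unit_ball_vol (DIM('a)) * R ^ DIM('a))"
    using R fin by (simp add: measure_def emeasure_cball)
  finally show "norm (\<integral>x. f x \<partial>lborel) \<le> B * (unit_ball_vol (DIM('a)) * R ^ DIM('a))" .
qed

lemma norm_iexp [simp]: "norm (exp (\<i> * of_real r)) = 1"
  by simp

text \<open>The exterior of a closed ball is open, so along each axis the function agrees with 0
  near the point and every further derivative vanishes as well.\<close>

lemma pders_eq_0_outside:
  assumes "\<And>\<xi>. norm (\<xi> - k) > R \<Longrightarrow> g \<xi> = 0" and "norm (\<xi> - k) > R"
  shows "pders is g \<xi> = 0"
  using assms(2)
proof (induction "is" arbitrary: \<xi>)
  case (Cons i "is")
  let ?U = "{h::real. norm (\<xi> + h *\<^sub>R axis i 1 - k) > R}"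
  have "open ?U"
    by (intro open_Collect_less continuous_intros)
  moreover have "0 \<in> ?U" using Cons.prems by simp
  ultimately have "((\<lambda>h. pders is g (\<xi> + h *\<^sub>R axis i 1)) has_vector_derivative 0) (at 0)"
    by (rule has_vector_derivative_transform_within_open[OF has_vector_derivative_const[of 0]])
       (use Cons.IH in auto)
  then show ?case by (simp add: pder_def vector_derivative_at)
qed (use assms in auto)

text \<open>\<open>pder\<close> differentiates at parameter 0 only; the mean value inequality needs
  the derivative at every parameter of the line, which a shift of the base point provides.\<close>

lemma pder_line:
  assumes d: "\<And>x. (\<lambda>h. f (x + h *\<^sub>R axis i 1)) differentiable (at 0)"
  shows "((\<lambda>h. f (x + h *\<^sub>R axis i 1)) has_vector_derivative pder i f (x + s *\<^sub>R axis i 1)) (at s)"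
proof -
  have "((\<lambda>h. f ((x + s *\<^sub>R axis i 1) + h *\<^sub>R axis i 1)) has_vector_derivative pder i f (x + s *\<^sub>R axis i 1)) (at (s - s))"
    unfolding pder_def using d by (simp add: vector_derivative_works[symmetric])
  then have "((\<lambda>h. f ((x + s *\<^sub>R axis i 1) + h *\<^sub>R axis i 1)) \<circ> (\<lambda>h. h - s) has_vector_derivative
      1 *\<^sub>R pder i f (x + s *\<^sub>R axis i 1)) (at s)"
    by (intro vector_diff_chain_at) (auto intro!: derivative_eq_intros)
  then show ?thesis by (simp add: o_def algebra_simps)
qed

lemma pder_difference_bound:
  assumes d: "\<And>x. (\<lambda>h. f (x + h *\<^sub>R axis i 1)) differentiable (at 0)"
    and B: "\<And>x. norm (pder i f x) \<le> B"
  shows "norm (f (x + h *\<^sub>R axis i 1) - f x) \<le> B * \<bar>h\<bar>"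
proof -
  have "norm (f (x + h *\<^sub>R axis i 1) - f (x + 0 *\<^sub>R axis i 1)) \<le> B * norm (h - 0)"
  proof (rule differentiable_bound[where S = UNIV])
    fix s :: real
    show "((\<lambda>h. f (x + h *\<^sub>R axis i 1)) has_derivative (\<lambda>h. h *\<^sub>R pder i f (x + s *\<^sub>R axis i 1))) (at s)"
      using pder_line[OF d] by (simp add: has_vector_derivative_def)
    show "onorm (\<lambda>h. h *\<^sub>R pder i f (x + s *\<^sub>R axis i 1)) \<le> B"
      using B[of "x + s *\<^sub>R axis i 1"] by (intro onorm_le) (simp add: mult.commute[of B] mult_left_mono)
  qed auto
  then show ?thesis by simp
qed

text \<open>Integration by parts, obtained from translation invariance: the integral of the
  difference quotient of \<open>f\<close> equals a difference quotient of an exponential times the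
  integral of \<open>f\<close>, and both sides converge as the step tends to 0. The mean value
  inequality dominates the quotients.\<close>

lemma fourier_pder:
  fixes f :: "real^'n::finite \<Rightarrow> complex" and x :: "real^'n"
  assumes c: "continuous_on UNIV f" and c': "continuous_on UNIV (pder i f)"
    and d: "\<And>x. (\<lambda>h. f (x + h *\<^sub>R axis i 1)) differentiable (at 0)"
    and z: "\<And>\<xi>. norm (\<xi> - k) > R \<Longrightarrow> f \<xi> = 0"
    and B: "\<And>x. norm (pder i f x) \<le> B" and B0: "\<And>x. norm (f x) \<le> B0" and R: "R \<ge> 0"
  shows "(\<integral>\<xi>. exp (\<i> * of_real (x \<bullet> \<xi>)) * pder i f \<xi> \<partial>lborel)
       = - \<i> * of_real (x $ i) * (\<integral>\<xi>. exp (\<i> * of_real (x \<bullet> \<xi>)) * f \<xi> \<partial>lborel)"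
proof -
  define e :: "real^'n" where "e = axis i 1"
  define E :: "real^'n \<Rightarrow> complex" where "E = (\<lambda>\<xi>. exp (\<i> * of_real (x \<bullet> \<xi>)))"
  define h where "h n = 1 / real (Suc n)" for n
  have [measurable]: "f \<in> borel_measurable borel" "pder i f \<in> borel_measurable borel"
    using c c' by (auto intro: borel_measurable_continuous_onI)
  have [measurable]: "E \<in> borel_measurable borel"
    unfolding E_def by (auto intro!: borel_measurable_continuous_onI continuous_intros)
  have nE: "norm (E \<xi>) = 1" for \<xi> by (simp add: E_def)
  have h: "h n > 0" "h n \<le> 1" for n by (auto simp: h_def)
  have h0: "h \<longlonglongrightarrow> 0" unfolding h_def using LIMSEQ_inverse_real_of_nat by (simp add: inverse_eq_divide)
  have ne: "norm e = 1" by (simp add: e_def)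
  have Ef: "integrable lborel (\<lambda>\<xi>. E \<xi> * f \<xi>)"
    by (rule integrable_bounded_support(1)[where B=B0 and R=R and k=k])
       (use B0 z R in \<open>auto simp: norm_mult nE\<close>)
  \<comment> \<open>The limit is the derivative at 0 of
    \<open>\<lambda>z. exp (- \<i> * x $ i * z)\<close>, taken along the real sequence
    \<open>h n\<close>.\<close>
  have q: "(\<lambda>n. (exp (- \<i> * of_real (h n * x $ i)) - 1) / of_real (h n)) \<longlonglongrightarrow> - \<i> * of_real (x $ i)"
  proof -
    have "((\<lambda>z. exp (- \<i> * of_real (x $ i) * z)) has_field_derivative (- \<i> * of_real (x $ i))) (at 0)"
      by (auto intro!: derivative_eq_intros)
    then have "((\<lambda>z. (exp (- \<i> * of_real (x $ i) * z) - 1) / z) \<longlongrightarrow> - \<i> * of_real (x $ i)) (at 0)"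
      by (simp add: has_field_derivative_iff)
    moreover have "filterlim (\<lambda>n. of_real (h n) :: complex) (at 0) sequentially"
      using h0 h by (intro filterlim_atI tendsto_eq_intros) (auto simp: less_imp_neq[symmetric] intro!: always_eventually)
    ultimately have "(\<lambda>n. (exp (- \<i> * of_real (x $ i) * of_real (h n)) - 1) / of_real (h n)) \<longlonglongrightarrow> - \<i> * of_real (x $ i)"
      by (rule filterlim_compose)
    then show ?thesis by (simp add: mult_ac)
  qed
  have shift: "(\<integral>\<xi>. E \<xi> * f (\<xi> + t *\<^sub>R e) \<partial>lborel) = exp (- \<i> * of_real (t * x $ i)) * (\<integral>\<xi>. E \<xi> * f \<xi> \<partial>lborel)" for t
  proof -
    have "(\<integral>\<xi>. E \<xi> * f \<xi> \<partial>lborel) = (\<integral>\<xi>. E (t *\<^sub>R e + 1 *\<^sub>R \<xi>) * f (t *\<^sub>R e + 1 *\<^sub>R \<xi>) \<partial>lborel)"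
      by (subst integral_lborel_affine[of _ 1 "t *\<^sub>R e"]) auto
    also have "\<dots> = (\<integral>\<xi>. exp (\<i> * of_real (t * x $ i)) * (E \<xi> * f (\<xi> + t *\<^sub>R e)) \<partial>lborel)"
      by (intro Bochner_Integration.integral_cong)
         (auto simp: E_def e_def inner_add_right inner_axis exp_add[symmetric] algebra_simps)
    also have "\<dots> = exp (\<i> * of_real (t * x $ i)) * (\<integral>\<xi>. E \<xi> * f (\<xi> + t *\<^sub>R e) \<partial>lborel)"
      by (rule integral_mult_right_zero)
    finally show ?thesis by (simp add: exp_minus)
  qed
  have lim: "(\<lambda>n. \<integral>\<xi>. E \<xi> * ((f (\<xi> + h n *\<^sub>R e) - f \<xi>) / of_real (h n)) \<partial>lborel) \<longlonglongrightarrow> (\<integral>\<xi>. E \<xi> * pder i f \<xi> \<partial>lborel)"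
  \<comment> \<open>Radius R + 1 because the steps \<open>h n\<close> are at most 1: outside that
    ball both the point and its translate lie outside the support.\<close>
  proof (rule integral_dominated_convergence[where w = "\<lambda>\<xi>. B * indicator (cball k (R + 1)) \<xi>"])
    show "integrable lborel (\<lambda>\<xi>. B * indicator (cball k (R + 1)) \<xi>)"
      using R by (intro integrable_mult_right integrable_real_indicator) (auto simp: emeasure_cball)
    show "AE \<xi> in lborel. norm (E \<xi> * ((f (\<xi> + h n *\<^sub>R e) - f \<xi>) / of_real (h n))) \<le> B * indicator (cball k (R + 1)) \<xi>" for n
    proof (rule AE_I2)
      fix \<xi>
      show "norm (E \<xi> * ((f (\<xi> + h n *\<^sub>R e) - f \<xi>) / of_real (h n))) \<le> B * indicator (cball k (R + 1)) \<xi>"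
      proof (cases "\<xi> \<in> cball k (R + 1)")
        case True
        have "norm (f (\<xi> + h n *\<^sub>R e) - f \<xi>) \<le> B * \<bar>h n\<bar>"
          unfolding e_def by (rule pder_difference_bound[OF d B])
        then show ?thesis using True h[of n] unfolding norm_mult norm_divide nE by (simp add: divide_le_eq)
      next
        case False
        then have *: "norm (\<xi> - k) > R + 1" by (simp add: dist_norm norm_minus_commute)
        have "norm (\<xi> - k) \<le> norm (\<xi> + h n *\<^sub>R e - k) + norm (h n *\<^sub>R e)"
          using norm_triangle_ineq4[of "\<xi> + h n *\<^sub>R e - k" "h n *\<^sub>R e"] by simp
        moreover have "norm (h n *\<^sub>R e) \<le> 1" using h[of n] ne by simp
        ultimately show ?thesis using * z[of \<xi>] z[of "\<xi> + h n *\<^sub>R e"] False by auto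
      qed
    qed
    show "AE \<xi> in lborel. (\<lambda>n. E \<xi> * ((f (\<xi> + h n *\<^sub>R e) - f \<xi>) / of_real (h n))) \<longlonglongrightarrow> E \<xi> * pder i f \<xi>"
    proof (rule AE_I2, rule tendsto_mult_left)
      fix \<xi>
      have "((\<lambda>t. f (\<xi> + t *\<^sub>R axis i 1)) has_vector_derivative pder i f (\<xi> + 0 *\<^sub>R axis i 1)) (at 0)"
        by (rule pder_line[OF d])
      then have "((\<lambda>t. (f (\<xi> + t *\<^sub>R e) - f \<xi> - t *\<^sub>R pder i f \<xi>) /\<^sub>R norm t) \<longlongrightarrow> 0) (at 0)"
        by (simp add: has_vector_derivative_def has_derivative_at_within e_def)
      moreover have "filterlim h (at 0) sequentially"
        using h0 h by (intro filterlim_atI) (auto simp: less_imp_neq[symmetric] intro!: always_eventually)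
      ultimately have "(\<lambda>n. (f (\<xi> + h n *\<^sub>R e) - f \<xi> - h n *\<^sub>R pder i f \<xi>) /\<^sub>R norm (h n)) \<longlonglongrightarrow> 0"
        by (rule filterlim_compose)
      moreover have "(f (\<xi> + h n *\<^sub>R e) - f \<xi> - h n *\<^sub>R pder i f \<xi>) /\<^sub>R norm (h n) =
          (f (\<xi> + h n *\<^sub>R e) - f \<xi>) / of_real (h n) - pder i f \<xi>" for n
        using h(1)[of n] by (simp add: scaleR_conv_of_real field_simps)
      ultimately show "(\<lambda>n. (f (\<xi> + h n *\<^sub>R e) - f \<xi>) / of_real (h n)) \<longlonglongrightarrow> pder i f \<xi>"
        by (simp add: LIM_zero_iff)
    qed
  qed auto
  have eq: "(\<integral>\<xi>. E \<xi> * ((f (\<xi> + h n *\<^sub>R e) - f \<xi>) / of_real (h n)) \<partial>lborel)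
     = (exp (- \<i> * of_real (h n * x $ i)) - 1) / of_real (h n) * (\<integral>\<xi>. E \<xi> * f \<xi> \<partial>lborel)" for n
  proof -
    have i2: "integrable lborel (\<lambda>\<xi>. E \<xi> * f (\<xi> + h n *\<^sub>R e))"
    proof (rule integrable_bounded_support(1)[where B=B0 and R=R and k="k - h n *\<^sub>R e"])
      show "norm (E \<xi> * f (\<xi> + h n *\<^sub>R e)) \<le> B0" for \<xi> using B0 by (simp add: norm_mult nE)
      show "E \<xi> * f (\<xi> + h n *\<^sub>R e) = 0" if "norm (\<xi> - (k - h n *\<^sub>R e)) > R" for \<xi>
        using z[of "\<xi> + h n *\<^sub>R e"] that by (simp add: algebra_simps)
    qed (use R in auto)
    have "(\<integral>\<xi>. E \<xi> * ((f (\<xi> + h n *\<^sub>R e) - f \<xi>) / of_real (h n)) \<partial>lborel)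
       = (\<integral>\<xi>. (E \<xi> * f (\<xi> + h n *\<^sub>R e) - E \<xi> * f \<xi>) / of_real (h n) \<partial>lborel)"
      by (simp add: right_diff_distrib)
    also have "\<dots> = ((\<integral>\<xi>. E \<xi> * f (\<xi> + h n *\<^sub>R e) \<partial>lborel) - (\<integral>\<xi>. E \<xi> * f \<xi> \<partial>lborel)) / of_real (h n)"
      using i2 Ef by simp
    finally show ?thesis unfolding shift by (simp add: algebra_simps)
  qed
  show ?thesis
    using LIMSEQ_unique[OF lim[unfolded eq] tendsto_mult_right[OF q]] unfolding E_def .
qed

text \<open>A product of one-variable weights: it is integrable because each factor is, and the
  factor for one coordinate costs exactly two derivatives in that direction.\<close>

definition decay :: "'a::euclidean_space \<Rightarrow> real" where
  "decay x = (\<Prod>b\<in>Basis. 1 / (1 + (x \<bullet> b)\<^sup>2))"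

lemma decay_nonneg: "decay x \<ge> 0" and decay_le_1: "decay x \<le> 1"
  unfolding decay_def by (auto intro!: prod_nonneg prod_le_1 simp: divide_simps add_pos_nonneg)

lemma measurable_decay [measurable]: "decay \<in> borel_measurable borel"
  unfolding decay_def by measurable

lemma integrable_decay: "integrable lborel (decay :: 'a::euclidean_space \<Rightarrow> real)"
proof -
  have "integrable lborel (\<lambda>x::real. 1 / (1 + x\<^sup>2))"
    using integrable_inverse_1_plus_square by (simp add: set_integrable_def einterval_eq inverse_eq_divide)
  then have "integrable lborel (\<lambda>x::real. complex_of_real (1 / (1 + x\<^sup>2)))"
    by (simp only: complex_of_real_integrable_eq)
  then have "integrable lborel (\<lambda>x::'a. \<Prod>b\<in>Basis. complex_of_real (1 / (1 + (x \<bullet> b)\<^sup>2)))"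
    by (rule integrable_lborel_prod)
  then show ?thesis
    by (simp only: complex_of_real_integrable_eq of_real_prod[symmetric] decay_def[abs_def])
qed

lemma prod_Basis_vec:
  fixes x :: "real^'n::finite" and F :: "real \<Rightarrow> real"
  shows "(\<Prod>b\<in>Basis. F (x \<bullet> b)) = (\<Prod>i\<in>UNIV. F (x $ i))"
proof -
  have B: "Basis = range (\<lambda>i. axis i (1::real) :: real^'n)" by (auto simp: Basis_vec_def)
  have "inj (\<lambda>i. axis i (1::real) :: real^'n)" by (auto simp: inj_on_def axis_eq_axis)
  then show ?thesis unfolding B by (subst prod.reindex) (auto simp: inner_axis)
qed

text \<open>Two integrations by parts in each coordinate. The constant does not depend on k because
  the supports share the radius R and the derivatives of each order are bounded uniformly in
  k.\<close>

lemma kernel_decay: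
  fixes \<eta> :: "real^'n::finite \<Rightarrow> real^'n \<Rightarrow> complex"
  assumes "admissible \<eta>"
  shows "\<exists>B>0. \<forall>k\<in>lattice. \<forall>x. norm (ifourier (\<eta> k) x) \<le> B * decay x"
proof -
  from assms obtain R where R: "R > 0" and z: "\<And>k \<xi>. k \<in> lattice \<Longrightarrow> norm (\<xi> - k) \<ge> R \<Longrightarrow> \<eta> k \<xi> = 0"
    unfolding admissible_def by blast
  have sm: "continuous_on UNIV (pders is (\<eta> k))" 
      "(\<lambda>h. pders is (\<eta> k) (x + h *\<^sub>R axis i 1)) differentiable (at 0)" if "k \<in> lattice" for k "is" i x
    using assms that unfolding admissible_def schwartz_def smooth_fn_def by blast+
  have bd: "\<exists>B. \<forall>k\<in>lattice. \<forall>\<xi>. norm (pders is (\<eta> k) \<xi>) \<le> B" for "is"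
    using assms unfolding admissible_def by blast
  let ?I = "\<lambda>is k (x::real^'n). \<integral>\<xi>. exp (\<i> * of_real (x \<bullet> \<xi>)) * pders is (\<eta> k) \<xi> \<partial>lborel"
  have step: "norm (?I (i # is) k x) = \<bar>x $ i\<bar> * norm (?I is k x)" if k: "k \<in> lattice" for k i "is" x
  proof -
    obtain B0 where "\<forall>k\<in>lattice. \<forall>\<xi>. norm (pders is (\<eta> k) \<xi>) \<le> B0" using bd by blast
    moreover obtain B where "\<forall>k\<in>lattice. \<forall>\<xi>. norm (pders (i # is) (\<eta> k) \<xi>) \<le> B" using bd by blast
    ultimately have "?I (i # is) k x = - \<i> * of_real (x $ i) * ?I is k x"
      unfolding pders.simps using k sm(1)[OF k, of "i # is"]
      by (intro fourier_pder[where k=k and R=R and B=B and ?B0.0=B0] sm pders_eq_0_outside)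
         (use R z in auto)
    then show ?thesis by (simp add: norm_mult)
  qed
  \<comment> \<open>Induction on the set S of treated coordinates with the derivative list
    arbitrary: the new factor \<open>1 + (x $ j)\<^sup>2\<close> splits the integral for
    \<open>is\<close> into the one for \<open>is\<close> and the one for \<open>j # j # is\<close>,
    and the hypothesis applies to both.\<close>
  have main: "\<exists>B. \<forall>k\<in>lattice. \<forall>x. (\<Prod>i\<in>S. 1 + (x $ i)\<^sup>2) * norm (?I is k x) \<le> B" if "finite S" for S "is"
    using that
  proof (induction S arbitrary: "is")
    case empty
    obtain B where B: "\<forall>k\<in>lattice. \<forall>\<xi>. norm (pders is (\<eta> k) \<xi>) \<le> B" using bd by blast
    have "norm (?I is k x) \<le> B * (unit_ball_vol (DIM(real^'n)) * R ^ DIM(real^'n))" if "k \<in> lattice" for k x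
      by (rule integrable_bounded_support(2)[where k=k])
         (use B R that sm(1)[OF that] pders_eq_0_outside[where k=k and R=R and g="\<eta> k"] z[OF that] in
          \<open>auto simp: norm_mult intro!: borel_measurable_continuous_onI continuous_intros\<close>)
    then show ?case by (auto intro!: exI)
  next
    case (insert j S)
    obtain B1 where B1: "\<forall>k\<in>lattice. \<forall>x. (\<Prod>i\<in>S. 1 + (x $ i)\<^sup>2) * norm (?I is k x) \<le> B1" using insert.IH by blast
    obtain B2 where B2: "\<forall>k\<in>lattice. \<forall>x. (\<Prod>i\<in>S. 1 + (x $ i)\<^sup>2) * norm (?I (j # j # is) k x) \<le> B2" using insert.IH by blast
    have "(\<Prod>i\<in>insert j S. 1 + (x $ i)\<^sup>2) * norm (?I is k x) \<le> B1 + B2" if k: "k \<in> lattice" for k x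
    proof -
      have "(\<Prod>i\<in>insert j S. 1 + (x $ i)\<^sup>2) * norm (?I is k x)
        = (\<Prod>i\<in>S. 1 + (x $ i)\<^sup>2) * norm (?I is k x) + (\<Prod>i\<in>S. 1 + (x $ i)\<^sup>2) * norm (?I (j # j # is) k x)"
        unfolding step[OF k] using insert.hyps by (simp add: algebra_simps power2_eq_square)
      also have "\<dots> \<le> B1 + B2" using B1 B2 k by (intro add_mono) blast+
      finally show ?thesis .
    qed
    then show ?case by blast
  qed
  obtain B where B: "\<forall>k\<in>lattice. \<forall>x. (\<Prod>i\<in>UNIV. 1 + (x $ i)\<^sup>2) * norm (?I [] k x) \<le> B"
    using main[OF finite] by blast
  \<comment> \<open>The constant \<open>1 + \<bar>B\<bar>\<close> is strictly positive, as the claim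
    demands, whatever the sign of \<open>B\<close>.\<close>
  have "norm (ifourier (\<eta> k) x) \<le> (1 + \<bar>B\<bar>) / (2 * pi) ^ CARD('n) * decay x" if k: "k \<in> lattice" for k x
  proof -
    have pos: "(\<Prod>i\<in>UNIV. 1 + (x $ i)\<^sup>2) > 0"
      by (intro prod_pos) (auto intro: add_pos_nonneg)
    have dec: "decay x = 1 / (\<Prod>i\<in>UNIV. 1 + (x $ i)\<^sup>2)"
      unfolding decay_def prod_Basis_vec[of "\<lambda>s. 1 / (1 + s\<^sup>2)"] by (simp add: prod_dividef)
    have "(\<Prod>i\<in>UNIV. 1 + (x $ i)\<^sup>2) * norm (?I [] k x) \<le> B"
      using B k by blast
    also have "\<dots> \<le> 1 + \<bar>B\<bar>" by simp
    finally have "(\<Prod>i\<in>UNIV. 1 + (x $ i)\<^sup>2) * norm (?I [] k x) \<le> 1 + \<bar>B\<bar>" .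
    then have "norm (?I [] k x) \<le> (1 + \<bar>B\<bar>) * decay x"
      unfolding dec using pos by (simp add: field_simps)
    then have "norm (?I [] k x) / (2 * pi) ^ CARD('n) \<le> (1 + \<bar>B\<bar>) * decay x / (2 * pi) ^ CARD('n)"
      by (rule divide_right_mono) simp
    moreover have "norm (ifourier (\<eta> k) x) = norm (?I [] k x) / (2 * pi) ^ CARD('n)"
      by (simp add: ifourier_def norm_mult norm_divide norm_power)
    ultimately show ?thesis by simp
  qed
  then show ?thesis by (intro exI[of _ "(1 + \<bar>B\<bar>) / (2 * pi) ^ CARD('n)"]) auto
qed

section \<open>Fourier inversion\<close>

lemma integrable_pair_oscillation:
  fixes f g :: "'a::euclidean_space \<Rightarrow> complex" and e :: "'a \<Rightarrow> 'a \<Rightarrow> complex"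
  assumes f: "integrable lborel f" and g: "integrable lborel g"
    and [measurable]: "(\<lambda>(x, y). e x y) \<in> borel_measurable (borel \<Otimes>\<^sub>M borel)"
    and e: "\<And>x y. norm (e x y) = 1"
  shows "integrable (lborel \<Otimes>\<^sub>M lborel) (\<lambda>(x, y). e x y * (f x * g y))"
proof -
  have [measurable]: "f \<in> borel_measurable borel" "g \<in> borel_measurable borel"
    using f g by (metis borel_measurable_integrable measurable_lborel2)+
  have m: "(\<lambda>(x, y). e x y * (f x * g y)) \<in> borel_measurable (lborel \<Otimes>\<^sub>M lborel)"
    by measurable
  show ?thesis
  proof (rule lborel_pair.Fubini_integrable)
    show "integrable lborel (\<lambda>x. \<integral>y. norm ((\<lambda>(x, y). e x y * (f x * g y)) (x, y)) \<partial>lborel)"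
      using f by (simp add: norm_mult e integrable_mult_left integrable_norm)
    show "AE x in lborel. integrable lborel (\<lambda>y. (\<lambda>(x, y). e x y * (f x * g y)) (x, y))"
    proof (rule AE_I2)
      fix x
      have [measurable]: "(\<lambda>y. e x y) \<in> borel_measurable borel"
        using measurable_compose[OF measurable_Pair1'[of x borel borel] assms(3)] by simp
      have "integrable lborel (\<lambda>y. e x y * (f x * g y))"
        by (rule Bochner_Integration.integrable_bound[of _ "\<lambda>y. f x * g y"])
           (use g in \<open>auto simp: norm_mult e\<close>)
      then show "integrable lborel (\<lambda>y. (\<lambda>(x, y). e x y * (f x * g y)) (x, y))" by simp
    qed
  qed (fact m)
qed

text \<open>A unimodular kernel leaves the absolute integrability of \<open>f x * g y\<close>
  intact. Every exchange of a space integral with a frequency integral below has this form.\<close>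

lemma Fubini_oscillation:
  fixes f g :: "'a::euclidean_space \<Rightarrow> complex" and e :: "'a \<Rightarrow> 'a \<Rightarrow> complex"
  assumes "integrable lborel f" and "integrable lborel g"
    and "(\<lambda>(x, y). e x y) \<in> borel_measurable (borel \<Otimes>\<^sub>M borel)"
    and "\<And>x y. norm (e x y) = 1"
  shows "(\<integral>x. f x * (\<integral>y. e x y * g y \<partial>lborel) \<partial>lborel) = (\<integral>y. g y * (\<integral>x. e x y * f x \<partial>lborel) \<partial>lborel)"
proof -
  have "(\<integral>y. (\<integral>x. e x y * (f x * g y) \<partial>lborel) \<partial>lborel) = (\<integral>x. (\<integral>y. e x y * (f x * g y) \<partial>lborel) \<partial>lborel)"
    by (rule lborel_pair.Fubini_integral[OF integrable_pair_oscillation[OF assms]])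
  moreover have "(\<integral>x. e x y * (f x * g y) \<partial>lborel) = g y * (\<integral>x. e x y * f x \<partial>lborel)" for y
    by (subst integral_mult_right_zero[symmetric]) (simp add: mult_ac)
  moreover have "(\<integral>y. e x y * (f x * g y) \<partial>lborel) = f x * (\<integral>y. e x y * g y \<partial>lborel)" for x
    by (subst integral_mult_right_zero[symmetric]) (simp add: mult_ac)
  ultimately show ?thesis by simp
qed

lemma measurable_ifourier:
  fixes g :: "real^'n::finite \<Rightarrow> complex"
  assumes [measurable]: "g \<in> borel_measurable borel"
  shows "ifourier g \<in> borel_measurable borel"
  unfolding ifourier_def by measurable

lemma integrable_imp_borel: "integrable lborel f \<Longrightarrow> f \<in> borel_measurable borel"
  by (metis borel_measurable_integrable measurable_lborel2)

text \<open>Exchanging the integrals leaves the Fourier transform of the Gaussian at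
  \<open>(\<xi> - \<kappa>) / \<mu>\<close>: averaging over a spatial window of width 1/\<mu>, after
  demodulation by \<kappa>, is a frequency window of width \<mu> around \<kappa>. The factor
  \<open>\<mu> ^ CARD('n)\<close> comes from substituting \<xi> = \<kappa> + \<mu> \<zeta>.\<close>

lemma gauss_packet:
  fixes \<Phi> :: "real^'n::finite \<Rightarrow> complex"
  assumes \<Phi>: "integrable lborel \<Phi>" and \<mu>: "\<mu> > 0"
  shows "(\<integral>\<theta>. of_real (gauss \<theta>) * (exp (\<i> * of_real (- (\<theta> \<bullet> \<kappa>) / \<mu>)) * ifourier \<Phi> (x + (1 / \<mu>) *\<^sub>R \<theta>)) \<partial>lborel)
    = of_real (\<mu> ^ CARD('n) / sqrt (2 * pi) ^ CARD('n)) *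
      (\<integral>\<zeta>. exp (\<i> * of_real (x \<bullet> (\<kappa> + \<mu> *\<^sub>R \<zeta>))) * \<Phi> (\<kappa> + \<mu> *\<^sub>R \<zeta>) * of_real (gauss \<zeta>) \<partial>lborel)"
proof -
  define c where "c = complex_of_real (1 / (2 * pi) ^ CARD('n))"
  have [measurable]: "\<Phi> \<in> borel_measurable borel" using integrable_imp_borel[OF \<Phi>] .
  define e where "e = (\<lambda>\<theta> \<xi> :: real^'n. exp (\<i> * of_real (- (\<theta> \<bullet> \<kappa>) / \<mu> + (x + (1 / \<mu>) *\<^sub>R \<theta>) \<bullet> \<xi>)))"
  have e[measurable]: "(\<lambda>(x, y). e x y) \<in> borel_measurable (borel \<Otimes>\<^sub>M borel)"
    unfolding e_def by measurable
  have G: "integrable lborel (\<lambda>\<theta>::real^'n. complex_of_real (gauss \<theta>))"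
    by (simp add: complex_of_real_integrable_eq integrable_gauss)
  have inner: "(\<integral>\<theta>. e \<theta> \<xi> * of_real (gauss \<theta>) \<partial>lborel)
      = of_real (sqrt (2 * pi) ^ CARD('n)) * (exp (\<i> * of_real (x \<bullet> \<xi>)) * of_real (gauss ((1 / \<mu>) *\<^sub>R (\<xi> - \<kappa>))))" for \<xi>
  proof -
    have "(\<integral>\<theta>. e \<theta> \<xi> * of_real (gauss \<theta>) \<partial>lborel) =
       (\<integral>\<theta>. exp (\<i> * of_real (x \<bullet> \<xi>)) * (of_real (gauss \<theta>) * exp (\<i> * of_real (\<theta> \<bullet> ((1 / \<mu>) *\<^sub>R (\<xi> - \<kappa>))))) \<partial>lborel)"
      by (intro Bochner_Integration.integral_cong)
         (auto simp: e_def inner_diff_right inner_add_left exp_add[symmetric] diff_divide_distrib algebra_simps)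
    also have "\<dots> = exp (\<i> * of_real (x \<bullet> \<xi>)) * of_real (sqrt (2 * pi) ^ CARD('n) * gauss ((1 / \<mu>) *\<^sub>R (\<xi> - \<kappa>)))"
      unfolding integral_mult_right_zero integral_gauss_fourier by simp
    finally show ?thesis by (simp add: mult_ac)
  qed
  have "(\<integral>\<theta>. of_real (gauss \<theta>) * (exp (\<i> * of_real (- (\<theta> \<bullet> \<kappa>) / \<mu>)) * ifourier \<Phi> (x + (1 / \<mu>) *\<^sub>R \<theta>)) \<partial>lborel)
     = (\<integral>\<theta>. c * (of_real (gauss \<theta>) * (\<integral>\<xi>. e \<theta> \<xi> * \<Phi> \<xi> \<partial>lborel)) \<partial>lborel)"
  proof (intro Bochner_Integration.integral_cong refl)
    fix \<theta> :: "real^'n"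
    have sw: "a * (b * (c * d)) = c * (a * (b * d))" for a b d :: complex
      by (simp add: mult_ac)
    have eq: "exp (\<i> * of_real (- (\<theta> \<bullet> \<kappa>) / \<mu>)) * (\<integral>\<xi>. exp (\<i> * of_real ((x + (1 / \<mu>) *\<^sub>R \<theta>) \<bullet> \<xi>)) * \<Phi> \<xi> \<partial>lborel)
        = (\<integral>\<xi>. e \<theta> \<xi> * \<Phi> \<xi> \<partial>lborel)"
      unfolding e_def by (subst integral_mult_right_zero[symmetric])
        (simp only: exp_add[symmetric] distrib_left[symmetric] mult.assoc[symmetric] of_real_add[symmetric])
    show "of_real (gauss \<theta>) * (exp (\<i> * of_real (- (\<theta> \<bullet> \<kappa>) / \<mu>)) * ifourier \<Phi> (x + (1 / \<mu>) *\<^sub>R \<theta>))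
       = c * (of_real (gauss \<theta>) * (\<integral>\<xi>. e \<theta> \<xi> * \<Phi> \<xi> \<partial>lborel))"
      unfolding ifourier_def c_def[symmetric] sw eq ..
  qed
  also have "\<dots> = c * (\<integral>\<xi>. \<Phi> \<xi> * (\<integral>\<theta>. e \<theta> \<xi> * of_real (gauss \<theta>) \<partial>lborel) \<partial>lborel)"
    unfolding integral_mult_right_zero using Fubini_oscillation[OF G \<Phi> e] by (simp only: e_def norm_iexp)
  also have "\<dots> = c * (\<integral>\<xi>. of_real (sqrt (2 * pi) ^ CARD('n)) * (exp (\<i> * of_real (x \<bullet> \<xi>)) * \<Phi> \<xi> * of_real (gauss ((1 / \<mu>) *\<^sub>R (\<xi> - \<kappa>)))) \<partial>lborel)"
    unfolding inner by (simp add: mult_ac)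
  also have "\<dots> = c * of_real (sqrt (2 * pi) ^ CARD('n)) * (\<integral>\<xi>. exp (\<i> * of_real (x \<bullet> \<xi>)) * \<Phi> \<xi> * of_real (gauss ((1 / \<mu>) *\<^sub>R (\<xi> - \<kappa>))) \<partial>lborel)"
    unfolding integral_mult_right_zero by (simp only: mult.assoc)
  also have "(\<integral>\<xi>. exp (\<i> * of_real (x \<bullet> \<xi>)) * \<Phi> \<xi> * of_real (gauss ((1 / \<mu>) *\<^sub>R (\<xi> - \<kappa>))) \<partial>lborel)
     = of_real (\<bar>\<mu>\<bar> ^ DIM(real^'n)) * (\<integral>\<zeta>. exp (\<i> * of_real (x \<bullet> (\<kappa> + \<mu> *\<^sub>R \<zeta>))) * \<Phi> (\<kappa> + \<mu> *\<^sub>R \<zeta>) * of_real (gauss ((1 / \<mu>) *\<^sub>R ((\<kappa> + \<mu> *\<^sub>R \<zeta>) - \<kappa>))) \<partial>lborel)"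
    by (rule integral_lborel_affine) (use \<mu> in auto)
  \<comment> \<open>The Gaussian transform cancels half of the normalisation
    \<open>(2 * pi) ^ CARD('n)\<close> of \<open>ifourier\<close>.\<close>
  also have "c * of_real (sqrt (2 * pi) ^ CARD('n)) = of_real (1 / sqrt (2 * pi) ^ CARD('n))"
  proof -
    have "(2 * pi) ^ CARD('n) = sqrt (2 * pi) ^ CARD('n) * sqrt (2 * pi) ^ CARD('n)"
      unfolding power_mult_distrib[symmetric] by simp
    then have "1 / (2 * pi) ^ CARD('n) * sqrt (2 * pi) ^ CARD('n) = 1 / sqrt (2 * pi) ^ CARD('n)"
      by (simp add: field_simps)
    then show ?thesis unfolding c_def by (metis of_real_mult)
  qed
  finally show ?thesis using \<mu> by (simp add: mult_ac)
qed

text \<open>Gaussian summation: with a cutoff of width 1/\<open>m n\<close> the outer integral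
  becomes, by \<open>gauss_packet\<close> at x = 0 and \<kappa> = \<xi>, an average of
  \<open>\<Phi>\<close> over a Gaussian of width \<open>m n\<close> around \<xi>. Dominated
  convergence evaluates both sides, using integrability of \<open>ifourier \<Phi>\<close> on the
  left and boundedness and continuity of \<open>\<Phi>\<close> on the right.\<close>

lemma fourier_inversion:
  fixes \<Phi> :: "real^'n::finite \<Rightarrow> complex"
  assumes c: "continuous_on UNIV \<Phi>" and B: "\<And>x. norm (\<Phi> x) \<le> B"
    and i: "integrable lborel \<Phi>" and i': "integrable lborel (ifourier \<Phi>)"
  shows "fourier (ifourier \<Phi>) \<xi> = \<Phi> \<xi>"
proof -
  define m where "m n = 1 / real (Suc n)" for n
  have m: "m n > 0" for n by (simp add: m_def)
  have m0: "m \<longlonglongrightarrow> 0" unfolding m_def using LIMSEQ_inverse_real_of_nat by (simp add: inverse_eq_divide)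
  have [measurable]: "\<Phi> \<in> borel_measurable borel" "ifourier \<Phi> \<in> borel_measurable borel"
    using integrable_imp_borel[OF i] integrable_imp_borel[OF i'] by auto
  define L where "L n = (\<integral>y. of_real (gauss (m n *\<^sub>R y)) * (exp (- \<i> * of_real (y \<bullet> \<xi>)) * ifourier \<Phi> y) \<partial>lborel)" for n
  have "L \<longlonglongrightarrow> (\<integral>y. exp (- \<i> * of_real (y \<bullet> \<xi>)) * ifourier \<Phi> y \<partial>lborel)"
    unfolding L_def
  proof (rule integral_dominated_convergence[where w = "\<lambda>y. norm (ifourier \<Phi> y)"])
    show "AE y in lborel. norm (of_real (gauss (m n *\<^sub>R y)) * (exp (- \<i> * of_real (y \<bullet> \<xi>)) * ifourier \<Phi> y)) \<le> norm (ifourier \<Phi> y)" for n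
      by (intro AE_I2) (auto simp: norm_mult abs_of_nonneg gauss_nonneg gauss_le_1 intro!: mult_left_le_one_le)
    show "AE y in lborel. (\<lambda>n. of_real (gauss (m n *\<^sub>R y)) * (exp (- \<i> * of_real (y \<bullet> \<xi>)) * ifourier \<Phi> y)) \<longlonglongrightarrow> exp (- \<i> * of_real (y \<bullet> \<xi>)) * ifourier \<Phi> y"
      using m0 by (auto intro!: tendsto_eq_intros simp: gauss_def)
  qed (use i' in auto)
  moreover have L: "L n = of_real (1 / sqrt (2 * pi) ^ CARD('n)) * (\<integral>\<zeta>. \<Phi> (\<xi> + m n *\<^sub>R \<zeta>) * of_real (gauss \<zeta>) \<partial>lborel)" for n
  proof -
    let ?F = "\<lambda>y. of_real (gauss (m n *\<^sub>R y)) * (exp (- \<i> * of_real (y \<bullet> \<xi>)) * ifourier \<Phi> y)"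
    \<comment> \<open>Substituting y = \<theta> / \<open>m n\<close> brings the cutoff to unit
      width; its Jacobian cancels the power of \<open>m n\<close> in
      \<open>gauss_packet\<close>.\<close>
    have "L n = of_real (\<bar>1 / m n\<bar> ^ DIM(real^'n)) * (\<integral>\<theta>. ?F (0 + (1 / m n) *\<^sub>R \<theta>) \<partial>lborel)"
      unfolding L_def by (rule integral_lborel_affine) (use m[of n] in auto)
    also have "(\<integral>\<theta>. ?F (0 + (1 / m n) *\<^sub>R \<theta>) \<partial>lborel) =
       (\<integral>\<theta>. of_real (gauss \<theta>) * (exp (\<i> * of_real (- (\<theta> \<bullet> \<xi>) / m n)) * ifourier \<Phi> (0 + (1 / m n) *\<^sub>R \<theta>)) \<partial>lborel)"
      using m[of n] by simp
    also have "\<dots> = of_real (m n ^ CARD('n) / sqrt (2 * pi) ^ CARD('n)) * (\<integral>\<zeta>. \<Phi> (\<xi> + m n *\<^sub>R \<zeta>) * of_real (gauss \<zeta>) \<partial>lborel)"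
      by (subst gauss_packet[OF i m]) simp
    finally show ?thesis
      using m[of n] by (simp add: power_divide)
  qed
  moreover have "(\<lambda>n. \<integral>\<zeta>. \<Phi> (\<xi> + m n *\<^sub>R \<zeta>) * of_real (gauss \<zeta>) \<partial>lborel) \<longlonglongrightarrow> (\<integral>\<zeta>. \<Phi> \<xi> * of_real (gauss (\<zeta>::real^'n)) \<partial>lborel)"
  proof (rule integral_dominated_convergence[where w = "\<lambda>\<zeta>. B * gauss \<zeta>"])
    show "AE \<zeta> in lborel. norm (\<Phi> (\<xi> + m n *\<^sub>R \<zeta>) * of_real (gauss \<zeta>)) \<le> B * gauss \<zeta>" for n
      using B by (auto simp: norm_mult gauss_nonneg abs_of_nonneg intro!: mult_right_mono)
    have "(\<lambda>n. \<Phi> (\<xi> + m n *\<^sub>R \<zeta>)) \<longlonglongrightarrow> \<Phi> (\<xi> + 0 *\<^sub>R \<zeta>)" for \<zeta>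
      by (rule continuous_on_tendsto_compose[OF c]) (use m0 in \<open>auto intro!: tendsto_eq_intros\<close>)
    then show "AE \<zeta> in lborel. (\<lambda>n. \<Phi> (\<xi> + m n *\<^sub>R \<zeta>) * of_real (gauss \<zeta>)) \<longlonglongrightarrow> \<Phi> \<xi> * of_real (gauss \<zeta>)"
      by (auto intro!: tendsto_intros)
  qed (use integrable_gauss in auto)
  then have "L \<longlonglongrightarrow> of_real (1 / sqrt (2 * pi) ^ CARD('n)) * (\<integral>\<zeta>. \<Phi> \<xi> * of_real (gauss (\<zeta>::real^'n)) \<partial>lborel)"
    unfolding L by (rule tendsto_mult_left)
  moreover have "of_real (1 / sqrt (2 * pi) ^ CARD('n)) * (\<integral>\<zeta>. \<Phi> \<xi> * of_real (gauss (\<zeta>::real^'n)) \<partial>lborel) = \<Phi> \<xi>"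
    unfolding integral_mult_right_zero integral_complex_of_real integral_gauss by simp
  ultimately show ?thesis
    unfolding fourier_def using LIMSEQ_unique by metis
qed

text \<open>A multiplier acts as convolution with its kernel: expanding \<open>fourier u\<close> and
  exchanging the integrals collects the phases into \<open>(x - y) \<bullet> \<xi>\<close>.\<close>

lemma ifourier_mult_fourier:
  fixes g u :: "real^'n::finite \<Rightarrow> complex"
  assumes g: "integrable lborel g" and u: "integrable lborel u"
  shows "ifourier (\<lambda>\<xi>. g \<xi> * fourier u \<xi>) x = (\<integral>y. u y * ifourier g (x - y) \<partial>lborel)"
proof -
  define c where "c = complex_of_real (1 / (2 * pi) ^ CARD('n))"
  define e where "e = (\<lambda>\<xi> y :: real^'n. exp (\<i> * of_real ((x - y) \<bullet> \<xi>)))"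
  have "exp (\<i> * of_real (x \<bullet> \<xi>)) * (g \<xi> * fourier u \<xi>) = g \<xi> * (\<integral>y. e \<xi> y * u y \<partial>lborel)" for \<xi>
  proof -
    have "exp (\<i> * of_real (x \<bullet> \<xi>)) * fourier u \<xi> = (\<integral>y. e \<xi> y * u y \<partial>lborel)"
      unfolding fourier_def e_def by (subst integral_mult_right_zero[symmetric])
        (simp add: exp_add[symmetric] exp_diff inner_diff_left right_diff_distrib mult.assoc[symmetric] exp_minus divide_inverse del: integral_mult_right_zero)
    then show ?thesis by (simp add: mult_ac)
  qed
  then have "ifourier (\<lambda>\<xi>. g \<xi> * fourier u \<xi>) x = c * (\<integral>\<xi>. g \<xi> * (\<integral>y. e \<xi> y * u y \<partial>lborel) \<partial>lborel)"
    unfolding ifourier_def c_def by (simp only:)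
  also have "\<dots> = c * (\<integral>y. u y * (\<integral>\<xi>. e \<xi> y * g \<xi> \<partial>lborel) \<partial>lborel)"
  proof (subst Fubini_oscillation[OF g u])
    show "(\<lambda>(x, y). e x y) \<in> borel_measurable (borel \<Otimes>\<^sub>M borel)"
      unfolding e_def by measurable
  qed (auto simp: e_def)
  also have "\<dots> = (\<integral>y. u y * ifourier g (x - y) \<partial>lborel)"
    unfolding ifourier_def c_def[symmetric] e_def
    by (subst integral_mult_right_zero[symmetric]) (simp add: mult_ac del: integral_mult_right_zero)
  finally show ?thesis .
qed

section \<open>Upper bound for the modulation norm\<close>

lemma epow_mono: "x \<le> y \<Longrightarrow> r \<ge> 0 \<Longrightarrow> epow x r \<le> epow y r"
  unfolding epow_def by (auto simp: top_unique less_top intro!: ennreal_leI powr_mono2 enn2real_mono)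

lemma epow_ennreal: "a \<ge> 0 \<Longrightarrow> epow (ennreal a) r = ennreal (a powr r)"
  by (simp add: epow_def)

lemma enn2real_ge_1: "1 \<le> p \<Longrightarrow> p \<noteq> \<infinity> \<Longrightarrow> 1 \<le> enn2real p"
  by (metis enn2real_1 enn2real_mono infinity_ennreal_def less_top)

text \<open>Justifies \<open>enn2real (1 / p)\<close> as a single real exponent for all p, with
  value 0 at infinity.\<close>

lemma enn2real_inverse:
  assumes "1 \<le> p"
  shows "enn2real (1 / p) = (if p = \<infinity> then 0 else 1 / enn2real p)"
proof (cases "p = \<infinity>")
  case False
  then have p: "p = ennreal (enn2real p)" by (simp add: less_top)
  have "1 / p = ennreal (1 / enn2real p)"
    by (subst p) (use enn2real_ge_1[OF assms False] in \<open>simp add: divide_ennreal ennreal_1[symmetric] del: ennreal_1\<close>)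
  then show ?thesis using False by simp
qed simp

text \<open>Interpolation between L^1 and L^\<infinity> through |f|^r \<le> C^(r-1) |f|. Since
  \<open>A \<ge> 1\<close>, the factor \<open>A powr (1 / r)\<close> is at most \<open>A\<close>, so
  that one bound serves every p.\<close>

lemma lpn_le:
  assumes [measurable]: "f \<in> borel_measurable M"
    and b: "\<And>x. norm (f x) \<le> C" and i: "(\<integral>\<^sup>+x. ennreal (norm (f x)) \<partial>M) \<le> ennreal (C * A)"
    and A: "A \<ge> 1" and C: "C \<ge> 0" and p: "1 \<le> p"
  shows "lpn M p f \<le> ennreal (C * A)"
proof (cases "p = \<infinity>")
  case True
  have "lpn M p f \<le> ennreal C"
    unfolding lpn_def using True b by (auto intro!: Inf_lower ennreal_leI)
  also have "\<dots> \<le> ennreal (C * A)" using A C by (intro ennreal_leI) (simp add: mult_le_cancel_left1)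
  finally show ?thesis .
next
  case False
  define r where "r = enn2real p"
  have r: "r \<ge> 1" unfolding r_def using enn2real_ge_1[OF p False] .
  have "(\<integral>\<^sup>+x. ennreal (norm (f x) powr r) \<partial>M) \<le> (\<integral>\<^sup>+x. ennreal (C powr (r - 1)) * ennreal (norm (f x)) \<partial>M)"
  proof (rule nn_integral_mono)
    fix x
    have "norm (f x) powr r = norm (f x) powr (r - 1) * norm (f x)"
      using r by (cases "f x = 0") (auto simp: powr_diff)
    also have "\<dots> \<le> C powr (r - 1) * norm (f x)"
      using r b by (intro mult_right_mono powr_mono2) auto
    finally show "ennreal (norm (f x) powr r) \<le> ennreal (C powr (r - 1)) * ennreal (norm (f x))"
      by (simp add: ennreal_mult[symmetric] ennreal_leI)
  qed
  also have "\<dots> = ennreal (C powr (r - 1)) * (\<integral>\<^sup>+x. ennreal (norm (f x)) \<partial>M)"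
    by (rule nn_integral_cmult) measurable
  also have "\<dots> \<le> ennreal (C powr (r - 1)) * ennreal (C * A)"
    by (rule mult_left_mono[OF i]) simp
  also have "\<dots> = ennreal (C powr r * A)"
    using C A r by (cases "C = 0") (auto simp: ennreal_mult[symmetric] powr_diff)
  finally have "epow (\<integral>\<^sup>+x. ennreal (norm (f x) powr r) \<partial>M) (1 / r) \<le> epow (ennreal (C powr r * A)) (1 / r)"
    by (rule epow_mono) (use r in simp)
  also have "\<dots> = ennreal (C * A powr (1 / r))"
    using C A r by (simp add: epow_ennreal powr_mult powr_powr)
  also have "\<dots> \<le> ennreal (C * A)"
    using C A r powr_mono[of "1 / r" 1 A] by (intro ennreal_leI mult_left_mono) auto
  finally show ?thesis using False by (simp add: lpn_def r_def)
qed

text \<open>Young's inequality at its two ends: the kernel is dominated by \<open>B * decay\<close>,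
  which is both bounded and integrable, so convolution sends L^1 into L^1 and into L^\<infinity>
  with explicit constants.\<close>

lemma lpn_box_le:
  fixes u g :: "real^'n::finite \<Rightarrow> complex"
  assumes g: "integrable lborel g" and dec: "\<And>x. norm (ifourier g x) \<le> B * decay x" and B: "B \<ge> 0"
    and u: "integrable lborel u" and U: "(\<integral>\<^sup>+x. ennreal (norm (u x)) \<partial>lborel) \<le> ennreal U" "U \<ge> 0"
    and A: "A \<ge> 1" "A \<ge> integral\<^sup>L lborel (decay :: real^'n \<Rightarrow> real)" and p: "1 \<le> p"
  shows "lpn lborel p (ifourier (\<lambda>\<xi>. g \<xi> * fourier u \<xi>)) \<le> ennreal (B * U * A)"
proof -
  have [measurable]: "g \<in> borel_measurable borel" "u \<in> borel_measurable borel"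
    using g u integrable_imp_borel by auto
  have [measurable]: "ifourier g \<in> borel_measurable borel" by (rule measurable_ifourier) measurable
  have [measurable]: "fourier u \<in> borel_measurable borel" unfolding fourier_def by measurable
  let ?f = "ifourier (\<lambda>\<xi>. g \<xi> * fourier u \<xi>)"
  have le: "ennreal (norm (?f x)) \<le> (\<integral>\<^sup>+y. ennreal (norm (u y)) * ennreal (B * decay (x - y)) \<partial>lborel)" for x
  proof -
    have "integrable lborel (\<lambda>y. u y * ifourier g (x - y))"
    proof (rule Bochner_Integration.integrable_bound[of _ "\<lambda>y. of_real B * u y"])
      show "AE y in lborel. norm (u y * ifourier g (x - y)) \<le> norm (of_real B * u y)"
      proof (rule AE_I2)
        fix y
        have "norm (ifourier g (x - y)) \<le> B * decay (x - y)" by (rule dec)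
        also have "\<dots> \<le> B" using mult_left_mono[OF decay_le_1 B, of "x - y"] by simp
        finally show "norm (u y * ifourier g (x - y)) \<le> norm (of_real B * u y)"
          using B by (simp add: norm_mult mult.commute[of B] mult_left_mono)
      qed
    qed (use u in auto)
    then have "ennreal (norm (?f x)) \<le> (\<integral>\<^sup>+y. ennreal (norm (u y * ifourier g (x - y))) \<partial>lborel)"
      unfolding ifourier_mult_fourier[OF g u] by (rule integral_norm_bound_ennreal)
    also have "\<dots> \<le> (\<integral>\<^sup>+y. ennreal (norm (u y)) * ennreal (B * decay (x - y)) \<partial>lborel)"
      using dec by (intro nn_integral_mono)
        (auto simp: norm_mult ennreal_mult[symmetric] B decay_nonneg intro!: ennreal_leI mult_left_mono)
    finally show ?thesis .
  qed
  show ?thesis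
  proof (rule lpn_le)
    show "?f \<in> borel_measurable lborel" using measurable_ifourier[of "\<lambda>\<xi>. g \<xi> * fourier u \<xi>"] by simp
    show "norm (?f x) \<le> B * U" for x
    proof -
      have "ennreal (norm (?f x)) \<le> (\<integral>\<^sup>+y. ennreal (norm (u y)) * ennreal B \<partial>lborel)"
        by (rule order.trans[OF le]) (intro nn_integral_mono mult_left_mono ennreal_leI, use B in \<open>auto simp: mult_left_le decay_le_1 decay_nonneg\<close>)
      also have "\<dots> = (\<integral>\<^sup>+y. ennreal (norm (u y)) \<partial>lborel) * ennreal B"
        by (rule nn_integral_multc) measurable
      also have "\<dots> \<le> ennreal U * ennreal B" by (intro mult_right_mono U) simp
      finally show ?thesis using B U by (simp add: ennreal_mult[symmetric] mult.commute)
    qed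
    have "(\<integral>\<^sup>+x. ennreal (norm (?f x)) \<partial>lborel) \<le> (\<integral>\<^sup>+x. \<integral>\<^sup>+y. ennreal (norm (u y)) * ennreal (B * decay (x - y)) \<partial>lborel \<partial>lborel)"
      by (rule nn_integral_mono) (rule le)
    also have "\<dots> = (\<integral>\<^sup>+y. \<integral>\<^sup>+x. ennreal (norm (u y)) * ennreal (B * decay (x - y)) \<partial>lborel \<partial>lborel)"
      by (rule lborel_pair.Fubini') measurable
    also have "\<dots> = (\<integral>\<^sup>+y. ennreal (norm (u y)) * ennreal (B * integral\<^sup>L lborel (decay :: real^'n \<Rightarrow> real)) \<partial>lborel)"
    proof (rule nn_integral_cong)
      fix y :: "real^'n"
      have "(\<integral>\<^sup>+x. ennreal (decay (x::real^'n)) \<partial>lborel) = ennreal (\<bar>1\<bar> ^ DIM(real^'n)) * (\<integral>\<^sup>+x. ennreal (decay (- y + 1 *\<^sub>R x)) \<partial>lborel)"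
        by (rule nn_integral_lborel_affine) auto
      then have "(\<integral>\<^sup>+x. ennreal (decay (x - y)) \<partial>lborel) = ennreal (integral\<^sup>L lborel (decay :: real^'n \<Rightarrow> real))"
        by (simp add: nn_integral_eq_integral integrable_decay decay_nonneg)
      then show "(\<integral>\<^sup>+x. ennreal (norm (u y)) * ennreal (B * decay (x - y)) \<partial>lborel) = ennreal (norm (u y)) * ennreal (B * integral\<^sup>L lborel (decay :: real^'n \<Rightarrow> real))"
        by (simp add: nn_integral_cmult ennreal_mult B decay_nonneg)
    qed
    also have "\<dots> = (\<integral>\<^sup>+y. ennreal (norm (u y)) \<partial>lborel) * ennreal (B * integral\<^sup>L lborel (decay :: real^'n \<Rightarrow> real))"
      by (rule nn_integral_multc) measurable
    also have "\<dots> \<le> ennreal U * ennreal (B * A)"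
      using A B U by (intro mult_mono ennreal_leI mult_left_mono) auto
    finally show "(\<integral>\<^sup>+x. ennreal (norm (?f x)) \<partial>lborel) \<le> ennreal (B * U * A)"
      using A B U by (simp add: ennreal_mult[symmetric] mult_ac)
  qed (use A B U p in auto)
qed

text \<open>\<open>ifourier \<Phi>\<close> is \<open>\<rho> ^ CARD('n)\<close> times a phase times
  \<open>ifourier h\<close> at \<rho> x, so its L^1 norm depends on neither \<rho> nor
  \<open>a\<close>. Inversion then identifies the transform of this function as
  \<open>\<Phi>\<close> at every point.\<close>

lemma test_function:
  fixes h :: "real^'n::finite \<Rightarrow> complex" and a :: "real^'n"
  assumes c: "continuous_on UNIV h" and B: "\<And>x. norm (h x) \<le> B" and z: "\<And>x. norm x > R \<Longrightarrow> h x = 0"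
    and R: "R \<ge> 0" and i: "integrable lborel (ifourier h)" and \<rho>: "\<rho> > 0"
  defines "\<Phi> \<equiv> (\<lambda>\<xi>. h ((1 / \<rho>) *\<^sub>R (\<xi> - a)))"
  shows "integrable lborel \<Phi>" and "integrable lborel (ifourier \<Phi>)" and "fourier (ifourier \<Phi>) = \<Phi>"
    and "(\<integral>\<^sup>+x. ennreal (norm (ifourier \<Phi> x)) \<partial>lborel) = (\<integral>\<^sup>+x. ennreal (norm (ifourier h x)) \<partial>lborel)"
proof -
  have c\<Phi>: "continuous_on UNIV \<Phi>"
    unfolding \<Phi>_def by (intro continuous_on_compose2[OF c] continuous_intros) auto
  have [measurable]: "h \<in> borel_measurable borel" "\<Phi> \<in> borel_measurable borel"
    using c c\<Phi> by (auto intro: borel_measurable_continuous_onI)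
  have [measurable]: "ifourier h \<in> borel_measurable borel" by (rule measurable_ifourier) measurable
  show i\<Phi>: "integrable lborel \<Phi>"
  proof (rule integrable_bounded_support(1)[where k = a and R = "R * \<rho>"])
    show "\<Phi> x = 0" if "norm (x - a) > R * \<rho>" for x
      unfolding \<Phi>_def by (rule z) (use \<rho> that in \<open>simp add: less_divide_eq\<close>)
  qed (use B R \<rho> in \<open>auto simp: \<Phi>_def\<close>)
  have eq: "ifourier \<Phi> x = of_real (\<rho> ^ CARD('n)) * exp (\<i> * of_real (x \<bullet> a)) * ifourier h (\<rho> *\<^sub>R x)" for x
  proof -
    have "(\<integral>\<xi>. exp (\<i> * of_real (x \<bullet> \<xi>)) * \<Phi> \<xi> \<partial>lborel) =
        of_real (\<bar>\<rho>\<bar> ^ DIM(real^'n)) * (\<integral>\<xi>. exp (\<i> * of_real (x \<bullet> (a + \<rho> *\<^sub>R \<xi>))) * \<Phi> (a + \<rho> *\<^sub>R \<xi>) \<partial>lborel)"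
      by (rule integral_lborel_affine) (use \<rho> in auto)
    also have "(\<integral>\<xi>. exp (\<i> * of_real (x \<bullet> (a + \<rho> *\<^sub>R \<xi>))) * \<Phi> (a + \<rho> *\<^sub>R \<xi>) \<partial>lborel)
       = (\<integral>\<xi>. exp (\<i> * of_real (x \<bullet> a)) * (exp (\<i> * of_real ((\<rho> *\<^sub>R x) \<bullet> \<xi>)) * h \<xi>) \<partial>lborel)"
      using \<rho> by (intro Bochner_Integration.integral_cong) (auto simp: \<Phi>_def inner_add_right exp_add distrib_left)
    finally show ?thesis
      unfolding ifourier_def integral_mult_right_zero using \<rho> by (simp add: mult_ac)
  qed
  have neq: "norm (ifourier \<Phi> x) = \<rho> ^ CARD('n) * norm (ifourier h (\<rho> *\<^sub>R x))" for x
    unfolding eq using \<rho> by (simp add: norm_mult norm_power)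
  show n: "(\<integral>\<^sup>+x. ennreal (norm (ifourier \<Phi> x)) \<partial>lborel) = (\<integral>\<^sup>+x. ennreal (norm (ifourier h x)) \<partial>lborel)"
  proof -
    have "(\<integral>\<^sup>+x. ennreal (norm (ifourier h x)) \<partial>lborel) = ennreal (\<bar>\<rho>\<bar> ^ DIM(real^'n)) * (\<integral>\<^sup>+x. ennreal (norm (ifourier h (0 + \<rho> *\<^sub>R x))) \<partial>lborel)"
      by (rule nn_integral_lborel_affine) (use \<rho> in auto)
    also have "\<dots> = (\<integral>\<^sup>+x. ennreal (norm (ifourier \<Phi> x)) \<partial>lborel)"
      unfolding neq using \<rho> by (simp add: ennreal_mult nn_integral_cmult)
    finally show ?thesis by simp
  qed
  show i2: "integrable lborel (ifourier \<Phi>)"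
    using i n measurable_ifourier[of \<Phi>] by (simp add: integrable_iff_bounded)
  show "fourier (ifourier \<Phi>) = \<Phi>"
    by (rule ext, rule fourier_inversion[OF c\<Phi> _ i\<Phi> i2, of B]) (simp add: \<Phi>_def B)
qed

text \<open>Coordinatewise floors inject the lattice points into a box, each side of which is an
  interval of length 2r and hence holds at most 2r + 1 integers.\<close>

lemma lattice_ball:
  fixes c :: "real^'n::finite"
  assumes r: "r \<ge> 0"
  defines "F \<equiv> {k \<in> lattice. norm (k - c) \<le> r}"
  shows "finite F" and "real (card F) \<le> (2 * r + 1) ^ CARD('n)"
proof -
  define A where "A i = {\<lceil>c $ i - r\<rceil> .. \<lfloor>c $ i + r\<rfloor>}" for i
  define T where "T = (\<lambda>k::real^'n. \<lambda>i. \<lfloor>k $ i\<rfloor>)"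
  have inj: "inj_on T F"
  proof (rule inj_onI)
    fix k l assume "k \<in> F" "l \<in> F" and T: "T k = T l"
    then have "k $ i = of_int \<lfloor>k $ i\<rfloor>" "l $ i = of_int \<lfloor>l $ i\<rfloor>" for i
      unfolding F_def lattice_def by (auto simp: Ints_def)
    moreover have "\<lfloor>k $ i\<rfloor> = \<lfloor>l $ i\<rfloor>" for i using T unfolding T_def by metis
    ultimately show "k = l" by (metis vec_eq_iff)
  qed
  have sub: "T ` F \<subseteq> PiE UNIV A"
  proof (rule image_subsetI, rule PiE_I)
    fix k and i :: 'n
    assume "k \<in> F"
    then have "k $ i \<in> \<int>" "\<bar>k $ i - c $ i\<bar> \<le> r"
      unfolding F_def lattice_def using component_le_norm_cart[of "k - c" i] by auto
    then show "T k i \<in> A i"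
      unfolding T_def A_def by (auto simp: ceiling_le_iff le_floor_iff elim!: Ints_cases)
  qed simp
  have finA: "finite (PiE UNIV A)" by (rule finite_PiE) (auto simp: A_def)
  show "finite F" using inj sub finA by (meson finite_imageD finite_subset)
  have "card F \<le> card (PiE UNIV A)" by (rule card_inj_on_le[OF inj sub finA])
  also have "\<dots> = (\<Prod>i\<in>UNIV. card (A i))" by (rule card_PiE) simp
  finally have "real (card F) \<le> (\<Prod>i\<in>UNIV. real (card (A i)))" by (metis of_nat_le_iff of_nat_prod)
  also have "\<dots> \<le> (\<Prod>i\<in>(UNIV::'n set). 2 * r + 1)"
  proof (intro prod_mono conjI)
    fix i :: 'n
    have "of_int (\<lfloor>c $ i + r\<rfloor> - \<lceil>c $ i - r\<rceil> + 1) \<le> 2 * r + 1" by linarith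
    then show "real (card (A i)) \<le> 2 * r + 1"
      unfolding A_def using r by simp
  qed simp
  finally show "real (card F) \<le> (2 * r + 1) ^ CARD('n)" by simp
qed

text \<open>Only the pieces in \<open>F\<close> contribute, each at most \<open>J * K\<close>, so
  the q-norm costs their number to the power 1/q.\<close>

lemma modn_le:
  fixes \<eta> :: "real^'n::finite \<Rightarrow> real^'n \<Rightarrow> complex"
  assumes F: "finite F" "F \<subseteq> lattice" "real (card F) \<le> D" "D > 0"
    and J: "\<And>k. k \<in> F \<Longrightarrow> jb k powr s \<le> J" "J \<ge> 0"
    and K: "\<And>k. k \<in> F \<Longrightarrow> lpn lborel p (box \<eta> k u) \<le> ennreal K" "K \<ge> 0"
    and z: "\<And>k. k \<in> lattice - F \<Longrightarrow> lpn lborel p (box \<eta> k u) = 0" and q: "1 \<le> q"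
  shows "modn \<eta> p q s u \<le> ennreal (J * K * D powr enn2real (1 / q))"
proof (cases "q = \<infinity>")
  case True
  have "ennreal (jb k powr s) * lpn lborel p (box \<eta> k u) \<le> ennreal (J * K)" if "k \<in> lattice" for k
  proof (cases "k \<in> F")
    case True
    then show ?thesis using J K by (auto simp: ennreal_mult intro!: mult_mono ennreal_leI)
  qed (use z that in auto)
  then have "modn \<eta> p q s u \<le> ennreal (J * K)"
    unfolding modn_def using True by (auto intro!: SUP_least)
  \<comment> \<open>Here 1/q is 0, and \<open>D powr 0 = 1\<close> because
    \<open>D > 0\<close>.\<close>
  then show ?thesis using True F by simp
next
  case False
  define r where "r = enn2real q"
  have r: "r \<ge> 1" unfolding r_def using enn2real_ge_1[OF q False] .
  define X where "X k = ennreal (jb k powr (s * r)) * epow (lpn lborel p (box \<eta> k u)) r" for k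
  have "(\<integral>\<^sup>+k. X k \<partial>count_space lattice) = (\<integral>\<^sup>+k. X k \<partial>count_space F)"
    by (rule nn_integral_count_space_eq) (use z F in \<open>auto simp: X_def epow_def\<close>)
  also have "\<dots> = (\<Sum>k\<in>F. X k)"
    by (rule nn_integral_count_space_finite[OF F(1)])
  also have "\<dots> \<le> (\<Sum>k\<in>F. ennreal ((J * K) powr r))"
  proof (rule sum_mono)
    fix k assume k: "k \<in> F"
    have "jb k powr (s * r) \<le> J powr r"
      using J(1)[OF k] r powr_mono2[of r "jb k powr s" J] by (simp add: powr_powr)
    moreover have "epow (lpn lborel p (box \<eta> k u)) r \<le> ennreal (K powr r)"
      using epow_mono[OF K(1)[OF k], of r] r K by (simp add: epow_ennreal)
    ultimately show "X k \<le> ennreal ((J * K) powr r)"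
      unfolding X_def using J K by (auto simp: powr_mult ennreal_mult intro!: mult_mono ennreal_leI)
  qed
  also have "\<dots> = ennreal (real (card F) * (J * K) powr r)"
    by (simp add: ennreal_mult ennreal_of_nat_eq_real_of_nat)
  also have "\<dots> \<le> ennreal (D * (J * K) powr r)"
    using F by (intro ennreal_leI mult_right_mono) auto
  finally have "epow (\<integral>\<^sup>+k. X k \<partial>count_space lattice) (1 / r) \<le> epow (ennreal (D * (J * K) powr r)) (1 / r)"
    by (rule epow_mono) (use r in simp)
  also have "\<dots> = ennreal (J * K * D powr (1 / r))"
    using F J K r by (simp add: epow_ennreal powr_mult powr_powr mult_ac)
  finally show ?thesis using False q by (simp add: modn_def X_def r_def enn2real_inverse)
qed

section \<open>Wave packets\<close>

lemma powr_above_tangent: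
  fixes x y r :: real
  assumes "x \<ge> 0" "y \<ge> 0" "r \<ge> 1"
  shows "y powr r + r * y powr (r - 1) * (x - y) \<le> x powr r"
proof (cases "x = 0 \<or> y = 0")
  case True
  \<comment> \<open>The derivative form of convexity covers positive arguments; the boundary is done
    by hand. At r = 1 and y = 0 the convention \<open>0 powr 0 = 0\<close> keeps the inequality
    true.\<close>
  have "y powr (r - 1) * y = y powr r" using assms by (cases "y = 0") (auto simp: powr_diff)
  then have "y powr r + r * y powr (r - 1) * (0 - y) = (1 - r) * y powr r" by (simp add: algebra_simps)
  also have "\<dots> \<le> 0" using assms by (simp add: mult_nonpos_nonneg)
  finally show ?thesis using True assms by (auto intro: order.trans[of _ 0])
next
  case False
  have "x powr r - y powr r \<ge> r * y powr (r - 1) * (x - y)"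
    by (rule convex_on_imp_above_tangent[OF powr_convex[OF assms(3)]])
       (use False assms in \<open>auto intro!: derivative_eq_intros simp: interior_open\<close>)
  then show ?thesis by simp
qed

text \<open>The gradient of \<open>norm \<xi> powr \<beta>\<close>; the classical position at time t
  is \<open>- t *\<^sub>R grad \<beta> \<kappa>\<close>.\<close>

definition grad :: "real \<Rightarrow> 'a::euclidean_space \<Rightarrow> 'a" where
  "grad \<beta> \<kappa> = (\<beta> * norm \<kappa> powr (\<beta> - 2)) *\<^sub>R \<kappa>"

text \<open>The Cauchy-Schwarz inequality reduces convexity in space to convexity of the radial
  profile.\<close>

lemma norm_powr_above_tangent:
  assumes "\<beta> \<ge> 2"
  shows "norm b powr \<beta> + grad \<beta> b \<bullet> (a - b) \<le> norm a powr \<beta>"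
proof -
  have "grad \<beta> b \<bullet> (a - b) = \<beta> * norm b powr (\<beta> - 2) * (a \<bullet> b - norm b * norm b)"
    by (simp add: grad_def inner_diff_right inner_commute power2_norm_eq_inner[symmetric] power2_eq_square)
  also have "\<dots> \<le> \<beta> * norm b powr (\<beta> - 2) * (norm a * norm b - norm b * norm b)"
    using assms norm_cauchy_schwarz[of a b] by (intro mult_left_mono) auto
  also have "\<dots> = \<beta> * (norm b powr (\<beta> - 2) * norm b) * (norm a - norm b)" by (simp add: algebra_simps)
  also have "norm b powr (\<beta> - 2) * norm b = norm b powr (\<beta> - 1)"
    by (cases "b = 0") (auto simp: powr_diff power2_eq_square)
  finally show ?thesis
    using powr_above_tangent[of "norm a" "norm b" \<beta>] assms by simp
qed

text \<open>Polarisation of the inner product of a and b. The identity does the work of a Hessian: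
  bounded above it gives the Taylor remainder, bounded below the expansion of the gradient
  map.\<close>

lemma grad_monotone_identity:
  "(grad \<beta> a - grad \<beta> b) \<bullet> (a - b) = \<beta> / 2 * ((norm a powr (\<beta> - 2) + norm b powr (\<beta> - 2)) * (norm (a - b))\<^sup>2
     + (norm a powr (\<beta> - 2) - norm b powr (\<beta> - 2)) * ((norm a)\<^sup>2 - (norm b)\<^sup>2))"
  unfolding grad_def power2_norm_eq_inner
  by (simp add: inner_diff_left inner_diff_right inner_commute[of b a] algebra_simps)

text \<open>The tangent inequality is applied to exponent m + 1, since the power m itself may be
  below 1 and then concave; \<open>y \<le> x\<close> brings the estimate back to exponent m.\<close>

lemma powr_diff_mult_le:
  fixes x y m :: real
  assumes "0 \<le> y" "y \<le> x" "m > 0"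
  shows "(x powr m - y powr m) * (x\<^sup>2 - y\<^sup>2) \<le> 2 * (1 + m) * x powr m * (x - y)\<^sup>2"
proof (cases "x = 0")
  case False
  then have x: "x > 0" using assms by simp
  have "x powr (m + 1) + (m + 1) * x powr m * (y - x) \<le> y powr (m + 1)"
    using powr_above_tangent[of y x "m + 1"] assms by simp
  also have "\<dots> = y * y powr m" using assms by (cases "y = 0") (auto simp: powr_add)
  also have "\<dots> \<le> x * y powr m" using assms by (intro mult_right_mono) auto
  finally have *: "x * (x powr m - y powr m) \<le> (1 + m) * x powr m * (x - y)"
    using x by (simp add: powr_add algebra_simps)
  have "(x powr m - y powr m) * (x\<^sup>2 - y\<^sup>2) = (x + y) * (x powr m - y powr m) * (x - y)"
    by (simp add: power2_eq_square algebra_simps)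
  also have "\<dots> \<le> (2 * x) * (x powr m - y powr m) * (x - y)"
    using assms by (intro mult_right_mono) (auto intro: powr_mono2)
  also have "\<dots> = 2 * (x * (x powr m - y powr m)) * (x - y)" by simp
  also have "\<dots> \<le> 2 * ((1 + m) * x powr m * (x - y)) * (x - y)"
    using assms * by (intro mult_right_mono mult_left_mono) auto
  finally show ?thesis by (simp only: power2_eq_square mult_ac)
qed (use assms in auto)

text \<open>The two terms of the identity contribute 2 and 2(1 + m) = 2(\<beta> - 1); multiplied by
  \<beta>/2 they add up to \<beta>^2.\<close>

lemma grad_lipschitz:
  assumes \<beta>: "\<beta> > 2" and L: "norm a \<le> L" "norm b \<le> L"
  shows "(grad \<beta> a - grad \<beta> b) \<bullet> (a - b) \<le> \<beta>\<^sup>2 * L powr (\<beta> - 2) * (norm (a - b))\<^sup>2"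
proof -
  define m where "m = \<beta> - 2"
  have m: "m > 0" using \<beta> by (simp add: m_def)
  have pa: "norm a powr m \<le> L powr m" and pb: "norm b powr m \<le> L powr m"
    using L m by (auto intro!: powr_mono2)
  have d: "(norm a - norm b)\<^sup>2 \<le> (norm (a - b))\<^sup>2"
    by (rule power2_le_iff_abs_le[THEN iffD2]) (auto simp: norm_triangle_ineq3)
  have key: "(norm a powr m - norm b powr m) * ((norm a)\<^sup>2 - (norm b)\<^sup>2) \<le> 2 * (1 + m) * L powr m * (norm (a - b))\<^sup>2"
  proof -
    have wlog: "(x powr m - y powr m) * (x\<^sup>2 - y\<^sup>2) \<le> 2 * (1 + m) * L powr m * D"
      if "0 \<le> y" "y \<le> x" "x \<le> L" "(x - y)\<^sup>2 \<le> D" for x y D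
    proof -
      have "(x powr m - y powr m) * (x\<^sup>2 - y\<^sup>2) \<le> 2 * (1 + m) * x powr m * (x - y)\<^sup>2"
        using that m by (intro powr_diff_mult_le)
      also have "\<dots> \<le> 2 * (1 + m) * L powr m * D"
        using that m by (intro mult_mono powr_mono2) auto
      finally show ?thesis .
    qed
    show ?thesis
    proof (cases "norm b \<le> norm a")
      case True
      then show ?thesis using wlog[of "norm b" "norm a"] L d by simp
    next
      case False
      then have "(norm b powr m - norm a powr m) * ((norm b)\<^sup>2 - (norm a)\<^sup>2) \<le> 2 * (1 + m) * L powr m * (norm (a - b))\<^sup>2"
        using wlog[of "norm a" "norm b"] L d by (simp add: power2_commute)
      then show ?thesis by (simp add: algebra_simps)
    qed
  qed
  have "(norm a powr m + norm b powr m) * (norm (a - b))\<^sup>2 \<le> (2 * L powr m) * (norm (a - b))\<^sup>2"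
    using pa pb by (intro mult_right_mono) auto
  then have "(grad \<beta> a - grad \<beta> b) \<bullet> (a - b) \<le> \<beta> / 2 * ((2 * L powr m) * (norm (a - b))\<^sup>2 + 2 * (1 + m) * L powr m * (norm (a - b))\<^sup>2)"
    unfolding grad_monotone_identity m_def[symmetric] using key \<beta> by (intro mult_left_mono add_mono) auto
  also have "\<dots> = \<beta>\<^sup>2 * L powr (\<beta> - 2) * (norm (a - b))\<^sup>2"
    by (simp add: m_def power2_eq_square algebra_simps)
  finally show ?thesis .
qed

text \<open>The tangent planes at b and at a trap the remainder between 0 and the monotonicity
  pairing of the gradients, which is quadratic in a - b.\<close>

lemma norm_powr_taylor:
  assumes \<beta>: "\<beta> > 2" and L: "norm a \<le> L" "norm b \<le> L"
  shows "\<bar>norm a powr \<beta> - norm b powr \<beta> - grad \<beta> b \<bullet> (a - b)\<bar> \<le> \<beta>\<^sup>2 * L powr (\<beta> - 2) * (norm (a - b))\<^sup>2"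
proof -
  have "norm b powr \<beta> + grad \<beta> b \<bullet> (a - b) \<le> norm a powr \<beta>"
    and "norm a powr \<beta> + grad \<beta> a \<bullet> (b - a) \<le> norm b powr \<beta>"
    using \<beta> by (intro norm_powr_above_tangent; simp)+
  moreover have "(grad \<beta> a - grad \<beta> b) \<bullet> (a - b) = - (grad \<beta> a \<bullet> (b - a)) - grad \<beta> b \<bullet> (a - b)"
    by (simp add: inner_diff_left inner_diff_right)
  ultimately show ?thesis using grad_lipschitz[OF assms] by linarith
qed

lemma grad_expanding:
  assumes \<beta>: "\<beta> > 2" and l: "0 \<le> l" "l \<le> norm a" "l \<le> norm b"
  shows "\<beta> * l powr (\<beta> - 2) * norm (a - b) \<le> norm (grad \<beta> a - grad \<beta> b)"
proof (cases "a = b")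
  case False
  define m where "m = \<beta> - 2"
  have m: "m > 0" using \<beta> by (simp add: m_def)
  have "0 \<le> (norm a powr m - norm b powr m) * ((norm a)\<^sup>2 - (norm b)\<^sup>2)"
  proof (cases "norm b \<le> norm a")
    case True
    then show ?thesis using m by (intro mult_nonneg_nonneg) (auto intro: powr_mono2 power_mono)
  next
    case False
    then show ?thesis using m by (intro mult_nonpos_nonpos) (auto intro: powr_mono2 power_mono)
  qed
  moreover have "2 * l powr m * (norm (a - b))\<^sup>2 \<le> (norm a powr m + norm b powr m) * (norm (a - b))\<^sup>2"
    using powr_mono2[of m l "norm a"] powr_mono2[of m l "norm b"] m l by (intro mult_right_mono) auto
  ultimately have "\<beta> / 2 * (2 * l powr m * (norm (a - b))\<^sup>2) \<le> (grad \<beta> a - grad \<beta> b) \<bullet> (a - b)"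
    unfolding grad_monotone_identity m_def[symmetric] using \<beta> by (intro mult_left_mono) auto
  also have "\<dots> \<le> norm (grad \<beta> a - grad \<beta> b) * norm (a - b)" by (rule norm_cauchy_schwarz)
  finally have "(\<beta> * l powr m * norm (a - b)) * norm (a - b) \<le> norm (grad \<beta> a - grad \<beta> b) * norm (a - b)"
    by (simp add: power2_eq_square mult_ac)
  then show ?thesis using False unfolding m_def by (subst (asm) mult_le_cancel_right) auto
qed simp

section \<open>Lower bound for one wave packet\<close>

text \<open>Uniform continuity covers near points, and the crude bound 2B, divided by \<delta>^2,
  covers distances of at least \<delta>. The quadratic form is wanted because it can be integrated
  against the Gaussian together with the phase error.\<close>

lemma compact_support_modulus:
  fixes h :: "'a::euclidean_space \<Rightarrow> complex"
  assumes c: "continuous_on UNIV h" and B: "\<And>x. norm (h x) \<le> B" and z: "\<And>x. norm x > R \<Longrightarrow> h x = 0"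
    and \<tau>: "\<tau> > 0"
  obtains K where "K \<ge> 0" "\<And>x y. norm (h x - h y) \<le> \<tau> + K * (norm (x - y))\<^sup>2"
proof -
  \<comment> \<open>The extra 1 matches \<open>\<delta> \<le> 1\<close>: if one of two
    \<delta>-close points leaves this ball, both lie outside the support.\<close>
  have "uniformly_continuous_on (cball 0 (R + 1)) h"
    by (intro compact_uniformly_continuous continuous_on_subset[OF c]) auto
  then obtain d where d: "d > 0" "\<And>x y. norm x \<le> R + 1 \<Longrightarrow> norm y \<le> R + 1 \<Longrightarrow> norm (x - y) < d \<Longrightarrow> norm (h x - h y) < \<tau>"
    unfolding uniformly_continuous_on_def using \<tau> by (auto simp: dist_norm norm_minus_commute)
  define \<delta> where "\<delta> = min d 1"
  have \<delta>: "\<delta> > 0" "\<delta> \<le> d" "\<delta> \<le> 1" using d by (auto simp: \<delta>_def)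
  have B0: "B \<ge> 0" using B[of 0] norm_ge_zero order.trans by blast
  have "norm (h x - h y) \<le> \<tau> + 2 * B / \<delta>\<^sup>2 * (norm (x - y))\<^sup>2" for x y
  proof (cases "norm (x - y) < \<delta>")
    case True
    have "norm (h x - h y) \<le> \<tau>"
    proof (cases "norm x \<le> R + 1 \<and> norm y \<le> R + 1")
      case t: True
      then show ?thesis using d(2)[of x y] True \<delta> by simp
    next
      case False
      have "\<bar>norm x - norm y\<bar> \<le> norm (x - y)" by (rule norm_triangle_ineq3)
      then have "norm x > R" "norm y > R" using True \<delta> False by auto
      then show ?thesis using z \<tau> by simp
    qed
    moreover have "0 \<le> 2 * B / \<delta>\<^sup>2 * (norm (x - y))\<^sup>2" using B0 by simp
    ultimately show ?thesis by linarith
  next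
    case False
    then have "\<delta>\<^sup>2 \<le> (norm (x - y))\<^sup>2" using \<delta> by (intro power_mono) auto
    then have "2 * B * 1 \<le> 2 * B * ((norm (x - y))\<^sup>2 / \<delta>\<^sup>2)"
      using B0 \<delta> by (intro mult_left_mono) (auto simp: le_divide_eq)
    moreover have "norm (h x - h y) \<le> 2 * B" using norm_triangle_ineq4[of "h x" "h y"] B[of x] B[of y] by linarith
    ultimately show ?thesis using \<tau> by simp
  qed
  then show thesis using that[of "2 * B / \<delta>\<^sup>2"] B0 by auto
qed

text \<open>A wider Gaussian absorbs the polynomial: |x|^2/4 \<le> exp(3|x|^2/8), and the product of
  the right-hand side with \<open>gauss x\<close> is
  \<open>gauss ((1 / 2) *\<^sub>R x)\<close>.\<close>

lemma integrable_gauss_second_moment: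
  "integrable lborel (\<lambda>x::'a::euclidean_space. gauss x * (norm x)\<^sup>2)"
proof (rule Bochner_Integration.integrable_bound)
  have "integrable lborel (\<lambda>x::'a. 4 * gauss (0 + (1 / 2) *\<^sub>R x))"
    by (intro integrable_mult_right integrable_lborel_affine integrable_gauss) simp
  then show "integrable lborel (\<lambda>x::'a. 4 * gauss ((1 / 2) *\<^sub>R x))" by simp
  show "AE x in lborel. norm (gauss x * (norm x)\<^sup>2) \<le> norm (4 * gauss ((1 / 2) *\<^sub>R (x::'a)))"
  proof (rule AE_I2)
    fix x :: 'a
    have "(norm x)\<^sup>2 / 4 \<le> exp ((norm x)\<^sup>2 * 3 / 8)"
      using exp_ge_add_one_self[of "(norm x)\<^sup>2 * 3 / 8"] by (simp add: field_simps) (smt (verit) zero_le_power2)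
    then have "gauss x * ((norm x)\<^sup>2 / 4) \<le> gauss x * exp ((norm x)\<^sup>2 * 3 / 8)"
      by (intro mult_left_mono) (auto simp: gauss_nonneg)
    also have "\<dots> = gauss ((1 / 2) *\<^sub>R x)"
      by (simp add: gauss_def exp_add[symmetric] power_divide)
    finally show "norm (gauss x * (norm x)\<^sup>2) \<le> norm (4 * gauss ((1 / 2) *\<^sub>R x))"
      by (simp add: gauss_nonneg abs_mult abs_of_nonneg)
  qed
qed simp

lemma norm_iexp_diff_le: "norm (exp (\<i> * of_real r) - 1) \<le> \<bar>r\<bar>"
  using iexp_approx1[of r 0] by simp

text \<open>After the phase at \<kappa> is factored out, the windowed integrand differs from the
  constant \<open>\<Phi> \<kappa>\<close> by at most a/4 plus a quadratic term in \<zeta>.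
  \<open>E\<close> is small enough that the Gaussian average of the quadratic term is also at most
  a/4, which leaves at least half of \<open>a\<close>.\<close>

lemma packet_lower_bound:
  fixes h :: "real^'n::finite \<Rightarrow> complex" and z\<^sub>0 :: "real^'n"
  defines "G \<equiv> sqrt (2 * pi) ^ CARD('n)"
    and "M\<^sub>2 \<equiv> (\<integral>\<zeta>. gauss \<zeta> * (norm (\<zeta>::real^'n))\<^sup>2 \<partial>lborel)"
  assumes c: "continuous_on UNIV h" and B: "\<And>x. norm (h x) \<le> B" and z: "\<And>x. norm x > R \<Longrightarrow> h x = 0"
    and R: "R \<ge> 0"
    and K: "K \<ge> 0" "\<And>x y. norm (h x - h y) \<le> a / 4 + K * (norm (x - y))\<^sup>2"
    and E: "(K + B * \<beta>\<^sup>2 * 2 powr (\<beta> - 2)) * E * M\<^sub>2 \<le> a / 4 * G"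
    and \<beta>: "\<beta> > 2" and pos: "\<rho> > 0" "\<mu> > 0" "t \<ge> 0" "N > 0"
    and scale: "\<mu>\<^sup>2 \<le> E * \<rho>\<^sup>2" "t * N powr (\<beta> - 2) * \<mu>\<^sup>2 \<le> E"
    and z0: "norm z\<^sub>0 = N" "R * \<rho> \<le> N" and \<kappa>: "norm \<kappa> \<le> 2 * N" "norm (h ((1 / \<rho>) *\<^sub>R (\<kappa> - z\<^sub>0))) \<ge> a"
    and u: "fourier u = (\<lambda>\<xi>. h ((1 / \<rho>) *\<^sub>R (\<xi> - z\<^sub>0)))"
  shows "ennreal (\<mu> ^ CARD('n) * a / 2) \<le>
     (\<integral>\<^sup>+\<theta>. ennreal (gauss \<theta>) * ennreal (norm (schro \<beta> t u (- t *\<^sub>R grad \<beta> \<kappa> + (1 / \<mu>) *\<^sub>R \<theta>))) \<partial>lborel)"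
proof -
  define \<Phi> where "\<Phi> = (\<lambda>\<xi>. h ((1 / \<rho>) *\<^sub>R (\<xi> - z\<^sub>0)))"
  define x where "x = - t *\<^sub>R grad \<beta> \<kappa>"
  define \<Psi> where "\<Psi> = (\<lambda>\<xi>. exp (\<i> * of_real (t * norm \<xi> powr \<beta>)) * \<Phi> \<xi>)"
  have B0: "B \<ge> 0" using B[of 0] norm_ge_zero order.trans by blast
  have c\<Phi>: "continuous_on UNIV \<Phi>"
    unfolding \<Phi>_def by (intro continuous_on_compose2[OF c] continuous_intros) auto
  have [measurable]: "\<Phi> \<in> borel_measurable borel"
    using c\<Phi> by (rule borel_measurable_continuous_onI)
  have [measurable]: "\<Psi> \<in> borel_measurable borel" unfolding \<Psi>_def by measurable
  have supp: "\<Phi> \<xi> = 0" if "norm (\<xi> - z\<^sub>0) > R * \<rho>" for \<xi>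
    unfolding \<Phi>_def by (rule z) (use pos that in \<open>simp add: less_divide_eq\<close>)
  have i\<Psi>: "integrable lborel \<Psi>"
  proof (rule integrable_bounded_support(1)[where k = z\<^sub>0 and R = "R * \<rho>" and B = B])
    show "norm (\<Psi> \<xi>) \<le> B" for \<xi> using B by (simp add: \<Psi>_def norm_mult \<Phi>_def)
    show "\<Psi> \<xi> = 0" if "norm (\<xi> - z\<^sub>0) > R * \<rho>" for \<xi> using supp[OF that] by (simp add: \<Psi>_def)
  qed (use R pos in auto)
  have v: "schro \<beta> t u = ifourier \<Psi>"
    unfolding schro_def u \<Psi>_def \<Phi>_def ..
  \<comment> \<open>The choice of \<open>x\<close> cancels the part of the phase that is linear in
    \<zeta>, so only the Taylor remainder of |xi|^\<beta> survives in
    \<open>\<psi> \<zeta> - \<psi> 0\<close>.\<close>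
  define \<psi> where "\<psi> \<zeta> = x \<bullet> (\<kappa> + \<mu> *\<^sub>R \<zeta>) + t * norm (\<kappa> + \<mu> *\<^sub>R \<zeta>) powr \<beta>" for \<zeta>
  define f where "f \<zeta> = exp (\<i> * of_real (\<psi> \<zeta> - \<psi> 0)) * \<Phi> (\<kappa> + \<mu> *\<^sub>R \<zeta>)" for \<zeta>
  define Q where "Q = (K + B * \<beta>\<^sup>2 * 2 powr (\<beta> - 2)) * E"
  have [measurable]: "f \<in> borel_measurable borel" unfolding f_def \<psi>_def by measurable
  have f_le: "norm (f \<zeta> - \<Phi> \<kappa>) \<le> a / 4 + Q * (norm \<zeta>)\<^sup>2" for \<zeta>
  proof -
    define \<xi> where "\<xi> = \<kappa> + \<mu> *\<^sub>R \<zeta>"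
    have d: "norm (\<xi> - \<kappa>) = \<mu> * norm \<zeta>" using pos by (simp add: \<xi>_def)
    have "f \<zeta> - \<Phi> \<kappa> = (exp (\<i> * of_real (\<psi> \<zeta> - \<psi> 0)) - 1) * \<Phi> \<xi> + (\<Phi> \<xi> - \<Phi> \<kappa>)"
      by (simp add: f_def \<xi>_def algebra_simps)
    then have "norm (f \<zeta> - \<Phi> \<kappa>) \<le> norm (exp (\<i> * of_real (\<psi> \<zeta> - \<psi> 0)) - 1) * norm (\<Phi> \<xi>) + norm (\<Phi> \<xi> - \<Phi> \<kappa>)"
      by (metis norm_mult norm_triangle_ineq)
    moreover have "norm (\<Phi> \<xi> - \<Phi> \<kappa>) \<le> a / 4 + K * E * (norm \<zeta>)\<^sup>2"
    proof -
      have "(1 / \<rho>) *\<^sub>R (\<xi> - z\<^sub>0) - (1 / \<rho>) *\<^sub>R (\<kappa> - z\<^sub>0) = (1 / \<rho>) *\<^sub>R (\<xi> - \<kappa>)"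
        by (simp add: scaleR_diff_right)
      then have "norm (\<Phi> \<xi> - \<Phi> \<kappa>) \<le> a / 4 + K * (norm ((1 / \<rho>) *\<^sub>R (\<xi> - \<kappa>)))\<^sup>2"
        unfolding \<Phi>_def using K(2)[of "(1 / \<rho>) *\<^sub>R (\<xi> - z\<^sub>0)" "(1 / \<rho>) *\<^sub>R (\<kappa> - z\<^sub>0)"] by simp
      also have "(norm ((1 / \<rho>) *\<^sub>R (\<xi> - \<kappa>)))\<^sup>2 = (\<mu>\<^sup>2 / \<rho>\<^sup>2) * (norm \<zeta>)\<^sup>2"
        using pos d by (simp add: power_mult_distrib power_divide)
      also have "a / 4 + K * ((\<mu>\<^sup>2 / \<rho>\<^sup>2) * (norm \<zeta>)\<^sup>2) \<le> a / 4 + K * (E * (norm \<zeta>)\<^sup>2)"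
        using K pos scale by (intro add_left_mono mult_left_mono mult_right_mono) (auto simp: divide_le_eq)
      finally show ?thesis by (simp add: mult_ac)
    qed
    moreover have "norm (exp (\<i> * of_real (\<psi> \<zeta> - \<psi> 0)) - 1) * norm (\<Phi> \<xi>) \<le> B * \<beta>\<^sup>2 * 2 powr (\<beta> - 2) * E * (norm \<zeta>)\<^sup>2"
    \<comment> \<open>The Taylor constant requires |xi| \<le> 2N. The support of
      \<open>\<Phi>\<close> guarantees this, and off the support the product vanishes
      anyway.\<close>
    proof (cases "\<Phi> \<xi> = 0")
      case True
      have "E \<ge> 0" using scale(1) pos by (smt (verit) mult_nonneg_nonneg mult_neg_pos zero_le_power2 zero_less_power)
      then show ?thesis using True B0 by simp
    next
      case False
      then have "norm (\<xi> - z\<^sub>0) \<le> R * \<rho>" using supp by force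
      then have n\<xi>: "norm \<xi> \<le> 2 * N"
        using norm_triangle_ineq[of "\<xi> - z\<^sub>0" z\<^sub>0] z0 by simp
      have "\<psi> \<zeta> - \<psi> 0 = t * (norm \<xi> powr \<beta> - norm \<kappa> powr \<beta> - grad \<beta> \<kappa> \<bullet> (\<xi> - \<kappa>))"
        unfolding \<psi>_def \<xi>_def x_def by (simp add: inner_add_right algebra_simps)
      then have "\<bar>\<psi> \<zeta> - \<psi> 0\<bar> = t * \<bar>norm \<xi> powr \<beta> - norm \<kappa> powr \<beta> - grad \<beta> \<kappa> \<bullet> (\<xi> - \<kappa>)\<bar>"
        using pos by (simp add: abs_mult)
      also have "\<dots> \<le> t * (\<beta>\<^sup>2 * (2 * N) powr (\<beta> - 2) * (norm (\<xi> - \<kappa>))\<^sup>2)"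
        using pos by (intro mult_left_mono norm_powr_taylor \<beta> n\<xi> \<kappa>) auto
      also have "\<dots> = \<beta>\<^sup>2 * 2 powr (\<beta> - 2) * (t * N powr (\<beta> - 2) * \<mu>\<^sup>2) * (norm \<zeta>)\<^sup>2"
        using pos by (simp add: d powr_mult power_mult_distrib mult_ac)
      also have "\<dots> \<le> \<beta>\<^sup>2 * 2 powr (\<beta> - 2) * E * (norm \<zeta>)\<^sup>2"
        using scale by (intro mult_right_mono mult_left_mono) auto
      finally have "\<bar>\<psi> \<zeta> - \<psi> 0\<bar> \<le> \<beta>\<^sup>2 * 2 powr (\<beta> - 2) * E * (norm \<zeta>)\<^sup>2" .
      then have "norm (exp (\<i> * of_real (\<psi> \<zeta> - \<psi> 0)) - 1) \<le> \<beta>\<^sup>2 * 2 powr (\<beta> - 2) * E * (norm \<zeta>)\<^sup>2"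
        using norm_iexp_diff_le order.trans by blast
      then have "norm (exp (\<i> * of_real (\<psi> \<zeta> - \<psi> 0)) - 1) * norm (\<Phi> \<xi>) \<le> (\<beta>\<^sup>2 * 2 powr (\<beta> - 2) * E * (norm \<zeta>)\<^sup>2) * B"
        using B B0 by (intro mult_mono) (auto simp: \<Phi>_def intro: order.trans[OF norm_ge_zero])
      then show ?thesis by (simp add: mult_ac)
    qed
    ultimately show ?thesis unfolding Q_def by (simp add: algebra_simps)
  qed
  have f_B: "norm (f \<zeta>) \<le> B" for \<zeta> using B by (simp add: f_def norm_mult \<Phi>_def)
  have ifg: "integrable lborel (\<lambda>\<zeta>. f \<zeta> * of_real (gauss \<zeta>))"
    by (rule Bochner_Integration.integrable_bound[of _ "\<lambda>\<zeta>. B * gauss \<zeta>"])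
       (use B0 f_B in \<open>auto simp: integrable_gauss norm_mult abs_mult gauss_nonneg intro!: mult_right_mono\<close>)
  have icg: "integrable lborel (\<lambda>\<zeta>::real^'n. \<Phi> \<kappa> * of_real (gauss \<zeta>))"
    by (intro integrable_mult_right) (simp add: complex_of_real_integrable_eq integrable_gauss)
  have "norm ((\<integral>\<zeta>. f \<zeta> * of_real (gauss \<zeta>) \<partial>lborel) - (\<integral>\<zeta>. \<Phi> \<kappa> * of_real (gauss (\<zeta>::real^'n)) \<partial>lborel))
      = norm (\<integral>\<zeta>. (f \<zeta> - \<Phi> \<kappa>) * of_real (gauss \<zeta>) \<partial>lborel)"
    by (subst Bochner_Integration.integral_diff[OF ifg icg, symmetric]) (simp add: left_diff_distrib)
  also have "\<dots> \<le> (\<integral>\<zeta>. norm ((f \<zeta> - \<Phi> \<kappa>) * of_real (gauss \<zeta>)) \<partial>lborel)"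
    by (rule integral_norm_bound)
  also have "\<dots> \<le> (\<integral>\<zeta>. a / 4 * gauss \<zeta> + Q * (gauss \<zeta> * (norm (\<zeta>::real^'n))\<^sup>2) \<partial>lborel)"
  proof (rule integral_mono)
    show "integrable lborel (\<lambda>\<zeta>. norm ((f \<zeta> - \<Phi> \<kappa>) * of_real (gauss \<zeta>)))"
      using Bochner_Integration.integrable_diff[OF ifg icg] by (intro integrable_norm) (simp add: left_diff_distrib)
    show "norm ((f \<zeta> - \<Phi> \<kappa>) * of_real (gauss \<zeta>)) \<le> a / 4 * gauss \<zeta> + Q * (gauss \<zeta> * (norm \<zeta>)\<^sup>2)" for \<zeta>
      unfolding norm_mult norm_of_real abs_of_nonneg[OF gauss_nonneg]
      using mult_right_mono[OF f_le[of \<zeta>] gauss_nonneg[of \<zeta>]] by (simp add: algebra_simps)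
  qed (intro Bochner_Integration.integrable_add integrable_mult_right integrable_gauss integrable_gauss_second_moment)
  also have "\<dots> = a / 4 * G + Q * M\<^sub>2"
    by (simp add: integrable_gauss integrable_gauss_second_moment integral_gauss G_def M\<^sub>2_def)
  also have "\<dots> \<le> a / 2 * G" using E unfolding Q_def by linarith
  finally have "norm ((\<integral>\<zeta>. f \<zeta> * of_real (gauss \<zeta>) \<partial>lborel) - \<Phi> \<kappa> * of_real G) \<le> a / 2 * G"
    unfolding integral_mult_right_zero integral_complex_of_real integral_gauss by (simp add: G_def)
  moreover have "norm (\<Phi> \<kappa> * of_real G) \<ge> a * G"
  proof -
    have "norm (\<Phi> \<kappa> * of_real G) = norm (\<Phi> \<kappa>) * G"
      unfolding norm_mult norm_of_real by (simp add: G_def)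
    then show ?thesis using \<kappa>(2) by (simp add: \<Phi>_def G_def mult_right_mono)
  qed
  ultimately have low: "norm (\<integral>\<zeta>. f \<zeta> * of_real (gauss \<zeta>) \<partial>lborel) \<ge> a / 2 * G"
    using norm_triangle_ineq2[of "\<Phi> \<kappa> * of_real G" "\<integral>\<zeta>. f \<zeta> * of_real (gauss \<zeta>) \<partial>lborel"]
    by (simp add: norm_minus_commute)
  have eq: "(\<integral>\<zeta>. exp (\<i> * of_real (x \<bullet> (\<kappa> + \<mu> *\<^sub>R \<zeta>))) * \<Psi> (\<kappa> + \<mu> *\<^sub>R \<zeta>) * of_real (gauss \<zeta>) \<partial>lborel)
     = exp (\<i> * of_real (\<psi> 0)) * (\<integral>\<zeta>. f \<zeta> * of_real (gauss \<zeta>) \<partial>lborel)"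
    unfolding integral_mult_right_zero[symmetric]
  proof (intro Bochner_Integration.integral_cong refl)
    fix \<zeta>
    have "exp (\<i> * of_real (x \<bullet> (\<kappa> + \<mu> *\<^sub>R \<zeta>))) * exp (\<i> * of_real (t * norm (\<kappa> + \<mu> *\<^sub>R \<zeta>) powr \<beta>))
        = exp (\<i> * of_real (\<psi> 0)) * exp (\<i> * of_real (\<psi> \<zeta> - \<psi> 0))"
      unfolding exp_add[symmetric] by (simp add: \<psi>_def algebra_simps)
    then show "exp (\<i> * of_real (x \<bullet> (\<kappa> + \<mu> *\<^sub>R \<zeta>))) * \<Psi> (\<kappa> + \<mu> *\<^sub>R \<zeta>) * of_real (gauss \<zeta>) =
       exp (\<i> * of_real (\<psi> 0)) * (f \<zeta> * of_real (gauss \<zeta>))"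
      unfolding \<Psi>_def f_def by (simp only: mult.assoc[symmetric])
  qed
  let ?I = "\<lambda>\<theta>. of_real (gauss \<theta>) * (exp (\<i> * of_real (- (\<theta> \<bullet> \<kappa>) / \<mu>)) * ifourier \<Psi> (x + (1 / \<mu>) *\<^sub>R \<theta>))"
  have G0: "G > 0" by (simp add: G_def)
  have packet: "norm (\<integral>\<theta>. ?I \<theta> \<partial>lborel) \<ge> \<mu> ^ CARD('n) * a / 2"
  proof -
    have "norm (\<integral>\<theta>. ?I \<theta> \<partial>lborel) = \<mu> ^ CARD('n) / G * norm (\<integral>\<zeta>. f \<zeta> * of_real (gauss \<zeta>) \<partial>lborel)"
      unfolding gauss_packet[OF i\<Psi> pos(2)] eq using pos G0 by (simp add: norm_mult norm_divide norm_power G_def)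
    also have "\<dots> \<ge> \<mu> ^ CARD('n) / G * (a / 2 * G)"
      using low pos G0 by (intro mult_left_mono) auto
    finally show ?thesis using G0 by simp
  qed
  have "ennreal (\<mu> ^ CARD('n) * a / 2) \<le> ennreal (norm (\<integral>\<theta>. ?I \<theta> \<partial>lborel))"
    using packet by (rule ennreal_leI)
  also have "\<dots> \<le> (\<integral>\<^sup>+\<theta>. ennreal (norm (?I \<theta>)) \<partial>lborel)"
  \<comment> \<open>A Bochner integral that does not exist has value 0, so the bound is trivial in
    that case.\<close>
  proof (cases "integrable lborel ?I")
    case True
    then show ?thesis by (rule integral_norm_bound_ennreal)
  qed (simp add: not_integrable_integral_eq)
  also have "\<dots> = (\<integral>\<^sup>+\<theta>. ennreal (gauss \<theta>) * ennreal (norm (schro \<beta> t u (x + (1 / \<mu>) *\<^sub>R \<theta>))) \<partial>lborel)"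
    unfolding v by (simp add: norm_mult gauss_nonneg ennreal_mult)
  finally show ?thesis unfolding x_def .
qed

text \<open>Jensen's inequality by the tangent of v^r at m. The tangent inequality is rearranged so
  that all terms are nonnegative, which allows infinite integrals; only the finite Gaussian term is
  cancelled at the end.\<close>

lemma gauss_jensen:
  fixes V :: "'a::euclidean_space \<Rightarrow> real"
  assumes [measurable]: "V \<in> borel_measurable borel" and V: "\<And>x. V x \<ge> 0" and m: "m > 0" and r: "r \<ge> 1"
    and low: "ennreal (sqrt (2 * pi) ^ DIM('a) * m) \<le> (\<integral>\<^sup>+x. ennreal (gauss x) * ennreal (V x) \<partial>lborel)"
  shows "ennreal (sqrt (2 * pi) ^ DIM('a) * m powr r) \<le> (\<integral>\<^sup>+x. ennreal (gauss x) * ennreal (V x powr r) \<partial>lborel)"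
proof -
  let ?G = "sqrt (2 * pi) ^ DIM('a)"
  have G: "(\<integral>\<^sup>+x. ennreal (gauss (x::'a)) \<partial>lborel) = ennreal ?G"
    by (simp add: integral_gauss nn_integral_eq_integral integrable_gauss gauss_nonneg)
  have mr: "m powr (r - 1) * m = m powr r" using m by (simp add: powr_diff)
  have pt: "r * m powr (r - 1) * v \<le> v powr r + (r - 1) * m powr r" if "v \<ge> 0" for v
  proof -
    have "r * m powr (r - 1) * (v - m) = r * m powr (r - 1) * v - r * m powr r"
      using mr by (metis (no_types, opaque_lifting) mult.assoc right_diff_distrib)
    then show ?thesis using powr_above_tangent[of v m r] that m r by (simp add: algebra_simps)
  qed
  have "ennreal (?G * m powr r) + ennreal ((r - 1) * m powr r) * ennreal ?G
     = ennreal (r * m powr (r - 1)) * ennreal (?G * m)"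
    using r m mr by (simp add: ennreal_mult[symmetric] ennreal_plus[symmetric] algebra_simps del: ennreal_plus)
  also have "\<dots> \<le> ennreal (r * m powr (r - 1)) * (\<integral>\<^sup>+x. ennreal (gauss x) * ennreal (V x) \<partial>lborel)"
    by (rule mult_left_mono[OF low]) simp
  also have "\<dots> = (\<integral>\<^sup>+x. ennreal (gauss x) * ennreal (r * m powr (r - 1) * V x) \<partial>lborel)"
    using r V by (subst nn_integral_cmult[symmetric]) (auto simp: ennreal_mult mult_ac)
  also have "\<dots> \<le> (\<integral>\<^sup>+x. ennreal (gauss x) * ennreal (V x powr r) + ennreal ((r - 1) * m powr r) * ennreal (gauss x) \<partial>lborel)"
  proof (rule nn_integral_mono)
    fix x
    have "ennreal (gauss x) * ennreal (r * m powr (r - 1) * V x) \<le> ennreal (gauss x) * ennreal (V x powr r + (r - 1) * m powr r)"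
      using pt[OF V] by (intro mult_left_mono ennreal_leI) auto
    then show "ennreal (gauss x) * ennreal (r * m powr (r - 1) * V x)
        \<le> ennreal (gauss x) * ennreal (V x powr r) + ennreal ((r - 1) * m powr r) * ennreal (gauss x)"
      using r by (simp add: distrib_left mult.commute)
  qed
  also have "\<dots> = (\<integral>\<^sup>+x. ennreal (gauss x) * ennreal (V x powr r) \<partial>lborel) + ennreal ((r - 1) * m powr r) * ennreal ?G"
    by (subst nn_integral_add) (auto simp: nn_integral_cmult G)
  finally show ?thesis
    unfolding add.commute[of _ "ennreal ((r - 1) * m powr r) * ennreal ?G"]
    by (subst (asm) ennreal_add_left_cancel_le) (auto simp: ennreal_mult_eq_top_iff)
qed

section \<open>Averaging over wave packets\<close>

lemma gauss_average_shift:
  fixes W :: "'a::euclidean_space \<Rightarrow> ennreal"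
  assumes [measurable]: "W \<in> borel_measurable borel" and \<mu>: "\<mu> > 0"
  shows "(\<integral>\<^sup>+\<theta>. ennreal (gauss \<theta>) * W (x + (1 / \<mu>) *\<^sub>R \<theta>) \<partial>lborel)
     = ennreal (\<mu> ^ DIM('a)) * (\<integral>\<^sup>+y. ennreal (gauss (\<mu> *\<^sub>R (y - x))) * W y \<partial>lborel)"
proof -
  have "(\<integral>\<^sup>+\<theta>. ennreal (gauss \<theta>) * W (x + (1 / \<mu>) *\<^sub>R \<theta>) \<partial>lborel) = ennreal (\<bar>\<mu>\<bar> ^ DIM('a)) *
     (\<integral>\<^sup>+y. ennreal (gauss (- \<mu> *\<^sub>R x + \<mu> *\<^sub>R y)) * W (x + (1 / \<mu>) *\<^sub>R (- \<mu> *\<^sub>R x + \<mu> *\<^sub>R y)) \<partial>lborel)"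
    by (rule nn_integral_lborel_affine) (use \<mu> in auto)
  also have "\<dots> = ennreal (\<mu> ^ DIM('a)) * (\<integral>\<^sup>+y. ennreal (gauss (\<mu> *\<^sub>R (y - x))) * W y \<partial>lborel)"
    using \<mu> by (simp add: scaleR_add_right scaleR_diff_right)
  finally show ?thesis .
qed

text \<open>Integrating Jensen's bound over the centres in \<open>S\<close> and exchanging the
  integrals leaves, at each y, the total weight of the packets that reach y. \<open>Z\<close> bounds
  this overlap.\<close>

lemma average_lower_bound:
  fixes V :: "'a::euclidean_space \<Rightarrow> real" and X :: "'a \<Rightarrow> 'a"
  assumes [measurable]: "V \<in> borel_measurable borel" "X \<in> borel_measurable borel" "S \<in> sets borel"
    and V: "\<And>x. V x \<ge> 0" and pos: "m > 0" "r \<ge> 1" "\<mu> > 0"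
    and low: "\<And>\<kappa>. \<kappa> \<in> S \<Longrightarrow> ennreal (sqrt (2 * pi) ^ DIM('a) * m) \<le>
        (\<integral>\<^sup>+\<theta>. ennreal (gauss \<theta>) * ennreal (V (X \<kappa> + (1 / \<mu>) *\<^sub>R \<theta>)) \<partial>lborel)"
    and Z: "\<And>y. (\<integral>\<^sup>+\<kappa>. indicator S \<kappa> * ennreal (gauss (\<mu> *\<^sub>R (y - X \<kappa>))) \<partial>lborel) \<le> Z"
  shows "emeasure lborel S * ennreal (sqrt (2 * pi) ^ DIM('a) * m powr r)
     \<le> ennreal (\<mu> ^ DIM('a)) * Z * (\<integral>\<^sup>+y. ennreal (V y powr r) \<partial>lborel)"
proof -
  let ?c = "ennreal (sqrt (2 * pi) ^ DIM('a) * m powr r)" and ?d = "ennreal (\<mu> ^ DIM('a))"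
  let ?K = "\<lambda>\<kappa> y. indicator S \<kappa> * ennreal (gauss (\<mu> *\<^sub>R (y - X \<kappa>)))"
  have "emeasure lborel S * ?c = (\<integral>\<^sup>+\<kappa>. indicator S \<kappa> * ?c \<partial>lborel)"
    by (simp add: nn_integral_multc)
  also have "\<dots> \<le> (\<integral>\<^sup>+\<kappa>. \<integral>\<^sup>+y. ?d * (?K \<kappa> y * ennreal (V y powr r)) \<partial>lborel \<partial>lborel)"
  proof (rule nn_integral_mono)
    fix \<kappa>
    show "indicator S \<kappa> * ?c \<le> (\<integral>\<^sup>+y. ?d * (?K \<kappa> y * ennreal (V y powr r)) \<partial>lborel)"
    proof (cases "\<kappa> \<in> S")
      case True
      have "?c \<le> (\<integral>\<^sup>+\<theta>. ennreal (gauss \<theta>) * ennreal (V (X \<kappa> + (1 / \<mu>) *\<^sub>R \<theta>) powr r) \<partial>lborel)"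
        by (rule gauss_jensen[OF _ V pos(1,2) low[OF True]]) measurable
      also have "\<dots> = ?d * (\<integral>\<^sup>+y. ennreal (gauss (\<mu> *\<^sub>R (y - X \<kappa>))) * ennreal (V y powr r) \<partial>lborel)"
        by (rule gauss_average_shift) (use pos in auto)
      also have "\<dots> = (\<integral>\<^sup>+y. ?d * (?K \<kappa> y * ennreal (V y powr r)) \<partial>lborel)"
        using True by (subst nn_integral_cmult[symmetric]) auto
      finally show ?thesis using True by simp
    qed simp
  qed
  also have "\<dots> = (\<integral>\<^sup>+y. \<integral>\<^sup>+\<kappa>. ?d * (?K \<kappa> y * ennreal (V y powr r)) \<partial>lborel \<partial>lborel)"
    by (rule lborel_pair.Fubini') measurable
  also have "\<dots> = (\<integral>\<^sup>+y. ?d * ((\<integral>\<^sup>+\<kappa>. ?K \<kappa> y \<partial>lborel) * ennreal (V y powr r)) \<partial>lborel)"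
    by (simp add: nn_integral_cmult nn_integral_multc)
  also have "\<dots> \<le> (\<integral>\<^sup>+y. ?d * Z * ennreal (V y powr r) \<partial>lborel)"
    unfolding mult.assoc by (intro nn_integral_mono mult_left_mono mult_right_mono Z) auto
  also have "\<dots> = ?d * Z * (\<integral>\<^sup>+y. ennreal (V y powr r) \<partial>lborel)"
    by (rule nn_integral_cmult) measurable
  finally show ?thesis .
qed

text \<open>Counterpart for p = \<infinity>: a Gaussian average is at most its mass times the
  essential supremum, so one packet suffices.\<close>

lemma sup_lower_bound:
  fixes V :: "'a::euclidean_space \<Rightarrow> real"
  assumes [measurable]: "V \<in> borel_measurable borel" and \<mu>: "\<mu> > 0" and m: "m > 0"
    and low: "ennreal (sqrt (2 * pi) ^ DIM('a) * m) \<le>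
        (\<integral>\<^sup>+\<theta>. ennreal (gauss \<theta>) * ennreal (V (x + (1 / \<mu>) *\<^sub>R \<theta>)) \<partial>lborel)"
    and ae: "AE y in lborel. ennreal (V y) \<le> c"
  shows "ennreal m \<le> c"
proof -
  let ?G = "sqrt (2 * pi) ^ DIM('a)"
  have "ennreal (?G * m) \<le> ennreal (\<mu> ^ DIM('a)) * (\<integral>\<^sup>+y. ennreal (gauss (\<mu> *\<^sub>R (y - x))) * ennreal (V y) \<partial>lborel)"
    using low by (subst (asm) gauss_average_shift[OF _ \<mu>]) auto
  also have "\<dots> \<le> ennreal (\<mu> ^ DIM('a)) * (\<integral>\<^sup>+y. ennreal (gauss (\<mu> *\<^sub>R (x - y))) * c \<partial>lborel)"
  proof (intro mult_left_mono nn_integral_mono_AE)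
    show "AE y in lborel. ennreal (gauss (\<mu> *\<^sub>R (y - x))) * ennreal (V y) \<le> ennreal (gauss (\<mu> *\<^sub>R (x - y))) * c"
      using ae
    proof eventually_elim
      case (elim y)
      have "gauss (\<mu> *\<^sub>R (y - x)) = gauss (\<mu> *\<^sub>R (x - y))" by (simp add: gauss_def norm_minus_commute)
      then show ?case using elim by (simp add: mult_left_mono)
    qed
  qed simp
  also have "\<dots> = ennreal (\<mu> ^ DIM('a)) * ennreal (?G / \<mu> ^ DIM('a)) * c"
    using \<mu> by (simp add: nn_integral_multc nn_integral_gauss_affine mult.assoc)
  also have "ennreal (\<mu> ^ DIM('a)) * ennreal (?G / \<mu> ^ DIM('a)) = ennreal ?G"
    using \<mu> by (simp add: ennreal_mult[symmetric])
  finally have *: "ennreal ?G * ennreal m \<le> ennreal ?G * c" using m by (simp add: ennreal_mult)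
  have "?G > 0" by simp
  show ?thesis
  proof (cases c)
    case (real y)
    then show ?thesis using * m by (simp add: ennreal_mult[symmetric])
  qed simp
qed

section \<open>Space-time norms from time slices\<close>

lemma strip_sets: "({0..1} :: real set) \<times> (UNIV :: (real^'n::finite) set) \<in> sets borel"
  by (intro borel_closed closed_Times) auto

lemma stn_ge_finite:
  fixes F :: "real \<times> (real^'n::finite) \<Rightarrow> complex"
  assumes F[measurable]: "F \<in> borel_measurable borel" and p: "1 \<le> p" "p \<noteq> \<infinity>" and t: "0 \<le> t\<^sub>0" "t\<^sub>0 < t\<^sub>1" "t\<^sub>1 \<le> 1"
    and W: "\<And>t. t \<in> {t\<^sub>0..t\<^sub>1} \<Longrightarrow> ennreal W \<le> (\<integral>\<^sup>+x. ennreal (norm (F (t, x)) powr enn2real p) \<partial>lborel)" "W \<ge> 0"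
  shows "ennreal (((t\<^sub>1 - t\<^sub>0) * W) powr (1 / enn2real p)) \<le> stn p F"
proof -
  define r where "r = enn2real p"
  let ?A = "({0..1} :: real set) \<times> (UNIV :: (real^'n) set)"
  have [measurable]: "F \<in> borel_measurable (borel \<Otimes>\<^sub>M borel)" using F by (simp add: borel_prod)
  have "ennreal ((t\<^sub>1 - t\<^sub>0) * W) = (\<integral>\<^sup>+t. ennreal W * indicator {t\<^sub>0..t\<^sub>1} t \<partial>lborel)"
    using t W by (simp add: nn_integral_cmult_indicator ennreal_mult[symmetric] mult.commute)
  also have "\<dots> \<le> (\<integral>\<^sup>+t. \<integral>\<^sup>+x. ennreal (norm (F (t, x)) powr r) * indicator ?A (t, x) \<partial>lborel \<partial>lborel)"
  proof (rule nn_integral_mono)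
    fix t :: real
    show "ennreal W * indicator {t\<^sub>0..t\<^sub>1} t \<le> (\<integral>\<^sup>+x. ennreal (norm (F (t, x)) powr r) * indicator ?A (t, x) \<partial>lborel)"
    proof (cases "t \<in> {t\<^sub>0..t\<^sub>1}")
      case True
      then have "(t, x) \<in> ?A" for x using t by auto
      then show ?thesis using W(1)[OF True] True by (simp add: r_def)
    qed simp
  qed
  also have "\<dots> = (\<integral>\<^sup>+z. ennreal (norm (F z) powr r) * indicator ?A z \<partial>(lborel \<Otimes>\<^sub>M lborel))"
    by (rule lborel.nn_integral_fst) measurable
  also have "\<dots> = (\<integral>\<^sup>+z. ennreal (norm (F z) powr r) \<partial>restrict_space lborel ?A)"
    by (subst nn_integral_restrict_space) (use strip_sets in \<open>auto simp: lborel_prod\<close>)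
  finally have "epow (ennreal ((t\<^sub>1 - t\<^sub>0) * W)) (1 / r) \<le> epow (\<integral>\<^sup>+z. ennreal (norm (F z) powr r) \<partial>restrict_space lborel ?A) (1 / r)"
    by (rule epow_mono) (simp add: r_def)
  then show ?thesis
    using p t W unfolding stn_def lpn_def r_def by (simp add: epow_ennreal)
qed

text \<open>An almost everywhere bound on the strip holds on almost every slice, and an interval of
  positive length must contain the time of such a slice.\<close>

lemma stn_ge_infinity:
  fixes F :: "real \<times> (real^'n::finite) \<Rightarrow> complex"
  assumes F[measurable]: "F \<in> borel_measurable borel" and t: "0 \<le> t\<^sub>0" "t\<^sub>0 < t\<^sub>1" "t\<^sub>1 \<le> 1"
    and W: "\<And>t c. t \<in> {t\<^sub>0..t\<^sub>1} \<Longrightarrow> AE x in lborel. ennreal (norm (F (t, x))) \<le> c \<Longrightarrow> W \<le> c"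
  shows "W \<le> stn \<infinity> F"
proof -
  let ?A = "({0..1} :: real set) \<times> (UNIV :: (real^'n) set)"
  have [measurable]: "F \<in> borel_measurable (borel \<Otimes>\<^sub>M borel)" using F by (simp add: borel_prod)
  have "W \<le> c" if "AE z in restrict_space lborel ?A. ennreal (norm (F z)) \<le> c" for c
  proof -
    have "AE z in lborel. z \<in> ?A \<longrightarrow> ennreal (norm (F z)) \<le> c"
      using that strip_sets by (subst (asm) AE_restrict_space_iff) auto
    then have "AE z in lborel \<Otimes>\<^sub>M lborel. z \<in> ?A \<longrightarrow> ennreal (norm (F z)) \<le> c"
      unfolding lborel_prod .
    then have ae: "AE t in lborel. AE x in lborel. (t, x) \<in> ?A \<longrightarrow> ennreal (norm (F (t, x))) \<le> c"
      by (rule lborel_pair.AE_pair)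
    have "\<exists>t\<in>{t\<^sub>0..t\<^sub>1}. AE x in lborel. (t, x) \<in> ?A \<longrightarrow> ennreal (norm (F (t, x))) \<le> c"
    proof (rule ccontr)
      assume "\<not> ?thesis"
      with ae have "AE t in lborel. t \<notin> {t\<^sub>0..t\<^sub>1}" by (auto elim!: eventually_mono)
      then have "emeasure lborel {t\<^sub>0..t\<^sub>1} = 0"
        by (subst (asm) AE_iff_measurable[OF _ refl]) (auto simp: atLeastAtMost_def Int_def)
      then show False using t by simp
    qed
    then obtain t where t': "t \<in> {t\<^sub>0..t\<^sub>1}" and "AE x in lborel. (t, x) \<in> ?A \<longrightarrow> ennreal (norm (F (t, x))) \<le> c"
      by blast
    then have "AE x in lborel. ennreal (norm (F (t, x))) \<le> c"
      using t by (auto elim!: eventually_mono)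
    then show ?thesis using W[OF t'] by blast
  qed
  then show ?thesis unfolding stn_def lpn_def by (auto intro!: Inf_greatest)
qed

lemma measurable_schro:
  fixes u :: "real^'n::finite \<Rightarrow> complex"
  assumes [measurable]: "fourier u \<in> borel_measurable borel"
  shows "(\<lambda>(t, x). schro \<beta> t u x) \<in> borel_measurable borel"
proof -
  have "(\<lambda>(t, x). schro \<beta> t u x) \<in> borel_measurable (borel \<Otimes>\<^sub>M borel)"
    unfolding schro_def ifourier_def by measurable
  then show ?thesis by (simp add: borel_prod)
qed

section \<open>Overlap of packets for times of order 1\<close>

lemma measurable_grad [measurable]: "grad \<beta> \<in> borel_measurable borel"
  unfolding grad_def by measurable

text \<open>Let k be the centre in the ball whose position is closest to y. By expansion, every
  other position is at distance at least L |k - \<kappa>| from y, so the weights lie below a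
  Gaussian in \<kappa> centred at k whose integral is explicit. The bound
  \<open>\<sigma> \<le> N / 2\<close> keeps the ball where |\<kappa>| \<ge> N/2.\<close>

lemma gauss_overlap_le:
  fixes z\<^sub>0 y :: "'a::euclidean_space"
  assumes \<beta>: "\<beta> > 2" and \<mu>: "\<mu> > 0" and t: "t \<ge> 1 / 2" and z0: "norm z\<^sub>0 = N" "N > 0"
    and \<sigma>: "0 \<le> \<sigma>" "\<sigma> \<le> N / 2"
  defines "L \<equiv> \<beta> * (N / 2) powr (\<beta> - 2) / 4"
  shows "(\<integral>\<^sup>+\<kappa>. indicator (cball z\<^sub>0 \<sigma>) \<kappa> * ennreal (gauss (\<mu> *\<^sub>R (y - (- t *\<^sub>R grad \<beta> \<kappa>)))) \<partial>lborel)
     \<le> ennreal (sqrt (2 * pi) ^ DIM('a) / (\<mu> * L) ^ DIM('a))"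
proof -
  let ?S = "cball z\<^sub>0 \<sigma>" and ?X = "\<lambda>\<kappa>. - t *\<^sub>R grad \<beta> \<kappa>"
  have L: "L > 0" using \<beta> z0 by (simp add: L_def)
  have nS: "N / 2 \<le> norm \<kappa>" if "\<kappa> \<in> ?S" for \<kappa>
    using that \<sigma> z0 norm_triangle_ineq2[of z\<^sub>0 \<kappa>] by (simp add: dist_norm)
  have cont: "continuous_on ?S (\<lambda>\<kappa>. norm (y - ?X \<kappa>))"
  proof -
    have "norm \<kappa> \<noteq> 0" if "\<kappa> \<in> ?S" for \<kappa> using nS[OF that] z0 by linarith
    then show ?thesis unfolding grad_def by (intro continuous_intros) auto
  qed
  have "?S \<noteq> {}" using \<sigma> by simp
  then obtain k where k: "k \<in> ?S" "\<And>\<kappa>. \<kappa> \<in> ?S \<Longrightarrow> norm (y - ?X k) \<le> norm (y - ?X \<kappa>)"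
    using continuous_attains_inf[OF compact_cball _ cont] by blast
  have le: "gauss (\<mu> *\<^sub>R (y - ?X \<kappa>)) \<le> gauss ((\<mu> * L) *\<^sub>R (k - \<kappa>))" if "\<kappa> \<in> ?S" for \<kappa>
  proof -
    \<comment> \<open>The 4 in \<open>L\<close> pays for t \<ge> 1/2 and for the triangle inequality
      through y, each at the cost of a factor 2.\<close>
    have "4 * L * norm (k - \<kappa>) \<le> norm (grad \<beta> k - grad \<beta> \<kappa>)"
      using grad_expanding[OF \<beta>, of "N / 2" k \<kappa>] nS[OF k(1)] nS[OF that] z0 by (simp add: L_def)
    also have "\<dots> \<le> 2 * t * norm (grad \<beta> k - grad \<beta> \<kappa>)"
      using t by (simp add: mult_le_cancel_right1)
    also have "\<dots> = 2 * norm (t *\<^sub>R grad \<beta> k - t *\<^sub>R grad \<beta> \<kappa>)"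
      unfolding scaleR_diff_right[symmetric] using t by simp
    also have "t *\<^sub>R grad \<beta> k - t *\<^sub>R grad \<beta> \<kappa> = (y - ?X k) - (y - ?X \<kappa>)" by simp
    also have "2 * norm ((y - ?X k) - (y - ?X \<kappa>)) \<le> 4 * norm (y - ?X \<kappa>)"
      using norm_triangle_ineq4[of "y - ?X k" "y - ?X \<kappa>"] k(2)[OF that] by linarith
    finally have "L * norm (k - \<kappa>) \<le> norm (y - ?X \<kappa>)" by simp
    then have "\<mu> * (L * norm (k - \<kappa>)) \<le> \<mu> * norm (y - ?X \<kappa>)" using \<mu> by (intro mult_left_mono) auto
    then have "norm ((\<mu> * L) *\<^sub>R (k - \<kappa>)) \<le> norm (\<mu> *\<^sub>R (y - ?X \<kappa>))"
      using \<mu> L by (simp add: mult.assoc)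
    then show ?thesis unfolding gauss_def by (simp add: power_mono del: norm_scaleR)
  qed
  have "(\<integral>\<^sup>+\<kappa>. indicator ?S \<kappa> * ennreal (gauss (\<mu> *\<^sub>R (y - ?X \<kappa>))) \<partial>lborel)
     \<le> (\<integral>\<^sup>+\<kappa>. ennreal (gauss ((\<mu> * L) *\<^sub>R (k - \<kappa>))) \<partial>lborel)"
    using le by (intro nn_integral_mono) (auto simp: indicator_def intro!: ennreal_leI)
  also have "\<dots> = ennreal (sqrt (2 * pi) ^ DIM('a) / (\<mu> * L) ^ DIM('a))"
    by (rule nn_integral_gauss_affine) (use \<mu> L in simp)
  finally show ?thesis .
qed

section \<open>Necessary conditions\<close>

text \<open>If x exceeded y, then N^(x-y) would be unbounded; \<open>T\<close> is the size at which
  it reaches |C|/c + 1.\<close>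

lemma powr_exponent_le:
  fixes x y c C N\<^sub>0 :: real
  assumes c: "c > 0" and le: "\<And>N. N \<ge> N\<^sub>0 \<Longrightarrow> N \<ge> 1 \<Longrightarrow> c * N powr x \<le> C * N powr y"
  shows "x \<le> y"
proof (rule ccontr)
  assume "\<not> x \<le> y"
  then have xy: "x - y > 0" by simp
  define T where "T = (\<bar>C\<bar> / c + 1) powr (1 / (x - y))"
  define N where "N = max N\<^sub>0 (max 1 T)"
  have N: "N \<ge> N\<^sub>0" "N \<ge> 1" "N \<ge> T" by (auto simp: N_def)
  have "\<bar>C\<bar> / c + 1 = T powr (x - y)"
    unfolding T_def powr_powr using xy c by (simp add: add_nonneg_pos less_imp_le)
  also have "\<dots> \<le> N powr (x - y)" using N xy by (intro powr_mono2) (auto simp: T_def)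
  also have "\<dots> \<le> C / c"
    using le[OF N(1,2)] N(2) c by (simp add: powr_diff field_simps)
  also have "\<dots> \<le> \<bar>C\<bar> / c" using c by (intro divide_right_mono) auto
  finally show False by simp
qed

section \<open>Test functions taken from the frequency partition\<close>

lemma admissible_bump:
  fixes \<eta> :: "real^'n::finite \<Rightarrow> real^'n \<Rightarrow> complex"
  assumes adm: "admissible \<eta>"
  obtains R B a c where "R > 0" "a > 0" "c > 0" "c \<le> R"
    "\<And>k \<xi>. k \<in> lattice \<Longrightarrow> norm (\<xi> - k) \<ge> R \<Longrightarrow> \<eta> k \<xi> = 0"
    "\<And>k. k \<in> lattice \<Longrightarrow> continuous_on UNIV (\<eta> k)"
    "\<And>k \<xi>. k \<in> lattice \<Longrightarrow> norm (\<eta> k \<xi>) \<le> B"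
    "\<And>\<xi>. norm \<xi> < c \<Longrightarrow> a \<le> norm (\<eta> 0 \<xi>)"
proof -
  have 0: "0 \<in> (lattice :: (real^'n) set)" by (simp add: lattice_def)
  from adm obtain R where R: "R > 0" "\<And>k \<xi>. k \<in> lattice \<Longrightarrow> norm (\<xi> - k) \<ge> R \<Longrightarrow> \<eta> k \<xi> = 0"
    unfolding admissible_def by blast
  from adm have "\<exists>c a. c > 0 \<and> a > 0 \<and> (\<forall>k\<in>lattice. \<forall>\<xi>. norm (\<xi> - k) < c \<longrightarrow> norm (\<eta> k \<xi>) \<ge> a)"
    unfolding admissible_def by (elim conjE)
  then obtain c a where ca: "c > 0" "a > 0" "\<And>k \<xi>. k \<in> lattice \<Longrightarrow> norm (\<xi> - k) < c \<Longrightarrow> a \<le> norm (\<eta> k \<xi>)"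
    by blast
  from adm have "\<exists>B. \<forall>k\<in>lattice. \<forall>\<xi>. norm (pders [] (\<eta> k) \<xi>) \<le> B"
    unfolding admissible_def by blast
  then obtain B where B: "\<And>k \<xi>. k \<in> lattice \<Longrightarrow> norm (\<eta> k \<xi>) \<le> B" by auto
  have "continuous_on UNIV (pders [] (\<eta> k))" if "k \<in> lattice" for k
    using adm that unfolding admissible_def schwartz_def smooth_fn_def by blast
  then have cont: "continuous_on UNIV (\<eta> k)" if "k \<in> lattice" for k using that by simp
  \<comment> \<open>Replacing c by \<open>min c R\<close> lets later bounds on R \<rho> control c
    \<rho> as well.\<close>
  show thesis
    by (rule that[of R a "min c R" B]) (use R ca B cont 0 ca(3)[of 0] in auto)
qed

lemma integrable_ifourier_eta:
  fixes \<eta> :: "real^'n::finite \<Rightarrow> real^'n \<Rightarrow> complex"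
  assumes adm: "admissible \<eta>" and k: "k \<in> lattice"
  shows "integrable lborel (\<eta> k)" and "integrable lborel (ifourier (\<eta> k))"
proof -
  from admissible_bump[OF adm] obtain R B where R: "R > 0"
    and z: "\<And>k \<xi>. k \<in> lattice \<Longrightarrow> norm (\<xi> - k) \<ge> R \<Longrightarrow> \<eta> k \<xi> = 0"
    and cont: "\<And>k. k \<in> lattice \<Longrightarrow> continuous_on UNIV (\<eta> k)"
    and B: "\<And>k \<xi>. k \<in> lattice \<Longrightarrow> norm (\<eta> k \<xi>) \<le> B" by metis
  have [measurable]: "\<eta> k \<in> borel_measurable borel"
    using cont[OF k] by (rule borel_measurable_continuous_onI)
  show "integrable lborel (\<eta> k)"
    by (rule integrable_bounded_support(1)[where k = k and R = R and B = B]) (use R z B k in auto)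
  obtain B' where B': "B' > 0" "\<And>x. norm (ifourier (\<eta> k) x) \<le> B' * decay x"
    using kernel_decay[OF adm] k by blast
  show "integrable lborel (ifourier (\<eta> k))"
  proof (rule Bochner_Integration.integrable_bound[of _ "\<lambda>x. B' * decay x"])
    show "integrable lborel (\<lambda>x::real^'n. B' * decay x)"
      by (intro integrable_mult_right integrable_decay)
    show "ifourier (\<eta> k) \<in> borel_measurable lborel" using measurable_ifourier[of "\<eta> k"] by simp
  qed (use B' in \<open>auto simp: decay_nonneg\<close>)
qed

text \<open>The weight at k lies between N/2 and 2N, and a ratio between 1/2 and 2 has s-th power at
  most 2^|s| for either sign of s.\<close>

lemma jb_powr_le:
  assumes N: "N \<ge> 1" and k: "norm (k - z\<^sub>0) \<le> N / 2" "norm z\<^sub>0 = N"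
  shows "jb k powr s \<le> 2 powr \<bar>s\<bar> * N powr s"
proof -
  have n: "N / 2 \<le> norm k" "norm k \<le> 3 / 2 * N"
    using k norm_triangle_ineq2[of z\<^sub>0 k] norm_triangle_ineq2[of k z\<^sub>0] by (auto simp: norm_minus_commute)
  have "(N / 2)\<^sup>2 \<le> (norm k)\<^sup>2" using n N by (intro power_mono) auto
  then have lo: "N / 2 \<le> jb k" unfolding jb_def by (intro real_le_rsqrt) linarith
  have "1 + (norm k)\<^sup>2 \<le> (2 * N)\<^sup>2"
    using power_mono[OF n(2), of 2] power_mono[OF N, of 2] by (simp add: power_mult_distrib power_divide)
  then have hi: "jb k \<le> 2 * N" unfolding jb_def using N by (intro real_le_lsqrt) auto
  have "(jb k / N) powr s \<le> 2 powr \<bar>s\<bar>"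
  proof (cases "s \<ge> 0")
    case True
    then show ?thesis using powr_mono2[of s "jb k / N" 2] lo hi N by (simp add: divide_le_eq)
  next
    case False
    have "(jb k / N) powr s \<le> (1 / 2) powr s"
      using False lo N by (intro powr_mono2') (auto simp: le_divide_eq)
    also have "(1 / 2) powr s = 2 powr \<bar>s\<bar>" using False by (simp add: powr_divide powr_minus_divide)
    finally show ?thesis .
  qed
  then show ?thesis using N lo by (simp add: powr_divide divide_le_eq)
qed

text \<open>Only k within R + R \<rho> of \<open>z\<^sub>0\<close> meet the support of the bump.
  There are O((1 + \<rho>)^d) of them, all have weight O(N^s) since R + R \<rho> \<le> N/2, and each
  piece has L^p norm O(1).\<close>

lemma modn_test_function_le:
  fixes \<eta> :: "real^'n::finite \<Rightarrow> real^'n \<Rightarrow> complex"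
  assumes adm: "admissible \<eta>" and pq: "1 \<le> p" "1 \<le> q"
    and R: "R > 0" and z: "\<And>k \<xi>. k \<in> lattice \<Longrightarrow> norm (\<xi> - k) \<ge> R \<Longrightarrow> \<eta> k \<xi> = 0"
  shows "\<exists>K>0. \<forall>N \<rho> z\<^sub>0. norm z\<^sub>0 = N \<longrightarrow> N \<ge> 1 \<longrightarrow> \<rho> > 0 \<longrightarrow> R + R * \<rho> \<le> N / 2 \<longrightarrow>
     modn \<eta> p q s (ifourier (\<lambda>\<xi>. \<eta> 0 ((1 / \<rho>) *\<^sub>R (\<xi> - z\<^sub>0))))
       \<le> ennreal (K * N powr s * (1 + \<rho>) powr (real CARD('n) * enn2real (1 / q)))"
proof -
  have 0: "0 \<in> (lattice :: (real^'n) set)" by (simp add: lattice_def)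
  from admissible_bump[OF adm] obtain B where cont: "\<And>k. k \<in> lattice \<Longrightarrow> continuous_on UNIV (\<eta> k)"
    and B: "\<And>k \<xi>. k \<in> lattice \<Longrightarrow> norm (\<eta> k \<xi>) \<le> B" by metis
  obtain B' where B': "B' > 0" "\<And>k x. k \<in> lattice \<Longrightarrow> norm (ifourier (\<eta> k) x) \<le> B' * decay x"
    using kernel_decay[OF adm] by blast
  define U where "U = (\<integral>x. norm (ifourier (\<eta> 0) x) \<partial>lborel)"
  define A where "A = max 1 (integral\<^sup>L lborel (decay :: real^'n \<Rightarrow> real))"
  define iq where "iq = enn2real (1 / q)"
  have U: "U \<ge> 0" by (simp add: U_def)
  have iq: "iq \<ge> 0" by (simp add: iq_def)
  \<comment> \<open>\<open>U + 1\<close> instead of \<open>U\<close> makes the constant strictly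
    positive.\<close>
  define K where "K = 2 powr \<bar>s\<bar> * (B' * (U + 1) * A) * (2 * R + 1) powr (real CARD('n) * iq)"
  have A: "A \<ge> 1" by (simp add: A_def)
  have "K > 0" using R B' U A unfolding K_def by (intro mult_pos_pos) auto
  moreover have "modn \<eta> p q s (ifourier (\<lambda>\<xi>. \<eta> 0 ((1 / \<rho>) *\<^sub>R (\<xi> - z\<^sub>0)))) \<le> ennreal (K * N powr s * (1 + \<rho>) powr (real CARD('n) * iq))"
    if N: "norm z\<^sub>0 = N" "N \<ge> 1" and \<rho>: "\<rho> > 0" "R + R * \<rho> \<le> N / 2" for N \<rho> :: real and z\<^sub>0 :: "real^'n"
  proof -
    define \<Phi> where "\<Phi> = (\<lambda>\<xi>. \<eta> 0 ((1 / \<rho>) *\<^sub>R (\<xi> - z\<^sub>0)))"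
    note tf = test_function[OF cont[OF 0] B[OF 0] _ _ integrable_ifourier_eta(2)[OF adm 0] \<rho>(1), of R z\<^sub>0, folded \<Phi>_def]
    have z': "\<eta> 0 x = 0" if "norm x > R" for x using z[OF 0, of x] that by simp
    have R': "0 \<le> R" using R by simp
    note tf = tf[OF z' R']
    have ft: "fourier (ifourier \<Phi>) = \<Phi>" by (rule tf(3))
    define F where "F = {k \<in> lattice. norm (k - z\<^sub>0) \<le> R + R * \<rho>}"
    define D where "D = (2 * (R + R * \<rho>) + 1) ^ CARD('n)"
    have Rr: "R + R * \<rho> \<ge> 0" using R \<rho> by simp
    have finF: "finite F" "real (card F) \<le> D"
      unfolding F_def D_def using lattice_ball[OF Rr, of z\<^sub>0] by auto
    have UU: "(\<integral>\<^sup>+x. ennreal (norm (ifourier \<Phi> x)) \<partial>lborel) \<le> ennreal (U + 1)"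
    proof -
      have "(\<integral>\<^sup>+x. ennreal (norm (ifourier \<Phi> x)) \<partial>lborel) = (\<integral>\<^sup>+x. ennreal (norm (ifourier (\<eta> 0) x)) \<partial>lborel)"
        by (rule tf(4))
      also have "\<dots> = ennreal U"
        unfolding U_def using integrable_ifourier_eta(2)[OF adm 0] by (intro nn_integral_eq_integral) auto
      finally show ?thesis by (simp add: ennreal_leI)
    qed
    have bound: "modn \<eta> p q s (ifourier \<Phi>) \<le> ennreal ((2 powr \<bar>s\<bar> * N powr s) * (B' * (U + 1) * A) * D powr iq)"
      unfolding iq_def
    proof (rule modn_le[OF finF(1) _ finF(2)])
      show "F \<subseteq> lattice" by (auto simp: F_def)
      show "D > 0" using Rr by (simp add: D_def)
      show "jb k powr s \<le> 2 powr \<bar>s\<bar> * N powr s" if "k \<in> F" for k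
        using that N \<rho> by (intro jb_powr_le[where z\<^sub>0 = z\<^sub>0]) (auto simp: F_def)
      show "lpn lborel p (box \<eta> k (ifourier \<Phi>)) \<le> ennreal (B' * (U + 1) * A)" if "k \<in> F" for k
      proof -
        have k: "k \<in> lattice" using that by (simp add: F_def)
        show ?thesis unfolding box_def
          by (rule lpn_box_le[OF integrable_ifourier_eta(1)[OF adm k] B'(2)[OF k] _ tf(2) UU])
             (use B' U pq in \<open>auto simp: A_def\<close>)
      qed
      show "lpn lborel p (box \<eta> k (ifourier \<Phi>)) = 0" if "k \<in> lattice - F" for k
      proof -
        have "\<eta> k \<xi> * \<Phi> \<xi> = 0" for \<xi>
        proof (cases "norm (\<xi> - k) \<ge> R")
          case False
          have "norm (k - z\<^sub>0) > R + R * \<rho>" using that by (auto simp: F_def)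
          then have "norm (\<xi> - z\<^sub>0) > R * \<rho>"
            using False norm_triangle_ineq[of "k - \<xi>" "\<xi> - z\<^sub>0"] by (simp add: norm_minus_commute)
          then have "norm ((1 / \<rho>) *\<^sub>R (\<xi> - z\<^sub>0)) > R" using \<rho> by (simp add: less_divide_eq)
          then show ?thesis unfolding \<Phi>_def using z' by simp
        qed (use z that in auto)
        then have "box \<eta> k (ifourier \<Phi>) = ifourier (\<lambda>\<xi>. 0)" unfolding box_def ft by (simp only:)
        then have "box \<eta> k (ifourier \<Phi>) = (\<lambda>x. 0)" by (simp add: ifourier_def fun_eq_iff)
        then have "lpn lborel p (box \<eta> k (ifourier \<Phi>)) \<le> ennreal (0 * 1)"
          by (intro lpn_le) (use pq in auto)
        then show ?thesis by simp
      qed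
    qed (use N B' U A pq in auto)
    have "D powr iq \<le> (2 * R + 1) powr (real CARD('n) * iq) * (1 + \<rho>) powr (real CARD('n) * iq)"
    proof -
      have "D \<le> ((2 * R + 1) * (1 + \<rho>)) ^ CARD('n)"
        unfolding D_def using R \<rho> by (intro power_mono) (auto simp: algebra_simps)
      also have "\<dots> = ((2 * R + 1) * (1 + \<rho>)) powr real CARD('n)"
        using R \<rho> by (simp add: powr_realpow)
      finally have "D powr iq \<le> (((2 * R + 1) * (1 + \<rho>)) powr real CARD('n)) powr iq"
        using iq Rr by (intro powr_mono2) (auto simp: D_def)
      then show ?thesis using R \<rho> by (simp add: powr_powr powr_mult)
    qed
    then have "(2 powr \<bar>s\<bar> * N powr s) * (B' * (U + 1) * A) * D powr iq \<le> (2 powr \<bar>s\<bar> * N powr s) * (B' * (U + 1) * A) *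
        ((2 * R + 1) powr (real CARD('n) * iq) * (1 + \<rho>) powr (real CARD('n) * iq))"
      using B' U A by (intro mult_left_mono) auto
    also have "\<dots> = K * N powr s * (1 + \<rho>) powr (real CARD('n) * iq)"
      unfolding K_def by (simp only: mult_ac)
    finally have "(2 powr \<bar>s\<bar> * N powr s) * (B' * (U + 1) * A) * D powr iq \<le> K * N powr s * (1 + \<rho>) powr (real CARD('n) * iq)" .
    then show ?thesis using bound order.trans ennreal_leI unfolding \<Phi>_def by blast
  qed
  ultimately show ?thesis unfolding iq_def by blast
qed

text \<open>\<open>m\<close> is the packet average divided by the Gaussian mass. \<open>w\<close> is
  the length of the time interval times the volume of the ball of centres, multiplied by the
  Gaussian mass and divided by the overlap. For finite p the p-th power of the norm is at least
  \<open>w\<close> times the p-th power of \<open>m\<close>; the exponent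
  \<open>enn2real (1 / p)\<close> also expresses the case p = \<infinity>.\<close>

lemma stn_packet_lower:
  fixes h :: "real^'n::finite \<Rightarrow> complex" and z\<^sub>0 :: "real^'n"
  defines "G \<equiv> sqrt (2 * pi) ^ CARD('n)"
    and "M\<^sub>2 \<equiv> (\<integral>\<zeta>. gauss \<zeta> * (norm (\<zeta>::real^'n))\<^sup>2 \<partial>lborel)"
  assumes c: "continuous_on UNIV h" and B: "\<And>x. norm (h x) \<le> B" and z: "\<And>x. norm x > R \<Longrightarrow> h x = 0"
    and R: "R \<ge> 0"
    and K: "K \<ge> 0" "\<And>x y. norm (h x - h y) \<le> a / 4 + K * (norm (x - y))\<^sup>2"
    and E: "(K + B * \<beta>\<^sup>2 * 2 powr (\<beta> - 2)) * E * M\<^sub>2 \<le> a / 4 * G"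
    and \<beta>: "\<beta> > 2" and pos: "\<rho> > 0" "\<mu> > 0" "N > 0" "a > 0"
    and scale: "\<mu>\<^sup>2 \<le> E * \<rho>\<^sup>2" "t\<^sub>1 * N powr (\<beta> - 2) * \<mu>\<^sup>2 \<le> E"
    and z0: "norm z\<^sub>0 = N" "R * \<rho> \<le> N" and u: "fourier u = (\<lambda>\<xi>. h ((1 / \<rho>) *\<^sub>R (\<xi> - z\<^sub>0)))"
    and \<sigma>: "0 < \<sigma>" "\<sigma> \<le> N" "\<And>\<kappa>. norm (\<kappa> - z\<^sub>0) \<le> \<sigma> \<Longrightarrow> norm (h ((1 / \<rho>) *\<^sub>R (\<kappa> - z\<^sub>0))) \<ge> a"
    and t: "0 \<le> t\<^sub>0" "t\<^sub>0 < t\<^sub>1" "t\<^sub>1 \<le> 1"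
    and Z: "Z > 0" "\<And>t y. t \<in> {t\<^sub>0..t\<^sub>1} \<Longrightarrow>
       (\<integral>\<^sup>+\<kappa>. indicator (cball z\<^sub>0 \<sigma>) \<kappa> * ennreal (gauss (\<mu> *\<^sub>R (y - (- t *\<^sub>R grad \<beta> \<kappa>)))) \<partial>lborel) \<le> ennreal Z"
    and p: "1 \<le> p"
  defines "m \<equiv> \<mu> ^ CARD('n) * a / (2 * G)"
    and "w \<equiv> (t\<^sub>1 - t\<^sub>0) * (unit_ball_vol (real CARD('n)) * \<sigma> ^ CARD('n) * G / (\<mu> ^ CARD('n) * Z))"
  shows "ennreal (m * w powr enn2real (1 / p)) \<le> stn p (\<lambda>(t, x). schro \<beta> t u x)"
proof -
  let ?F = "\<lambda>(t, x). schro \<beta> t u x"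
  have G: "G > 0" by (simp add: G_def)
  have m: "m > 0" using pos G by (simp add: m_def)
  have [measurable]: "fourier u \<in> borel_measurable borel"
    unfolding u by (rule borel_measurable_continuous_onI) (intro continuous_on_compose2[OF c] continuous_intros, auto)
  have F: "?F \<in> borel_measurable borel" by (rule measurable_schro) measurable
  have [measurable]: "schro \<beta> t u \<in> borel_measurable borel" for t
    unfolding schro_def by (rule measurable_ifourier) measurable
  have low: "ennreal (sqrt (2 * pi) ^ DIM(real^'n) * m) \<le>
      (\<integral>\<^sup>+\<theta>. ennreal (gauss \<theta>) * ennreal (norm (schro \<beta> t u (- t *\<^sub>R grad \<beta> \<kappa> + (1 / \<mu>) *\<^sub>R \<theta>))) \<partial>lborel)"
    if t': "t \<in> {t\<^sub>0..t\<^sub>1}" and \<kappa>: "\<kappa> \<in> cball z\<^sub>0 \<sigma>" for t \<kappa>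
  proof -
    have n: "norm (\<kappa> - z\<^sub>0) \<le> \<sigma>" using \<kappa> by (simp add: dist_norm norm_minus_commute)
    have "t * N powr (\<beta> - 2) * \<mu>\<^sup>2 \<le> t\<^sub>1 * N powr (\<beta> - 2) * \<mu>\<^sup>2"
      using t' by (intro mult_right_mono) auto
    then have s2: "t * N powr (\<beta> - 2) * \<mu>\<^sup>2 \<le> E" using scale(2) by simp
    have n2: "norm \<kappa> \<le> 2 * N" using n norm_triangle_ineq[of "\<kappa> - z\<^sub>0" z\<^sub>0] z0 \<sigma> by simp
    have t0: "0 \<le> t" using t' t by simp
    have eq: "sqrt (2 * pi) ^ DIM(real^'n) * m = \<mu> ^ CARD('n) * a / 2"
      using G by (simp add: m_def G_def)
    show ?thesis
      unfolding eq using packet_lower_bound[OF c B z R K E[unfolded M\<^sub>2_def G_def] \<beta> pos(1,2) t0 pos(3) scale(1) s2 z0 n2 \<sigma>(3)[OF n] u] .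
  qed
  show ?thesis
  proof (cases "p = \<infinity>")
    case True
    \<comment> \<open>Strict positivity matters: \<open>w powr 0\<close> is 1 only for nonzero
      \<open>w\<close>.\<close>
    have "w > 0" unfolding w_def using t \<sigma> G pos Z by (auto intro!: mult_pos_pos divide_pos_pos)
    then have "m * w powr enn2real (1 / p) = m" using True by simp
    moreover have "ennreal m \<le> stn \<infinity> ?F"
    proof (rule stn_ge_infinity[OF F t])
      fix s c assume s: "s \<in> {t\<^sub>0..t\<^sub>1}" and ae: "AE x in lborel. ennreal (norm (?F (s, x))) \<le> c"
      have "z\<^sub>0 \<in> cball z\<^sub>0 \<sigma>" using \<sigma> by simp
      note low' = low[OF s this]
      show "ennreal m \<le> c"
        by (rule sup_lower_bound[OF _ pos(2) m low']) (use ae in auto)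
    qed
    ultimately show ?thesis using True by simp
  next
    case False
    define r where "r = enn2real p"
    have r: "r \<ge> 1" unfolding r_def using enn2real_ge_1[OF p False] .
    define W where "W = unit_ball_vol (real CARD('n)) * \<sigma> ^ CARD('n) * (G * m powr r) / (\<mu> ^ CARD('n) * Z)"
    have W0: "W \<ge> 0" unfolding W_def using \<sigma> G pos Z by auto
    have W: "ennreal W \<le> (\<integral>\<^sup>+x. ennreal (norm (?F (s, x)) powr enn2real p) \<partial>lborel)" if s: "s \<in> {t\<^sub>0..t\<^sub>1}" for s
    proof -
      let ?J = "\<integral>\<^sup>+x. ennreal (norm (schro \<beta> s u x) powr r) \<partial>lborel"
      have "emeasure lborel (cball z\<^sub>0 \<sigma>) * ennreal (sqrt (2 * pi) ^ DIM(real^'n) * m powr r)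
          \<le> ennreal (\<mu> ^ DIM(real^'n)) * ennreal Z * ?J"
        by (rule average_lower_bound[where X = "\<lambda>\<kappa>. - s *\<^sub>R grad \<beta> \<kappa>"])
           (use m r pos low[OF s] Z(2)[OF s] in auto)
      then have *: "ennreal (unit_ball_vol (real CARD('n)) * \<sigma> ^ CARD('n) * (G * m powr r)) \<le> ennreal (\<mu> ^ CARD('n) * Z) * ?J"
        using \<sigma> pos Z G by (simp add: emeasure_cball ennreal_mult[symmetric] G_def)
      have "ennreal W \<le> ?J"
      proof (cases ?J)
        case (real j)
        then have "unit_ball_vol (real CARD('n)) * \<sigma> ^ CARD('n) * (G * m powr r) \<le> (\<mu> ^ CARD('n) * Z) * j"
          using * pos Z by (simp add: ennreal_mult[symmetric])
        then have "W \<le> j" unfolding W_def using pos Z by (simp add: divide_le_eq mult.commute)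
        then show ?thesis using real by (simp add: ennreal_leI)
      qed simp
      then show ?thesis by (simp add: r_def)
    qed
    have "(t\<^sub>1 - t\<^sub>0) * W = w * m powr r" unfolding W_def w_def by simp
    moreover have "w \<ge> 0" unfolding w_def using t \<sigma> G pos Z by auto
    ultimately have "((t\<^sub>1 - t\<^sub>0) * W) powr (1 / r) = m * w powr enn2real (1 / p)"
      using m r False p by (simp add: powr_mult powr_powr enn2real_inverse r_def)
    then show ?thesis using stn_ge_finite[OF F p False t W W0] by (simp add: r_def)
  qed
qed

text \<open>The estimate is assumed only for integrable \<open>u\<close> with integrable transform,
  where the integrals defining the operators converge; the rescaled bumps belong to this
  class.\<close>

theorem theorem1p5:
  fixes \<eta> :: "real^'n::finite \<Rightarrow> real^'n \<Rightarrow> complex"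
    and \<beta> s C :: real and p q :: ennreal
  assumes adm: "admissible \<eta>"
    and beta: "\<beta> > 2"
    and p: "1 \<le> p" and q: "1 \<le> q"
    and est: "\<forall>u :: real^'n \<Rightarrow> complex.
        integrable lborel u \<and> integrable lborel (fourier u) \<and> modn \<eta> p q s u < \<infinity> \<longrightarrow>
        stn p (\<lambda>(t, x). schro \<beta> t u x) \<le> ennreal C * modn \<eta> p q s u"
  shows "s \<ge> max (real CARD('n) * (1 - enn2real (1 / p) - enn2real (1 / q)) - \<beta> * enn2real (1 / p))
                 (real CARD('n) * (\<beta> - 2) * (enn2real (1 / p) - 1 / 2)
                    + real CARD('n) * (enn2real (1 / p) - enn2real (1 / q)))
         \<and> (p \<le> 2 \<and> q \<le> p \<longrightarrow> s \<ge> real CARD('n) * (\<beta> - 2) * (enn2real (1 / p) - 1 / 2))"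
proof -
  define ip iq d where "ip = enn2real (1 / p)" and "iq = enn2real (1 / q)" and "d = real CARD('n)"
  define G where "G = sqrt (2 * pi) ^ CARD('n)"
  define M where "M = (\<integral>\<zeta>. gauss \<zeta> * (norm (\<zeta>::real^'n))\<^sup>2 \<partial>lborel)"
  define V where "V = unit_ball_vol (real CARD('n))"
  have ip: "ip \<ge> 0" and iq: "iq \<ge> 0" and d: "d > 0" and G: "G > 0" and V: "V > 0"
    by (simp_all add: ip_def iq_def d_def G_def V_def)
  have M: "M \<ge> 0" unfolding M_def by (intro integral_nonneg_AE) (auto simp: gauss_nonneg)
  have 0: "0 \<in> (lattice :: (real^'n) set)" by (simp add: lattice_def)
  obtain R B a c where R: "R > 0" and a: "a > 0" and c: "c > 0" "c \<le> R"
    and supp: "\<And>k \<xi>. k \<in> lattice \<Longrightarrow> norm (\<xi> - k) \<ge> R \<Longrightarrow> \<eta> k \<xi> = 0"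
    and cont: "\<And>k. k \<in> lattice \<Longrightarrow> continuous_on UNIV (\<eta> k)"
    and B: "\<And>k \<xi>. k \<in> lattice \<Longrightarrow> norm (\<eta> k \<xi>) \<le> B"
    and low: "\<And>\<xi>. norm \<xi> < c \<Longrightarrow> a \<le> norm (\<eta> 0 \<xi>)"
    using admissible_bump[OF adm] by metis
  have B0: "B \<ge> 0" using B[OF 0, of 0] norm_ge_zero order.trans by blast
  have supp0: "\<eta> 0 x = 0" if "norm x > R" for x using supp[OF 0, of x] that by simp
  obtain K where K: "K \<ge> 0" "\<And>x y. norm (\<eta> 0 x - \<eta> 0 y) \<le> a / 4 + K * (norm (x - y))\<^sup>2"
    by (rule compact_support_modulus[OF cont[OF 0] B[OF 0], where R = R and \<tau> = "a / 4"]) (use supp0 a in auto)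
  define Q where "Q = (K + B * \<beta>\<^sup>2 * 2 powr (\<beta> - 2)) * M"
  have Q: "Q \<ge> 0" unfolding Q_def using K B0 M by simp
  \<comment> \<open>Makes \<open>Q * E\<close> at most a/4 times the Gaussian mass; the added 1
    keeps the denominator positive even if \<open>Q\<close> is 0.\<close>
  define E where "E = a / 4 * G / (Q + 1)"
  have E: "E > 0" unfolding E_def using a G Q by simp
  have QE: "(K + B * \<beta>\<^sup>2 * 2 powr (\<beta> - 2)) * E * M \<le> a / 4 * G"
  proof -
    have "(K + B * \<beta>\<^sup>2 * 2 powr (\<beta> - 2)) * E * M = a / 4 * G * (Q / (Q + 1))"
      unfolding Q_def E_def by (simp add: mult_ac)
    also have "\<dots> \<le> a / 4 * G * 1" using a G Q by (intro mult_left_mono) auto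
    finally show ?thesis by simp
  qed
  obtain D where D: "D > 0" and modn_bound: "\<And>N \<rho> z\<^sub>0. norm z\<^sub>0 = N \<Longrightarrow> N \<ge> 1 \<Longrightarrow> \<rho> > 0 \<Longrightarrow> R + R * \<rho> \<le> N / 2 \<Longrightarrow>
     modn \<eta> p q s (ifourier (\<lambda>\<xi>. \<eta> 0 ((1 / \<rho>) *\<^sub>R (\<xi> - z\<^sub>0)))) \<le> ennreal (D * N powr s * (1 + \<rho>) powr (d * iq))"
    using modn_test_function_le[OF adm p q R supp, of s] unfolding d_def iq_def by blast
  define z\<^sub>0 :: "real \<Rightarrow> real^'n" where "z\<^sub>0 N = N *\<^sub>R axis undefined 1" for N
  have nz: "norm (z\<^sub>0 N) = N" if "N \<ge> 1" for N using that by (simp add: z\<^sub>0_def)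
  \<comment> \<open>For \<rho> \<le> r N this gives R \<rho> \<le> N/4, which together with N \<ge>
    4R yields R + R \<rho> \<le> N/2.\<close>
  define r where "r = min 1 (1 / (4 * R))"
  have r: "r > 0" "r \<le> 1" "R * r \<le> 1 / 4"
  proof -
    have "R * r \<le> R * (1 / (4 * R))" using R by (intro mult_left_mono) (auto simp: r_def)
    then show "R * r \<le> 1 / 4" using R by simp
  qed (use R in \<open>auto simp: r_def\<close>)
  \<comment> \<open>The sign of \<open>C\<close> is unknown and \<open>ennreal C\<close> is 0 for
    negative \<open>C\<close>; \<open>max C 1\<close> is a positive upper bound.\<close>
  define C' where "C' = max C 1 * D"
  \<comment> \<open>The estimate for one bump with its lower and upper bounds inserted. The scales
    \<rho>, \<mu>, the times and the overlap \<open>Z\<close> stay free, so each necessary condition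
    is one choice of them.\<close>
  have key: "(\<mu> ^ CARD('n) * a / (2 * G)) * ((t\<^sub>1 - t\<^sub>0) * (V * (c * \<rho> / 2) ^ CARD('n) * G / (\<mu> ^ CARD('n) * Z))) powr ip
      \<le> C' * N powr s * (1 + \<rho>) powr (d * iq)"
    if N: "N \<ge> 1" "N \<ge> 4 * R" and \<rho>: "0 < \<rho>" "\<rho> \<le> r * N" and \<mu>: "\<mu> > 0"
      and scale: "\<mu>\<^sup>2 \<le> E * \<rho>\<^sup>2" "t\<^sub>1 * N powr (\<beta> - 2) * \<mu>\<^sup>2 \<le> E"
      and t: "0 \<le> t\<^sub>0" "t\<^sub>0 < t\<^sub>1" "t\<^sub>1 \<le> 1"
      and Z: "Z > 0" "\<And>t y. t \<in> {t\<^sub>0..t\<^sub>1} \<Longrightarrow>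
       (\<integral>\<^sup>+\<kappa>. indicator (cball (z\<^sub>0 N) (c * \<rho> / 2)) \<kappa> * ennreal (gauss (\<mu> *\<^sub>R (y - (- t *\<^sub>R grad \<beta> \<kappa>)))) \<partial>lborel) \<le> ennreal Z"
    for N \<rho> \<mu> t\<^sub>0 t\<^sub>1 Z
  proof -
    define \<Phi> where "\<Phi> = (\<lambda>\<xi>. \<eta> 0 ((1 / \<rho>) *\<^sub>R (\<xi> - z\<^sub>0 N)))"
    have R': "0 \<le> R" using R by simp
    note tf = test_function[OF cont[OF 0] B[OF 0] supp0 R' integrable_ifourier_eta(2)[OF adm 0] \<rho>(1), of "z\<^sub>0 N", folded \<Phi>_def]
    have ft: "fourier (ifourier \<Phi>) = \<Phi>" by (rule tf(3))
    have "R * \<rho> \<le> R * (r * N)" using \<rho> R by (intro mult_left_mono) auto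
    also have "\<dots> = (R * r) * N" by simp
    also have "\<dots> \<le> 1 / 4 * N" using r N by (intro mult_right_mono) auto
    finally have R\<rho>: "R * \<rho> \<le> N / 4" by simp
    have c\<rho>: "c * \<rho> \<le> N / 4" using mult_right_mono[OF c(2), of \<rho>] \<rho> R\<rho> by linarith
    have mb: "modn \<eta> p q s (ifourier \<Phi>) \<le> ennreal (D * N powr s * (1 + \<rho>) powr (d * iq))"
      unfolding \<Phi>_def by (rule modn_bound[OF nz]) (use N \<rho> R\<rho> in auto)
    then have "modn \<eta> p q s (ifourier \<Phi>) < \<infinity>" using le_less_trans by fastforce
    moreover have "integrable lborel (ifourier \<Phi>)" by (rule tf(2))
    moreover have "integrable lborel (fourier (ifourier \<Phi>))" unfolding ft by (rule tf(1))
    ultimately have "stn p (\<lambda>(t, x). schro \<beta> t (ifourier \<Phi>) x) \<le> ennreal C * modn \<eta> p q s (ifourier \<Phi>)"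
      using est by blast
    also have "\<dots> \<le> ennreal (max C 1) * ennreal (D * N powr s * (1 + \<rho>) powr (d * iq))"
      by (intro mult_mono ennreal_leI mb) auto
    also have "\<dots> = ennreal (C' * N powr s * (1 + \<rho>) powr (d * iq))"
      using D unfolding C'_def by (simp add: ennreal_mult[symmetric] mult_ac)
    finally have up: "stn p (\<lambda>(t, x). schro \<beta> t (ifourier \<Phi>) x) \<le> ennreal (C' * N powr s * (1 + \<rho>) powr (d * iq))" .
    have "ennreal ((\<mu> ^ CARD('n) * a / (2 * G)) * ((t\<^sub>1 - t\<^sub>0) * (V * (c * \<rho> / 2) ^ CARD('n) * G / (\<mu> ^ CARD('n) * Z))) powr ip)
       \<le> stn p (\<lambda>(t, x). schro \<beta> t (ifourier \<Phi>) x)"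
      unfolding G_def V_def ip_def
    proof (rule stn_packet_lower[where z\<^sub>0 = "z\<^sub>0 N" and N = N and \<rho> = \<rho> and E = E and K = K and B = B and R = R and h = "\<eta> 0"])
      show "fourier (ifourier \<Phi>) = (\<lambda>\<xi>. \<eta> 0 ((1 / \<rho>) *\<^sub>R (\<xi> - z\<^sub>0 N)))" using ft by (simp add: \<Phi>_def)
      show "a \<le> norm (\<eta> 0 ((1 / \<rho>) *\<^sub>R (\<kappa> - z\<^sub>0 N)))" if "norm (\<kappa> - z\<^sub>0 N) \<le> c * \<rho> / 2" for \<kappa>
      proof (rule low)
        have "norm (\<kappa> - z\<^sub>0 N) / \<rho> < c"
          unfolding pos_divide_less_eq[OF \<rho>(1)] using that mult_pos_pos[OF c(1) \<rho>(1)] by linarith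
        then show "norm ((1 / \<rho>) *\<^sub>R (\<kappa> - z\<^sub>0 N)) < c" using \<rho> c by simp
      qed
      show "(K + B * \<beta>\<^sup>2 * 2 powr (\<beta> - 2)) * E * (\<integral>\<zeta>. gauss \<zeta> * (norm (\<zeta>::real^'n))\<^sup>2 \<partial>lborel) \<le> a / 4 * sqrt (2 * pi) ^ CARD('n)"
        using QE unfolding M_def G_def .
      show "c * \<rho> / 2 \<le> N" using c\<rho> N by linarith
      show "R * \<rho> \<le> N" using R\<rho> N by linarith
    qed (use cont[OF 0] B[OF 0] supp0 R' K beta \<rho> \<mu> N a scale nz[OF N(1)] c t Z p in auto)
    then have "ennreal ((\<mu> ^ CARD('n) * a / (2 * G)) * ((t\<^sub>1 - t\<^sub>0) * (V * (c * \<rho> / 2) ^ CARD('n) * G / (\<mu> ^ CARD('n) * Z))) powr ip)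
       \<le> ennreal (C' * N powr s * (1 + \<rho>) powr (d * iq))" using up by (rule order.trans)
    moreover have "0 \<le> C' * N powr s * (1 + \<rho>) powr (d * iq)" using D by (simp add: C'_def)
    ultimately show ?thesis by simp
  qed
  \<comment> \<open>With \<rho> = r N and \<mu> = b N the amplitude condition \<mu>^2 \<le> E
    \<rho>^2 is an equality, and r \<le> 1 gives b^2 \<le> E for the phase condition.\<close>
  define b where "b = sqrt E * r"
  have b: "b > 0" "b\<^sup>2 = E * r\<^sup>2" using E r by (auto simp: b_def power_mult_distrib)
  have r2: "r\<^sup>2 \<le> 1" using r by (simp add: power_le_one)
  have C': "C' \<ge> 0" using D by (simp add: C'_def)
  have pow: "(x * N powr y) ^ CARD('n) = x ^ CARD('n) * N powr (d * y)" if "N \<ge> 1" for x y N :: real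
  proof -
    have "(N powr y) ^ CARD('n) = (N powr y) powr real CARD('n)" using that by (intro powr_realpow[symmetric]) simp
    then show ?thesis by (simp add: power_mult_distrib powr_powr d_def mult.commute)
  qed
  have rhs: "C' * N powr s * (1 + r * N powr \<delta>) powr (d * iq) \<le> C' * 2 powr (d * iq) * N powr (s + \<delta> * d * iq)"
    if N: "N \<ge> 1" and \<delta>: "\<delta> \<ge> 0" for N \<delta> :: real
  proof -
    have "N powr \<delta> \<ge> 1" using N \<delta> by (simp add: ge_one_powr_ge_zero)
    moreover have "r * N powr \<delta> \<le> 1 * N powr \<delta>" using r by (intro mult_right_mono) auto
    ultimately have "1 + r * N powr \<delta> \<le> 2 * N powr \<delta>" by simp
    then have "(1 + r * N powr \<delta>) powr (d * iq) \<le> (2 * N powr \<delta>) powr (d * iq)"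
      using d iq r by (intro powr_mono2) auto
    also have "\<dots> = 2 powr (d * iq) * N powr (\<delta> * d * iq)" by (simp add: powr_mult powr_powr mult.assoc)
    finally have "C' * N powr s * (1 + r * N powr \<delta>) powr (d * iq) \<le> C' * N powr s * (2 powr (d * iq) * N powr (\<delta> * d * iq))"
      using C' by (intro mult_left_mono) auto
    then show ?thesis by (simp add: powr_add mult_ac)
  qed
  \<comment> \<open>Near the focus, \<open>m\<close> grows like N^d, the time interval gives
    N^(-\<beta>), and the ratio of the ball volume to \<mu>^d \<open>Z\<close> gives N^(-d); the
    last two are raised to the power 1/p.\<close>
  have first: "d + (- \<beta> - d) * ip \<le> s + 1 * d * iq"
  proof (rule powr_exponent_le[where c = "b ^ CARD('n) * a / (2 * G) * (G / b ^ CARD('n)) powr ip"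
        and C = "C' * 2 powr (d * iq)" and N\<^sub>0 = "4 * R"])
    show "0 < b ^ CARD('n) * a / (2 * G) * (G / b ^ CARD('n)) powr ip" using b a G by simp
    fix N :: real assume N: "N \<ge> 4 * R" "N \<ge> 1"
    define \<rho> \<mu> where "\<rho> = r * N" and "\<mu> = b * N"
    \<comment> \<open>At such short times the overlap is estimated trivially by
      \<open>gauss \<le> 1\<close>, so \<open>Z\<close> is the volume of the ball of centres and
      cancels against that volume in \<open>key\<close>.\<close>
    define Z where "Z = V * (c * \<rho> / 2) ^ CARD('n)"
    have \<rho>: "\<rho> > 0" and \<mu>: "\<mu> > 0" using r b N by (auto simp: \<rho>_def \<mu>_def)
    have Z: "Z > 0" unfolding Z_def using V c \<rho> by simp
    have "(\<mu> ^ CARD('n) * a / (2 * G)) * ((N powr - \<beta> - 0) * (V * (c * \<rho> / 2) ^ CARD('n) * G / (\<mu> ^ CARD('n) * Z))) powr ip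
      \<le> C' * N powr s * (1 + \<rho>) powr (d * iq)"
    proof (rule key[OF N(2,1) \<rho> _ \<mu>])
      show "\<rho> \<le> r * N" by (simp add: \<rho>_def)
      show "\<mu>\<^sup>2 \<le> E * \<rho>\<^sup>2" using b by (simp add: \<mu>_def \<rho>_def power_mult_distrib)
      have "N powr - \<beta> * N powr (\<beta> - 2) * N\<^sup>2 = 1"
      proof -
        have "N powr - \<beta> * N powr (\<beta> - 2) * N\<^sup>2 = N powr (- \<beta> + (\<beta> - 2) + 2)"
          using N by (simp only: powr_add) simp
        then show ?thesis using N by simp
      qed
      then have "N powr - \<beta> * N powr (\<beta> - 2) * \<mu>\<^sup>2 = b\<^sup>2"
        by (simp add: \<mu>_def power_mult_distrib mult_ac)
      also have "\<dots> \<le> E" using b r2 E by (simp add: mult_left_le)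
      finally show "N powr - \<beta> * N powr (\<beta> - 2) * \<mu>\<^sup>2 \<le> E" .
      show "N powr - \<beta> \<le> 1" using N beta powr_mono[of "-\<beta>" 0 N] by simp
      fix t y
      have "(\<integral>\<^sup>+\<kappa>. indicator (cball (z\<^sub>0 N) (c * \<rho> / 2)) \<kappa> * ennreal (gauss (\<mu> *\<^sub>R (y - (- t *\<^sub>R grad \<beta> \<kappa>)))) \<partial>lborel)
         \<le> (\<integral>\<^sup>+\<kappa>. indicator (cball (z\<^sub>0 N) (c * \<rho> / 2)) \<kappa> \<partial>lborel)"
        by (intro nn_integral_mono) (auto simp: indicator_def gauss_le_1)
      also have "\<dots> = ennreal Z" using c \<rho> by (simp add: emeasure_cball Z_def V_def)
      finally show "(\<integral>\<^sup>+\<kappa>. indicator (cball (z\<^sub>0 N) (c * \<rho> / 2)) \<kappa> * ennreal (gauss (\<mu> *\<^sub>R (y - (- t *\<^sub>R grad \<beta> \<kappa>)))) \<partial>lborel) \<le> ennreal Z" .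
    qed (use N Z in auto)
    also have "\<dots> \<le> C' * 2 powr (d * iq) * N powr (s + 1 * d * iq)"
      using rhs[of N 1] N by (simp add: \<rho>_def)
    also have "(N powr - \<beta> - 0) * (V * (c * \<rho> / 2) ^ CARD('n) * G / (\<mu> ^ CARD('n) * Z)) = G / b ^ CARD('n) * N powr (- \<beta> - d)"
      using pow[OF N(2), of b 1] N b Z c \<rho> V unfolding Z_def \<mu>_def by (simp add: powr_diff powr_minus field_simps)
    also have "\<mu> ^ CARD('n) = b ^ CARD('n) * N powr d"
      using pow[OF N(2), of b 1] N unfolding \<mu>_def by simp
    also have "(b ^ CARD('n) * N powr d * a / (2 * G)) * (G / b ^ CARD('n) * N powr (- \<beta> - d)) powr ip
      = b ^ CARD('n) * a / (2 * G) * (G / b ^ CARD('n)) powr ip * N powr (d + (- \<beta> - d) * ip)"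
      unfolding powr_mult powr_powr powr_add by simp
    finally show "b ^ CARD('n) * a / (2 * G) * (G / b ^ CARD('n)) powr ip * N powr (d + (- \<beta> - d) * ip)
       \<le> C' * 2 powr (d * iq) * N powr (s + 1 * d * iq)" .
  qed
  \<comment> \<open>One computation for \<rho> = r N^\<delta>: \<delta> = 1 yields the second lower
    bound and \<delta> = 0 the third. Here \<open>m\<close> has size \<mu>^d, and \<open>w\<close>
    has size (\<rho> L)^d, the order of the volume over which packet positions spread.\<close>
  have second: "d * (- (\<beta> - 2) / 2) + d * (\<delta> + (\<beta> - 2)) * ip \<le> s + \<delta> * d * iq" if \<delta>: "0 \<le> \<delta>" "\<delta> \<le> 1" for \<delta>
  proof -
    \<comment> \<open>The coefficient of N^(\<delta> + \<beta> - 2) in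
      \<open>c * \<rho> / 2 * L\<close>.\<close>
    define l where "l = c * r / 2 * (\<beta> / (4 * 2 powr (\<beta> - 2)))"
    have l: "l > 0" using c r beta by (simp add: l_def)
    show ?thesis
    proof (rule powr_exponent_le[where c = "b ^ CARD('n) * a / (2 * G) * (V / 2 * l ^ CARD('n)) powr ip"
          and C = "C' * 2 powr (d * iq)" and N\<^sub>0 = "4 * R"])
      show "0 < b ^ CARD('n) * a / (2 * G) * (V / 2 * l ^ CARD('n)) powr ip" using b a G V l by simp
      fix N :: real assume N: "N \<ge> 4 * R" "N \<ge> 1"
      \<comment> \<open>\<mu> is of the largest order for which the phase error t N^(\<beta>-2)
        \<mu>^2 stays below \<open>E\<close> up to t = 1; \<open>L\<close> is the expansion constant
        from the overlap bound.\<close>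
      define \<rho> \<mu> L where "\<rho> = r * N powr \<delta>" and "\<mu> = b * N powr (- (\<beta> - 2) / 2)"
        and "L = \<beta> * (N / 2) powr (\<beta> - 2) / 4"
      define Z where "Z = G / (\<mu> * L) ^ CARD('n)"
      have pos: "\<rho> > 0" "\<mu> > 0" "L > 0" using r b N beta by (auto simp: \<rho>_def \<mu>_def L_def)
      have Z: "Z > 0" unfolding Z_def using G pos by simp
      have \<rho>N: "\<rho> \<le> r * N" unfolding \<rho>_def using powr_mono[OF \<delta>(2) N(2)] N r by (intro mult_left_mono) auto
      have \<mu>2: "\<mu>\<^sup>2 = E * r\<^sup>2 * N powr (- (\<beta> - 2))"
      proof -
        have "(N powr (- (\<beta> - 2) / 2))\<^sup>2 = N powr (- (\<beta> - 2))"
          by (simp add: power2_eq_square powr_add[symmetric])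
        then show ?thesis unfolding \<mu>_def using b by (simp add: power_mult_distrib)
      qed
      have "(\<mu> ^ CARD('n) * a / (2 * G)) * ((1 - 1 / 2) * (V * (c * \<rho> / 2) ^ CARD('n) * G / (\<mu> ^ CARD('n) * Z))) powr ip
        \<le> C' * N powr s * (1 + \<rho>) powr (d * iq)"
      proof (rule key[OF N(2,1) pos(1) \<rho>N pos(2)])
        have "N powr (- (\<beta> - 2)) \<le> 1" using N beta powr_mono[of "- (\<beta> - 2)" 0 N] by simp
        moreover have "1 \<le> (N powr \<delta>)\<^sup>2" using N \<delta> by (simp add: ge_one_powr_ge_zero)
        ultimately show "\<mu>\<^sup>2 \<le> E * \<rho>\<^sup>2"
          unfolding \<mu>2 \<rho>_def power_mult_distrib mult.assoc using E by (intro mult_left_mono) auto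
        have "1 * N powr (\<beta> - 2) * \<mu>\<^sup>2 = E * r\<^sup>2 * (N powr (\<beta> - 2) * N powr (- (\<beta> - 2)))"
          unfolding \<mu>2 by (simp add: mult_ac)
        also have "N powr (\<beta> - 2) * N powr (- (\<beta> - 2)) = 1" using N by (simp add: powr_add[symmetric])
        also have "E * r\<^sup>2 * 1 \<le> E" using r2 E by (simp add: mult_left_le)
        finally show "1 * N powr (\<beta> - 2) * \<mu>\<^sup>2 \<le> E" .
        have "c * \<rho> \<le> R * (r * N)" using c R \<rho>N pos by (intro mult_mono) auto
        also have "\<dots> = (R * r) * N" by simp
        also have "\<dots> \<le> 1 / 4 * N" using r N by (intro mult_right_mono) auto
        finally have c\<rho>: "c * \<rho> / 2 \<le> N / 2" using N by linarith
        show "(\<integral>\<^sup>+\<kappa>. indicator (cball (z\<^sub>0 N) (c * \<rho> / 2)) \<kappa> * ennreal (gauss (\<mu> *\<^sub>R (y - (- t *\<^sub>R grad \<beta> \<kappa>)))) \<partial>lborel) \<le> ennreal Z"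
          if "t \<in> {1 / 2..1}" for t y
          using gauss_overlap_le[OF beta pos(2) _ nz[OF N(2)] _ _ c\<rho>, of t y] that N c pos
          by (simp add: Z_def L_def G_def)
      qed (use Z in auto)
      also have "\<dots> \<le> C' * 2 powr (d * iq) * N powr (s + \<delta> * d * iq)"
        using rhs[OF N(2) \<delta>(1)] by (simp add: \<rho>_def)
      also have "(1 - 1 / 2) * (V * (c * \<rho> / 2) ^ CARD('n) * G / (\<mu> ^ CARD('n) * Z)) = V / 2 * (c * \<rho> / 2 * L) ^ CARD('n)"
        using G pos unfolding Z_def by (simp add: power_mult_distrib field_simps)
      also have "c * \<rho> / 2 * L = l * N powr (\<delta> + (\<beta> - 2))"
        using N unfolding \<rho>_def L_def l_def by (simp add: powr_divide powr_add powr_diff field_simps)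
      also have "V / 2 * (l * N powr (\<delta> + (\<beta> - 2))) ^ CARD('n) = V / 2 * l ^ CARD('n) * N powr (d * (\<delta> + (\<beta> - 2)))"
        unfolding pow[OF N(2)] by simp
      also have "\<mu> ^ CARD('n) = b ^ CARD('n) * N powr (d * (- (\<beta> - 2) / 2))"
        unfolding \<mu>_def by (rule pow[OF N(2)])
      also have "(b ^ CARD('n) * N powr (d * (- (\<beta> - 2) / 2)) * a / (2 * G)) * (V / 2 * l ^ CARD('n) * N powr (d * (\<delta> + (\<beta> - 2)))) powr ip
        = b ^ CARD('n) * a / (2 * G) * (V / 2 * l ^ CARD('n)) powr ip * N powr (d * (- (\<beta> - 2) / 2) + d * (\<delta> + (\<beta> - 2)) * ip)"
        unfolding powr_mult powr_powr powr_add by simp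
      finally show "b ^ CARD('n) * a / (2 * G) * (V / 2 * l ^ CARD('n)) powr ip * N powr (d * (- (\<beta> - 2) / 2) + d * (\<delta> + (\<beta> - 2)) * ip)
         \<le> C' * 2 powr (d * iq) * N powr (s + \<delta> * d * iq)" .
    qed
  qed
  have A: "d * (1 - ip - iq) - \<beta> * ip \<le> s" using first by (simp add: algebra_simps)
  have "d * (\<beta> - 2) * (ip - 1 / 2) + d * (ip - iq) = d * (- (\<beta> - 2) / 2) + d * (1 + (\<beta> - 2)) * ip - 1 * d * iq"
    by (simp add: field_simps)
  then have B: "d * (\<beta> - 2) * (ip - 1 / 2) + d * (ip - iq) \<le> s" using second[of 1] by linarith
  have "d * (\<beta> - 2) * (ip - 1 / 2) = d * (- (\<beta> - 2) / 2) + d * (0 + (\<beta> - 2)) * ip - 0 * d * iq"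
    by (simp add: field_simps)
  then have C: "d * (\<beta> - 2) * (ip - 1 / 2) \<le> s" using second[of 0] by linarith
  show ?thesis
    using A B C unfolding d_def ip_def iq_def by simp
qed

end
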